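(* Let $n=3$, let $v_\infty\in\mathbb{R}^{4,1}$ be non-zero and $t\in\mathbb{R}$. Suppose $\Lambda$ has constant mean curvature $H_\infty$ in $S_{v_\infty}$, that $\alpha_t,L^{\alpha_t}$ are constrained Willmore (real) Bäcklund transformation parameters to $\Lambda$, corresponding to the multiplier $q_\infty^t$, with $p_\infty^t(\alpha_t)\perp L^{\alpha_t}$, and that the constrained Willmore Bäcklund transform $\Lambda^{*_t}$ of $\Lambda$ of parameters $\alpha_t,L^{\alpha_t}$ immerses. Then the mean curvature $H_\infty^{*_t}$ of $\Lambda^{*_t}$ in $S_{v_\infty}$ relates to the mean curvature of $\Lambda$ in $S_{v_\infty}$ by $$H_\infty^{*_t}=H_\infty.$$
   Context: $\mathbb{R}^{4,1}$ has metric $(\,,\,)$ of signature $(4,1)$, extended complex bilinearly to $\mathbb{C}^{5}$; $\mathcal{L}$ is the set of non-zero null vectors of $\mathbb{R}^{4,1}$; $M$ is an oriented surface; $d$ is the trivial flat connection on $M\times\mathbb{R}^{4,1}$ and on $\underline{\mathbb{C}}^5=M\times\mathbb{C}^5$. The theory is local: restriction to a suitable non-empty open subset of $M$ is always understood. $\wedge^{2}\mathbb{R}^{4,1}\cong o(\mathbb{R}^{4,1})$ by $(v_1\wedge v_2)(w)=(w,v_1)v_2-(w,v_2)v_1$; $[\mu\wedge\eta](X,Y)=[\mu_X,\eta_Y]-[\mu_Y,\eta_X]$; $d^\nabla$ is the exterior derivative on endomorphism-valued forms. A surface is a null line subbundle $\Lambda\subset M\times\mathbb{R}^{4,1}$ defining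 an immersion $M\to\mathbb{P}(\mathcal{L})\cong S^3$ (standing assumption: not contained in any $2$-sphere of $S^3$). $M$ carries the conformal structure of the metrics $g_\sigma(X,Y)=(d_X\sigma,d_Y\sigma)$, $\sigma\in\Gamma(\Lambda)$ never-zero; $(1,0)$/$(0,1)$-parts and $*$ (with $*\omega=-\omega\circ J$) refer to it. For a holomorphic chart $z$, $\Lambda^{1,0}=\langle\sigma,\sigma_z\rangle$, $\Lambda^{0,1}=\langle\sigma,\sigma_{\bar z}\rangle$, $\Lambda^{(1)}=\Lambda^{1,0}+\Lambda^{0,1}$, and the central sphere congruence is (complexified) $S=\langle\sigma,\sigma_z,\sigma_{\bar z},\sigma_{z\bar z}\rangle$. $\mathcal{D}:=\pi_S\circ d\circ\pi_S+\pi_{S^\perp}\circ d\circ\pi_{S^\perp}$, $\mathcal{N}:=d-\mathcal{D}$. A real $q\in\Omega^1(\Lambda\wedge\Lambda^{(1)})$ is a multiplier if $d^{\mathcal{D}}q=0$ and $d^{\mathcal{D}}*\mathcal{N}=2[q\wedge*\mathcal{N}]$. Set $d^{\lambda,q}_S:=\mathcal{D}+\lambda^{-1}\mathcal{N}^{1,0}+\lambda\mathcal{N}^{0,1}+(\lambda^{-2}-1)q^{1,0}+(\lambda^2-1)q^{0,1}$. For non-zero $v_\infty\in\mathbb{R}^{4,1}$, $S_{v_\infty}=\{v\in\mathcal{L}:(v,v_\infty)=-1\}$, $\sigma_\infty:=-\sigma/(\sigma,v_\infty)$, and $v_\infty^T,v_\infty^\perp$ are the orthogonal projections of $v_\infty$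 onto $S$ and $S^\perp$. The mean curvature of $\Lambda$ in $S_{v_\infty}$ is $H_\infty:=(v_\infty^\perp,v_\infty^\perp)^{1/2}$ (for another surface, projection onto the normal bundle of its own central sphere congruence is used); $\Lambda$ is CMC in $S_{v_\infty}$ if this is constant. $N$ is the real unit section of $S^\perp$ with $v_\infty^\perp=H_\infty N$ (if $H_\infty=0$, one of the two choices of sign is fixed). For $\Lambda$ CMC in $S_{v_\infty}$: $\eta_\infty:=\frac12\sigma_\infty\wedge dN$, $q_\infty:=H_\infty\eta_\infty$, $q_\infty^t:=q_\infty+t*\eta_\infty$ ($t\in\mathbb{R}$; these are multipliers to $\Lambda$), and $p_\infty^t(\lambda):=\lambda^{-1}\frac12(H_\infty-it)N+v_\infty^T+\lambda\frac12(H_\infty+it)N$. Bäcklund transformation. Let $\rho=\pi_S-\pi_{S^\perp}$. For $a\in\mathbb{C}\backslash\{-1,0,1\}$ and a null line subbundle $L\subset\underline{\mathbb{C}}^{5}$ with $\rho L\cap L^\perp=\{0\}$, let $\pi_L,\pi_{\rho L},\pi_\perp$ be the projections for $\underline{\mathbb{C}}^{5}=L\oplus\rho L\oplus(L\oplus\rho L)^\perp$ and $$p_{a,L}(\lambda)=\tfrac{a-\lambda}{a+\lambda}\pi_L+\pi_\perp+\tfrac{a+\lambda}{a-\lambda}\pi_{\rho L},\qquad q_{a,L}(\lambda)=\tfrac{\lambda-a}{\lambda+a}\pi_L+\pi_\perp+\tfrac{\lambda+a}{\lambda-a}\pi_{\rho L},$$ extended by $p_{a,L}(\infty)=-\pi_L+\pi_\perp-\pi_{\rho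 L}$, $q_{a,L}(\infty)=I$. Real Bäcklund transformation parameters to $\Lambda$ for a multiplier $q$ are $\alpha\in\mathbb{C}\backslash(S^1\cup\{0\})$ and a $d^{\alpha,q}_S$-parallel null line subbundle $L^\alpha$ with, locally, $\rho L^\alpha\cap(L^\alpha)^\perp=\{0\}$ and $\rho\tilde L^\alpha\cap(\tilde L^\alpha)^\perp=\{0\}$, where $\tilde L^\alpha:=q_{\overline\alpha^{-1},\overline{L^\alpha}}(\alpha)L^\alpha$. With $r^*:=p_{\alpha,\tilde L^\alpha}\,q_{\overline\alpha^{-1},\overline{L^\alpha}}$, the Bäcklund transform is $\Lambda^*:=r^*(1)^{-1}\big(r^*(\infty)\Lambda^{1,0}\cap r^*(0)\Lambda^{0,1}\big)$, a real null line bundle; it immerses if it defines an immersion of $M$ into $\mathbb{P}(\mathcal{L})$. *)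

theory Defs
  imports "HOL-Analysis.Analysis"
begin

section \<open>Smooth maps and oriented smooth surfaces\<close>

abbreviation dd :: "('a::real_normed_vector \<Rightarrow> 'b::real_normed_vector) \<Rightarrow> 'a \<Rightarrow> 'a \<Rightarrow> 'b" where
  "dd f z X \<equiv> frechet_derivative f (at z) X"

text \<open>\<open>Ck k U f\<close>: \<open>f\<close> is of class \<open>C^k\<close> on \<open>U\<close> (meaningful for open \<open>U\<close>).\<close>

primrec Ck :: "nat \<Rightarrow> 'a::real_normed_vector set \<Rightarrow> ('a \<Rightarrow> 'b::real_normed_vector) \<Rightarrow> bool" where
  "Ck 0 U f \<longleftrightarrow> continuous_on U f"
| "Ck (Suc k) U f \<longleftrightarrow> (\<forall>x\<in>U. f differentiable (at x)) \<and> (\<forall>v. Ck k U (\<lambda>x. dd f x v))"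

definition smooth_on :: "'a::real_normed_vector set \<Rightarrow> ('a \<Rightarrow> 'b::real_normed_vector) \<Rightarrow> bool" where
  "smooth_on U f \<longleftrightarrow> (\<forall>k. Ck k U f)"

text \<open>A chart is stored as the local parametrisation \<open>(D, \<psi>)\<close> inverse to it: \<open>\<psi>\<close> maps the open set
  \<open>D\<close> of the complex plane homeomorphically onto an open subset of \<open>M\<close>, and the coordinate function
  is \<open>z = \<psi>\<inverse>\<close>. The surface \<open>M\<close> is the whole type.\<close>

type_synonym 'm chart = "complex set \<times> (complex \<Rightarrow> 'm)"

definition chart :: "'m::topological_space chart \<Rightarrow> bool" where
  "chart c \<longleftrightarrow> (case c of (D, \<psi>) \<Rightarrow>
     open D \<and> open (\<psi> ` D) \<and> inj_on \<psi> D \<and> continuous_on D \<psi> \<and>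
     continuous_on (\<psi> ` D) (inv_into D \<psi>))"

definition overlap :: "'m chart \<Rightarrow> 'm chart \<Rightarrow> complex set" where
  "overlap c c' = {z \<in> fst c. snd c z \<in> snd c' ` fst c'}"

definition transition :: "'m chart \<Rightarrow> 'm chart \<Rightarrow> complex \<Rightarrow> complex" where
  "transition c c' z = inv_into (fst c') (snd c') (snd c z)"

text \<open>For a real-linear map \<open>T\<close> of the complex plane, \<open>Im (cnj (T 1) * T \<i>)\<close> is its determinant.\<close>

definition oriented_compatible :: "'m chart \<Rightarrow> 'm chart \<Rightarrow> bool" where
  "oriented_compatible c c' \<longleftrightarrow>
     smooth_on (overlap c c') (transition c c') \<and>
     (\<forall>z\<in>overlap c c'. 0 < Im (cnj (dd (transition c c') z 1) * dd (transition c c') z \<i>))"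

definition oriented_atlas :: "'m::topological_space chart set \<Rightarrow> bool" where
  "oriented_atlas A \<longleftrightarrow> (\<forall>c\<in>A. chart c) \<and> (\<Union>(D, \<psi>)\<in>A. \<psi> ` D) = UNIV \<and>
     (\<forall>c\<in>A. \<forall>c'\<in>A. oriented_compatible c c')"

definition oriented_charts :: "'m::topological_space chart set \<Rightarrow> 'm chart set" where
  "oriented_charts A =
     {c. chart c \<and> (\<forall>c'\<in>A. oriented_compatible c c' \<and> oriented_compatible c' c)}"


section \<open>The space \<open>\<real>\<^sup>4\<^sup>,\<^sup>1\<close> and its complexification\<close>

text \<open>The coordinate with index \<open>0\<close> (which is \<open>5\<close> in the index type) is the timelike one. On
  complex vectors the form is the complex bilinear extension.\<close>

definition lform :: "'a::comm_ring_1 ^ 5 \<Rightarrow> 'a ^ 5 \<Rightarrow> 'a" where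
  "lform x y = (\<Sum>i\<in>UNIV. (if i = 0 then - 1 else 1) * x $ i * y $ i)"

definition cx :: "real ^ 5 \<Rightarrow> complex ^ 5" where
  "cx v = (\<chi> i. complex_of_real (v $ i))"

definition conjv :: "complex ^ 5 \<Rightarrow> complex ^ 5" where
  "conjv v = (\<chi> i. cnj (v $ i))"

definition orth :: "(complex ^ 5) set \<Rightarrow> (complex ^ 5) set" where
  "orth W = {v. \<forall>w\<in>W. lform v w = 0}"

definition setsum2 :: "(complex ^ 5) set \<Rightarrow> (complex ^ 5) set \<Rightarrow> (complex ^ 5) set" where
  "setsum2 V W = {v + w | v w. v \<in> V \<and> w \<in> W}"

text \<open>Projection onto \<open>V\<close> along the complement \<open>W\<close>.\<close>

definition proj :: "(complex ^ 5) set \<Rightarrow> (complex ^ 5) set \<Rightarrow> complex ^ 5 \<Rightarrow> complex ^ 5" where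
  "proj V W x = (THE v. v \<in> V \<and> x - v \<in> W)"

definition wedge :: "complex ^ 5 \<Rightarrow> complex ^ 5 \<Rightarrow> complex ^ 5 \<Rightarrow> complex ^ 5" where
  "wedge v1 v2 w = lform w v1 *s v2 - lform w v2 *s v1"


section \<open>Surfaces in the conformal 3-sphere\<close>

definition frame :: "(complex \<Rightarrow> ('a::real_normed_field ^ 5) set) \<Rightarrow> complex set \<Rightarrow> (complex \<Rightarrow> 'a ^ 5) \<Rightarrow> bool"
  where
  "frame E W s \<longleftrightarrow> open W \<and> smooth_on W s \<and> (\<forall>z\<in>W. s z \<noteq> 0 \<and> E z = vec.span {s z})"

definition null_line_subbundle ::
  "'m chart set \<Rightarrow> ('m \<Rightarrow> ('a::real_normed_field ^ 5) set) \<Rightarrow> bool" where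
  "null_line_subbundle A E \<longleftrightarrow>
     (\<forall>(D, \<psi>)\<in>A. \<forall>z\<in>D. \<exists>W s. z \<in> W \<and> W \<subseteq> D \<and> frame (E \<circ> \<psi>) W s) \<and>
     (\<forall>p. \<forall>u\<in>E p. lform u u = 0)"

text \<open>The differential of \<open>[\<sigma>] : M \<rightarrow> \<P>(\<L>)\<close> at \<open>z\<close> is \<open>X \<mapsto> (\<sigma> \<mapsto> d\<^sub>X \<sigma> mod \<Lambda>)\<close>, whence the condition for
  an immersion.\<close>

definition immerses :: "'m chart set \<Rightarrow> ('m \<Rightarrow> (real ^ 5) set) \<Rightarrow> bool" where
  "immerses A \<Lambda> \<longleftrightarrow> null_line_subbundle A \<Lambda> \<and>
     (\<forall>(D, \<psi>)\<in>A. \<forall>W \<sigma>. W \<subseteq> D \<longrightarrow> frame (\<Lambda> \<circ> \<psi>) W \<sigma> \<longrightarrow>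
        (\<forall>z\<in>W. \<forall>X. dd \<sigma> z X \<in> \<Lambda> (\<psi> z) \<longrightarrow> X = 0))"

text \<open>The 2-spheres of \<open>\<P>(\<L>)\<close> are the sets of null lines orthogonal to a spacelike vector.\<close>

definition surface :: "'m chart set \<Rightarrow> ('m \<Rightarrow> (real ^ 5) set) \<Rightarrow> bool" where
  "surface A \<Lambda> \<longleftrightarrow> immerses A \<Lambda> \<and>
     \<not> (\<exists>w. lform w w > 0 \<and> (\<forall>p. \<forall>u\<in>\<Lambda> p. lform u w = 0))"

text \<open>The holomorphic charts of the conformal structure induced by \<open>\<Lambda>\<close>: oriented charts in which
  multiplication by \<open>\<i>\<close> is isometric for every \<open>g\<^sub>\<sigma>\<close>. That such charts cover \<open>M\<close> is the classical
  theorem on isothermal coordinates, which the libraries lack.\<close>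

definition hol_charts :: "'m::topological_space chart set \<Rightarrow> ('m \<Rightarrow> (real ^ 5) set) \<Rightarrow> 'm chart set" where
  "hol_charts A \<Lambda> = {(D, \<psi>). (D, \<psi>) \<in> oriented_charts A \<and>
     (\<forall>W \<sigma>. W \<subseteq> D \<longrightarrow> frame (\<Lambda> \<circ> \<psi>) W \<sigma> \<longrightarrow>
        (\<forall>z\<in>W. \<forall>X Y. lform (dd \<sigma> z (\<i> * X)) (dd \<sigma> z (\<i> * Y)) = lform (dd \<sigma> z X) (dd \<sigma> z Y)))}"

definition dz :: "(complex \<Rightarrow> complex ^ 5) \<Rightarrow> complex \<Rightarrow> complex ^ 5" where
  "dz f z = (1 / 2) *s (dd f z 1 - \<i> *s dd f z \<i>)"

definition dzbar :: "(complex \<Rightarrow> complex ^ 5) \<Rightarrow> complex \<Rightarrow> complex ^ 5" where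
  "dzbar f z = (1 / 2) *s (dd f z 1 + \<i> *s dd f z \<i>)"

text \<open>\<open>hol_frame_at A \<Lambda> p D \<psi> z W \<sigma>\<close>: near \<open>p\<close>, \<open>\<sigma>\<close> is a never-zero section of \<open>\<Lambda>\<close>, written in the
  holomorphic chart \<open>(D, \<psi>)\<close>, in which \<open>p\<close> has coordinate \<open>z\<close>. The bundles below do not depend on
  the choices.\<close>

definition hol_frame_at ::
  "'m::topological_space chart set \<Rightarrow> ('m \<Rightarrow> (real ^ 5) set) \<Rightarrow> 'm \<Rightarrow>
   complex set \<Rightarrow> (complex \<Rightarrow> 'm) \<Rightarrow> complex \<Rightarrow> complex set \<Rightarrow> (complex \<Rightarrow> real ^ 5) \<Rightarrow> bool" where
  "hol_frame_at A \<Lambda> p D \<psi> z W \<sigma> \<longleftrightarrow>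
     (D, \<psi>) \<in> hol_charts A \<Lambda> \<and> z \<in> W \<and> W \<subseteq> D \<and> \<psi> z = p \<and> frame (\<Lambda> \<circ> \<psi>) W \<sigma>"

definition Lam10 :: "'m::topological_space chart set \<Rightarrow> ('m \<Rightarrow> (real ^ 5) set) \<Rightarrow> 'm \<Rightarrow> (complex ^ 5) set" where
  "Lam10 A \<Lambda> p = (THE V. \<exists>D \<psi> z W \<sigma>. hol_frame_at A \<Lambda> p D \<psi> z W \<sigma> \<and>
     V = vec.span {cx (\<sigma> z), dz (cx \<circ> \<sigma>) z})"

definition Lam01 :: "'m::topological_space chart set \<Rightarrow> ('m \<Rightarrow> (real ^ 5) set) \<Rightarrow> 'm \<Rightarrow> (complex ^ 5) set" where
  "Lam01 A \<Lambda> p = (THE V. \<exists>D \<psi> z W \<sigma>. hol_frame_at A \<Lambda> p D \<psi> z W \<sigma> \<and>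
     V = vec.span {cx (\<sigma> z), dzbar (cx \<circ> \<sigma>) z})"

definition central_sphere ::
  "'m::topological_space chart set \<Rightarrow> ('m \<Rightarrow> (real ^ 5) set) \<Rightarrow> 'm \<Rightarrow> (complex ^ 5) set" where
  "central_sphere A \<Lambda> p = (THE V. \<exists>D \<psi> z W \<sigma>. hol_frame_at A \<Lambda> p D \<psi> z W \<sigma> \<and>
     V = vec.span {cx (\<sigma> z), dz (cx \<circ> \<sigma>) z, dzbar (cx \<circ> \<sigma>) z, dz (dzbar (cx \<circ> \<sigma>)) z})"


section \<open>Connections and multipliers\<close>

text \<open>On a chart domain, a section of the trivial bundle is a function of the coordinate \<open>z\<close>, tangent
  vectors are complex numbers \<open>X\<close>, and an endomorphism-valued 1-form is a function \<open>\<omega> z X w\<close>. In a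
  holomorphic chart \<open>J X = \<i> * X\<close>. A 1-form on \<open>M\<close> is the family of its expressions in the charts.
  Below, \<open>S\<close> is the complexified central sphere congruence in terms of the coordinate.\<close>

type_synonym local_form = "complex \<Rightarrow> complex \<Rightarrow> complex ^ 5 \<Rightarrow> complex ^ 5"

type_synonym 'm form = "'m chart \<Rightarrow> local_form"

definition form10 :: "local_form \<Rightarrow> local_form" where
  "form10 \<omega> z X w = (1 / 2) *s (\<omega> z X w - \<i> *s \<omega> z (\<i> * X) w)"

definition form01 :: "local_form \<Rightarrow> local_form" where
  "form01 \<omega> z X w = (1 / 2) *s (\<omega> z X w + \<i> *s \<omega> z (\<i> * X) w)"

definition star :: "local_form \<Rightarrow> local_form" where
  "star \<omega> z X w = - \<omega> z (\<i> * X) w"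

definition Dcon ::
  "(complex \<Rightarrow> (complex ^ 5) set) \<Rightarrow> (complex \<Rightarrow> complex ^ 5) \<Rightarrow> complex \<Rightarrow> complex \<Rightarrow> complex ^ 5" where
  "Dcon S s z X =
     proj (S z) (orth (S z)) (dd (\<lambda>y. proj (S y) (orth (S y)) (s y)) z X) +
     proj (orth (S z)) (S z) (dd (\<lambda>y. proj (orth (S y)) (S y) (s y)) z X)"

text \<open>\<open>d - \<D>\<close> is tensorial, so it is evaluated on constant sections.\<close>

definition Nform :: "(complex \<Rightarrow> (complex ^ 5) set) \<Rightarrow> local_form" where
  "Nform S z X w = dd (\<lambda>_. w) z X - Dcon S (\<lambda>_. w) z X"

text \<open>\<open>d^\<D> \<omega> (X, Y) = \<D>\<^sub>X (\<omega>\<^sub>Y) - \<D>\<^sub>Y (\<omega>\<^sub>X)\<close> for the commuting constant fields \<open>X\<close>, \<open>Y\<close>, where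
  \<open>(\<D>\<^sub>X B) w = \<D>\<^sub>X (B w) - B (\<D>\<^sub>X w)\<close>; \<open>w\<close> is a constant section.\<close>

definition ext_D ::
  "(complex \<Rightarrow> (complex ^ 5) set) \<Rightarrow> local_form \<Rightarrow> complex \<Rightarrow> complex \<Rightarrow> complex \<Rightarrow> complex ^ 5 \<Rightarrow> complex ^ 5" where
  "ext_D S \<omega> z X Y w =
     (Dcon S (\<lambda>y. \<omega> y Y w) z X - \<omega> z Y (Dcon S (\<lambda>_. w) z X)) -
     (Dcon S (\<lambda>y. \<omega> y X w) z Y - \<omega> z X (Dcon S (\<lambda>_. w) z Y))"

definition wedge_bracket ::
  "local_form \<Rightarrow> local_form \<Rightarrow> complex \<Rightarrow> complex \<Rightarrow> complex \<Rightarrow> complex ^ 5 \<Rightarrow> complex ^ 5" where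
  "wedge_bracket \<mu> \<eta> z X Y w =
     (\<mu> z X (\<eta> z Y w) - \<eta> z Y (\<mu> z X w)) - (\<mu> z Y (\<eta> z X w) - \<eta> z X (\<mu> z Y w))"

definition one_form :: "'m chart set \<Rightarrow> 'm form \<Rightarrow> bool" where
  "one_form C q \<longleftrightarrow>
     (\<forall>c\<in>C. (\<forall>X w. smooth_on (fst c) (\<lambda>z. q c z X w)) \<and>
            (\<forall>z\<in>fst c. (\<forall>w. linear (\<lambda>X. q c z X w)) \<and> (\<forall>X. Vector_Spaces.linear (*s) (*s) (q c z X)))) \<and>
     (\<forall>c\<in>C. \<forall>c'\<in>C. \<forall>z\<in>overlap c c'. \<forall>X w.
        q c z X w = q c' (transition c c' z) (dd (transition c c') z X) w)"

definition multiplier ::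
  "'m::topological_space chart set \<Rightarrow> ('m \<Rightarrow> (real ^ 5) set) \<Rightarrow> 'm form \<Rightarrow> bool" where
  "multiplier A \<Lambda> q \<longleftrightarrow> one_form (hol_charts A \<Lambda>) q \<and>
     (\<forall>c\<in>hol_charts A \<Lambda>. \<forall>z\<in>fst c.
        (\<forall>X. \<exists>u\<in>\<Lambda> (snd c z). \<exists>v\<in>setsum2 (Lam10 A \<Lambda> (snd c z)) (Lam01 A \<Lambda> (snd c z)).
           q c z X = wedge (cx u) v) \<and>
        (\<forall>X w. q c z X (conjv w) = conjv (q c z X w)) \<and>
        (\<forall>X Y w. ext_D (central_sphere A \<Lambda> \<circ> snd c) (q c) z X Y w = 0) \<and>
        (\<forall>X Y w. ext_D (central_sphere A \<Lambda> \<circ> snd c)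
                    (star (Nform (central_sphere A \<Lambda> \<circ> snd c))) z X Y w =
           2 *s wedge_bracket (q c) (star (Nform (central_sphere A \<Lambda> \<circ> snd c))) z X Y w))"

text \<open>The connection \<open>d\<^sub>S^{lam,q}\<close>, for \<open>lam \<noteq> 0\<close>, applied to a section \<open>s\<close> in the direction \<open>X\<close>.\<close>

definition dlam ::
  "(complex \<Rightarrow> (complex ^ 5) set) \<Rightarrow> local_form \<Rightarrow> complex \<Rightarrow>
   (complex \<Rightarrow> complex ^ 5) \<Rightarrow> complex \<Rightarrow> complex \<Rightarrow> complex ^ 5" where
  "dlam S q lam s z X = Dcon S s z X
     + inverse lam *s form10 (Nform S) z X (s z) + lam *s form01 (Nform S) z X (s z)
     + ((inverse lam)\<^sup>2 - 1) *s form10 q z X (s z) + (lam\<^sup>2 - 1) *s form01 q z X (s z)"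

definition parallel ::
  "'m::topological_space chart set \<Rightarrow> ('m \<Rightarrow> (real ^ 5) set) \<Rightarrow> 'm form \<Rightarrow> complex \<Rightarrow>
   ('m \<Rightarrow> (complex ^ 5) set) \<Rightarrow> bool" where
  "parallel A \<Lambda> q lam L \<longleftrightarrow>
     (\<forall>c\<in>hol_charts A \<Lambda>. \<forall>W s. open W \<and> W \<subseteq> fst c \<and> smooth_on W s \<and> (\<forall>z\<in>W. s z \<in> L (snd c z)) \<longrightarrow>
        (\<forall>z\<in>W. \<forall>X. dlam (central_sphere A \<Lambda> \<circ> snd c) (q c) lam s z X \<in> L (snd c z)))"


section \<open>The Baecklund transformation\<close>

text \<open>Here \<open>S\<close> and \<open>L\<close> are the fibres at one point of the surface. The values at \<open>lam = \<infinity>\<close> are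
  separate constants.\<close>

definition rho :: "(complex ^ 5) set \<Rightarrow> complex ^ 5 \<Rightarrow> complex ^ 5" where
  "rho S v = proj S (orth S) v - proj (orth S) S v"

definition piL :: "(complex ^ 5) set \<Rightarrow> (complex ^ 5) set \<Rightarrow> complex ^ 5 \<Rightarrow> complex ^ 5" where
  "piL S L = proj L (setsum2 (rho S ` L) (orth (setsum2 L (rho S ` L))))"

definition piRhoL :: "(complex ^ 5) set \<Rightarrow> (complex ^ 5) set \<Rightarrow> complex ^ 5 \<Rightarrow> complex ^ 5" where
  "piRhoL S L = proj (rho S ` L) (setsum2 L (orth (setsum2 L (rho S ` L))))"

definition piPerp :: "(complex ^ 5) set \<Rightarrow> (complex ^ 5) set \<Rightarrow> complex ^ 5 \<Rightarrow> complex ^ 5" where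
  "piPerp S L = proj (orth (setsum2 L (rho S ` L))) (setsum2 L (rho S ` L))"

definition p_dress ::
  "(complex ^ 5) set \<Rightarrow> complex \<Rightarrow> (complex ^ 5) set \<Rightarrow> complex \<Rightarrow> complex ^ 5 \<Rightarrow> complex ^ 5" where
  "p_dress S a L lam v =
     ((a - lam) / (a + lam)) *s piL S L v + piPerp S L v + ((a + lam) / (a - lam)) *s piRhoL S L v"

definition p_dress_inf ::
  "(complex ^ 5) set \<Rightarrow> (complex ^ 5) set \<Rightarrow> complex ^ 5 \<Rightarrow> complex ^ 5" where
  "p_dress_inf S L v = - piL S L v + piPerp S L v - piRhoL S L v"

definition q_dress ::
  "(complex ^ 5) set \<Rightarrow> complex \<Rightarrow> (complex ^ 5) set \<Rightarrow> complex \<Rightarrow> complex ^ 5 \<Rightarrow> complex ^ 5" where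
  "q_dress S a L lam v =
     ((lam - a) / (lam + a)) *s piL S L v + piPerp S L v + ((lam + a) / (lam - a)) *s piRhoL S L v"

definition q_dress_inf :: "complex ^ 5 \<Rightarrow> complex ^ 5" where
  "q_dress_inf v = v"

definition L_tilde :: "(complex ^ 5) set \<Rightarrow> complex \<Rightarrow> (complex ^ 5) set \<Rightarrow> (complex ^ 5) set" where
  "L_tilde S \<alpha> L = q_dress S (inverse (cnj \<alpha>)) (conjv ` L) \<alpha> ` L"

definition r_star :: "(complex ^ 5) set \<Rightarrow> complex \<Rightarrow> (complex ^ 5) set \<Rightarrow> complex \<Rightarrow> complex ^ 5 \<Rightarrow> complex ^ 5" where
  "r_star S \<alpha> L lam = p_dress S \<alpha> (L_tilde S \<alpha> L) lam \<circ> q_dress S (inverse (cnj \<alpha>)) (conjv ` L) lam"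

definition r_star_inf :: "(complex ^ 5) set \<Rightarrow> complex \<Rightarrow> (complex ^ 5) set \<Rightarrow> complex ^ 5 \<Rightarrow> complex ^ 5" where
  "r_star_inf S \<alpha> L = p_dress_inf S (L_tilde S \<alpha> L) \<circ> q_dress_inf"

definition real_backlund_parameters ::
  "'m::topological_space chart set \<Rightarrow> ('m \<Rightarrow> (real ^ 5) set) \<Rightarrow> 'm form \<Rightarrow> complex \<Rightarrow>
   ('m \<Rightarrow> (complex ^ 5) set) \<Rightarrow> bool" where
  "real_backlund_parameters A \<Lambda> q \<alpha> L \<longleftrightarrow>
     multiplier A \<Lambda> q \<and> \<alpha> \<noteq> 0 \<and> cmod \<alpha> \<noteq> 1 \<and>
     null_line_subbundle A L \<and> parallel A \<Lambda> q \<alpha> L \<and>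
     (\<forall>p. let S = central_sphere A \<Lambda> p; L' = L_tilde S \<alpha> (L p) in
        rho S ` L p \<inter> orth (L p) = {0} \<and> rho S ` L' \<inter> orth L' = {0})"

definition backlund_transform_complex ::
  "'m::topological_space chart set \<Rightarrow> ('m \<Rightarrow> (real ^ 5) set) \<Rightarrow> complex \<Rightarrow>
   ('m \<Rightarrow> (complex ^ 5) set) \<Rightarrow> 'm \<Rightarrow> (complex ^ 5) set" where
  "backlund_transform_complex A \<Lambda> \<alpha> L p =
     (let S = central_sphere A \<Lambda> p in
        inv (r_star S \<alpha> (L p) 1) `
          (r_star_inf S \<alpha> (L p) ` Lam10 A \<Lambda> p \<inter> r_star S \<alpha> (L p) 0 ` Lam01 A \<Lambda> p))"

text \<open>The complex line bundle above is real, i.e. it is the complexification of its real part:\<close>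

definition backlund_transform ::
  "'m::topological_space chart set \<Rightarrow> ('m \<Rightarrow> (real ^ 5) set) \<Rightarrow> complex \<Rightarrow>
   ('m \<Rightarrow> (complex ^ 5) set) \<Rightarrow> 'm \<Rightarrow> (real ^ 5) set" where
  "backlund_transform A \<Lambda> \<alpha> L p = {v. cx v \<in> backlund_transform_complex A \<Lambda> \<alpha> L p}"


section \<open>Constant mean curvature surfaces in space-forms\<close>

definition tangent_part ::
  "'m::topological_space chart set \<Rightarrow> ('m \<Rightarrow> (real ^ 5) set) \<Rightarrow> real ^ 5 \<Rightarrow> 'm \<Rightarrow> complex ^ 5" where
  "tangent_part A \<Lambda> v p = proj (central_sphere A \<Lambda> p) (orth (central_sphere A \<Lambda> p)) (cx v)"

definition normal_part ::
  "'m::topological_space chart set \<Rightarrow> ('m \<Rightarrow> (real ^ 5) set) \<Rightarrow> real ^ 5 \<Rightarrow> 'm \<Rightarrow> complex ^ 5" where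
  "normal_part A \<Lambda> v p = proj (orth (central_sphere A \<Lambda> p)) (central_sphere A \<Lambda> p) (cx v)"

text \<open>\<open>S\<close> is closed under conjugation and \<open>S\<^sup>\<bottom>\<close> is spacelike, so \<open>v\<^sup>\<bottom>\<close> is real and \<open>(v\<^sup>\<bottom>, v\<^sup>\<bottom>)\<close> is a
  non-negative real number.\<close>

definition mean_curvature ::
  "'m::topological_space chart set \<Rightarrow> ('m \<Rightarrow> (real ^ 5) set) \<Rightarrow> real ^ 5 \<Rightarrow> 'm \<Rightarrow> real" where
  "mean_curvature A \<Lambda> v p = sqrt (Re (lform (normal_part A \<Lambda> v p) (normal_part A \<Lambda> v p)))"

definition cmc ::
  "'m::topological_space chart set \<Rightarrow> ('m \<Rightarrow> (real ^ 5) set) \<Rightarrow> real ^ 5 \<Rightarrow> real \<Rightarrow> bool" where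
  "cmc A \<Lambda> v H \<longleftrightarrow> (\<forall>p. mean_curvature A \<Lambda> v p = H)"

definition sigma_inf :: "('m \<Rightarrow> (real ^ 5) set) \<Rightarrow> real ^ 5 \<Rightarrow> 'm \<Rightarrow> real ^ 5" where
  "sigma_inf \<Lambda> v p = (THE s. \<exists>u\<in>\<Lambda> p. u \<noteq> 0 \<and> s = - ((1 / lform u v) *s u))"

text \<open>For \<open>H = 0\<close> this leaves the choice of the sign of \<open>N\<close> open.\<close>

definition unit_normal ::
  "'m::topological_space chart set \<Rightarrow> ('m \<Rightarrow> (real ^ 5) set) \<Rightarrow> real ^ 5 \<Rightarrow> ('m \<Rightarrow> real ^ 5) \<Rightarrow> bool" where
  "unit_normal A \<Lambda> v N \<longleftrightarrow>
     (\<forall>(D, \<psi>)\<in>A. smooth_on D (N \<circ> \<psi>)) \<and>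
     (\<forall>p. cx (N p) \<in> orth (central_sphere A \<Lambda> p) \<and> lform (N p) (N p) = 1 \<and>
          normal_part A \<Lambda> v p = complex_of_real (mean_curvature A \<Lambda> v p) *s cx (N p))"

definition eta_inf :: "('m \<Rightarrow> (real ^ 5) set) \<Rightarrow> real ^ 5 \<Rightarrow> ('m \<Rightarrow> real ^ 5) \<Rightarrow> 'm form" where
  "eta_inf \<Lambda> v N c z X w =
     (1 / 2) *s wedge (cx (sigma_inf \<Lambda> v (snd c z))) (cx (dd (N \<circ> snd c) z X)) w"

definition q_inf ::
  "('m \<Rightarrow> (real ^ 5) set) \<Rightarrow> real ^ 5 \<Rightarrow> real \<Rightarrow> ('m \<Rightarrow> real ^ 5) \<Rightarrow> real \<Rightarrow> 'm form" where
  "q_inf \<Lambda> v H N t c z X w =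
     complex_of_real H *s eta_inf \<Lambda> v N c z X w + complex_of_real t *s star (eta_inf \<Lambda> v N c) z X w"

definition p_inf ::
  "'m::topological_space chart set \<Rightarrow> ('m \<Rightarrow> (real ^ 5) set) \<Rightarrow> real ^ 5 \<Rightarrow> real \<Rightarrow> ('m \<Rightarrow> real ^ 5) \<Rightarrow>
   real \<Rightarrow> complex \<Rightarrow> 'm \<Rightarrow> complex ^ 5" where
  "p_inf A \<Lambda> v H N t lam p =
     (inverse lam * (1 / 2) * (complex_of_real H - \<i> * complex_of_real t)) *s cx (N p)
     + tangent_part A \<Lambda> v p
     + (lam * (1 / 2) * (complex_of_real H + \<i> * complex_of_real t)) *s cx (N p)"

end

theory Submission
  imports Defs
begin

text \<open>Let \<open>n\<close> be the unit normal of the central sphere congruence. A line \<open>L\<close> with \<open>\<rho> L \<inter> L\<^sup>\<bottom> = {0}\<close> is spanned by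
  \<open>n + m\<close> with \<open>m\<close> tangential and \<open>(m, m) = -1\<close>, and the dressing factors \<open>p\<close> and \<open>q\<close> are hyperbolic rotations of
  the plane of \<open>n\<close> and \<open>m\<close>. If \<open>L\<close> is parallel, the gauge transform of the family of flat connections by such a
  factor is again a Laurent polynomial in the spectral parameter, with explicit coefficients. Applied twice, at
  spectral parameter \<open>1\<close>, this shows that \<open>r*(1)\<^sup>-\<^sup>1 n\<close> is orthogonal to the Baecklund transform and to its
  derivatives up to the mixed second one, hence spans the normal bundle of the new central sphere congruence. The
  new mean curvature is therefore the absolute value of \<open>(v, r*(1)\<^sup>-\<^sup>1 n) = (r*(1) p(1), n)\<close>. As \<open>p(\<alpha>)\<close> is
  orthogonal to \<open>L\<close>, the vector \<open>r* p\<close> has no poles besides \<open>0\<close> and \<open>\<infinity>\<close>; its normal component is minus that of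
  \<open>p\<close>, and at \<open>1\<close> it is \<open>- H\<close>.\<close>

section \<open>The bilinear form\<close>

text \<open>The obstacle is the normal bundle of the transform: it depends on second derivatives of
  a line known only as an intersection of two planes. Isotropy gives access to it. The central
  sphere congruence forces \<open>n_z\<close> into \<open>Lam01\<close> and its conjugate into
  \<open>Lam10\<close>. In the dressed operators the derivative of \<open>n\<close> along z lies in
  the image of \<open>Lam01\<close> under \<open>r_star\<close> at 0, and the one along the
  conjugate direction in the image of \<open>Lam10\<close> under \<open>r_star\<close> at infinity.
  At parameter 1 the transform becomes the intersection of these isotropic planes, so orthogonality
  to both derivatives is automatic. The mixed derivative is reached because the conjugate derivative
  of a section stays in the first plane. Two factors occur for reality: conjugation exchanges the
  two directions and replaces the parameter by its inverse conjugate, so the conjugate of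
  \<open>L\<close> is parallel at \<open>inverse (cnj \<alpha>)\<close>. The final sign arises in
  two halves: the q factor reverses the coefficient of \<open>inverse lam\<close> in the normal part
  of \<open>p_inf\<close>, the p factor that of \<open>lam\<close>.\<close>

lemma lform_commute: "lform x y = lform y x"
  by (simp add: lform_def mult_ac)

lemma lform_add_left: "lform (x + y) z = lform x z + lform y z"
  by (simp add: lform_def algebra_simps sum.distrib)

lemma lform_scale_left: "lform (c *s x) y = c * lform x y"
  unfolding lform_def sum_distrib_left by (intro sum.cong) (simp_all add: mult_ac)

lemma lform_add_right: "lform z (x + y) = lform z x + lform z y"
  by (simp add: lform_commute[of z] lform_add_left)

lemma lform_scale_right: "lform y (c *s x) = c * lform y x"
  by (simp add: lform_commute[of y] lform_scale_left)

lemma lform_minus_left: "lform (- x) y = - lform x y"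
  using lform_scale_left[of "- 1" x y] by (simp flip: vector_sneg_minus1)

lemma lform_minus_right: "lform y (- x) = - lform y x"
  using lform_scale_right[of y "- 1" x] by (simp flip: vector_sneg_minus1)

lemma lform_diff_left: "lform (x - y) z = lform x z - lform y z"
  using lform_add_left[of x "- y" z] by (simp add: lform_minus_left)

lemma lform_diff_right: "lform z (x - y) = lform z x - lform z y"
  using lform_add_right[of z x "- y"] by (simp add: lform_minus_right)

lemma lform_zero [simp]: "lform 0 y = 0" "lform y 0 = 0"
  by (simp_all add: lform_def)

lemmas lform_simps = lform_add_left lform_add_right lform_diff_left lform_diff_right
  lform_scale_left lform_scale_right lform_minus_left lform_minus_right

lemma lform_axis_left: "lform (axis i 1) x = (if i = 0 then - 1 else 1) * x $ i"
proof -
  have "lform (axis i 1) x = (\<Sum>j\<in>UNIV. if j = i then (if i = 0 then - 1 else 1) * x $ i else 0)"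
    unfolding lform_def by (intro sum.cong) (auto simp: axis_def)
  then show ?thesis by simp
qed

lemma lform_nondegenerate:
  assumes "\<And>x. lform x y = 0"
  shows "y = 0"
proof -
  have "y $ i = 0" for i
    using assms[of "axis i 1"] by (simp add: lform_axis_left split: if_splits)
  then show ?thesis by (simp add: vec_eq_iff)
qed

section \<open>Hyperbolic rotations\<close>

text \<open>For \<open>(n, n) = 1\<close>, \<open>(m, m) = -1\<close>, \<open>(n, m) = 0\<close> this is \<open>n \<mapsto> C n + D m\<close>, \<open>m \<mapsto> C m + D n\<close>, and the
  identity on the orthogonal complement.\<close>

definition hrot :: "'a::comm_ring_1 ^ 5 \<Rightarrow> 'a ^ 5 \<Rightarrow> 'a \<Rightarrow> 'a \<Rightarrow> 'a ^ 5 \<Rightarrow> 'a ^ 5" where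
  "hrot n m C D x = x + lform x n *s ((C - 1) *s n + D *s m) - lform x m *s ((C - 1) *s m + D *s n)"

definition hpair :: "'a::comm_ring_1 ^ 5 \<Rightarrow> 'a ^ 5 \<Rightarrow> bool" where
  "hpair n m \<longleftrightarrow> lform n n = 1 \<and> lform m m = - 1 \<and> lform n m = 0"

lemma hpairD:
  assumes "hpair n m"
  shows "lform n n = 1" "lform m m = - 1" "lform n m = 0" "lform m n = 0"
  using assms by (auto simp: hpair_def lform_commute)

lemma hrot_add: "hrot n m C D (x + y) = hrot n m C D x + hrot n m C D y"
  by (simp add: hrot_def vec_eq_iff lform_simps) (simp add: algebra_simps)

lemma hrot_scale: "hrot n m C D (c *s x) = c *s hrot n m C D x"
  by (simp add: hrot_def vec_eq_iff lform_simps algebra_simps)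

lemma hrot_minus: "hrot n m C D (- x) = - hrot n m C D x"
  using hrot_scale[of n m C D "- 1" x] by (simp flip: vector_sneg_minus1)

lemma hrot_diff: "hrot n m C D (x - y) = hrot n m C D x - hrot n m C D y"
  using hrot_add[of n m C D x "- y"] by (simp add: hrot_minus)

lemma hrot_n: "hpair n m \<Longrightarrow> hrot n m C D n = C *s n + D *s m"
  by (simp add: hrot_def vec_eq_iff hpairD algebra_simps)

lemma hrot_m: "hpair n m \<Longrightarrow> hrot n m C D m = C *s m + D *s n"
  by (simp add: hrot_def vec_eq_iff hpairD algebra_simps)

lemma hrot_perp: "lform x n = 0 \<Longrightarrow> lform x m = 0 \<Longrightarrow> hrot n m C D x = x"
  by (simp add: hrot_def)

text \<open>On the plane of \<open>n\<close> and \<open>m\<close> the map is multiplication by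
  \<open>C + D * j\<close> with \<open>j * j = 1\<close>, so coefficients multiply as in that ring.
  The sign change of the plane, with coefficients \<open>- 1\<close> and \<open>0\<close>, obeys the
  same rule.\<close>

lemma hrot_hrot:
  assumes "hpair n m"
  shows "hrot n m C' D' (hrot n m C D x) = hrot n m (C' * C + D' * D) (C' * D + D' * C) x"
  using hpairD[OF assms]
  by (simp add: hrot_def vec_eq_iff lform_simps) (simp add: algebra_simps)

lemma hrot_id: "hrot n m 1 0 x = x"
  by (simp add: hrot_def)

lemma hrot_inverse:
  assumes "hpair n m" "C * C - D * D = 1"
  shows "hrot n m C (- D) (hrot n m C D x) = x" "hrot n m C D (hrot n m C (- D) x) = x"
  using assms by (simp_all add: hrot_hrot algebra_simps hrot_id)

text \<open>The part with \<open>C\<close> is symmetric for the form and the part with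
  \<open>D\<close> is skew.\<close>

lemma hrot_adjoint: "lform (hrot n m C D x) y = lform x (hrot n m C (- D) y)"
  by (simp add: hrot_def lform_simps lform_commute[of n] lform_commute[of m] algebra_simps)

lemma hrot_orthogonal:
  assumes "hpair n m" "C * C - D * D = 1"
  shows "lform (hrot n m C D x) (hrot n m C D y) = lform x y"
  by (simp add: hrot_adjoint hrot_inverse[OF assms])

lemma hrot_decomp:
  assumes "hpair n m"
  obtains y where "lform y n = 0" "lform y m = 0" "x = y + lform x n *s n + (- lform x m) *s m"
proof
  let ?y = "x - lform x n *s n + lform x m *s m"
  show "lform ?y n = 0" "lform ?y m = 0" using hpairD[OF assms] by (simp_all add: lform_simps)
  show "x = ?y + lform x n *s n + (- lform x m) *s m" by (simp add: vec_eq_iff)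
qed


section \<open>Dual numbers\<close>

text \<open>A section is recorded at a point by its value and one of its two Wirtinger derivatives, as a vector
  over the dual numbers; Leibniz rules then become identities over a commutative ring.\<close>

datatype dual = Dual (val: complex) (der: complex)

instantiation dual :: comm_ring_1
begin
definition "0 = Dual 0 0"
definition "1 = Dual 1 0"
definition "x + y = Dual (val x + val y) (der x + der y)"
definition "x - y = Dual (val x - val y) (der x - der y)"
definition "- x = Dual (- val x) (- der x)"
definition "x * y = Dual (val x * val y) (der x * val y + val x * der y)"
instance
  by standard (auto simp: zero_dual_def one_dual_def plus_dual_def minus_dual_def uminus_dual_def
      times_dual_def algebra_simps dual.expand)
end

lemma dual_ops [simp]:
  "val 0 = 0" "der 0 = 0" "val 1 = 1" "der 1 = 0"
  "val (x + y) = val x + val y" "der (x + y) = der x + der y"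
  "val (x - y) = val x - val y" "der (x - y) = der x - der y"
  "val (- x) = - val x" "der (- x) = - der x"
  "val (x * y) = val x * val y" "der (x * y) = der x * val y + val x * der y"
  by (simp_all add: zero_dual_def one_dual_def plus_dual_def minus_dual_def uminus_dual_def
      times_dual_def)

lemma val_sum: "val (sum f A) = (\<Sum>i\<in>A. val (f i))"
  by (induction A rule: infinite_finite_induct) auto

lemma der_sum: "der (sum f A) = (\<Sum>i\<in>A. der (f i))"
  by (induction A rule: infinite_finite_induct) auto

definition vval :: "dual ^ 5 \<Rightarrow> complex ^ 5" where "vval x = (\<chi> i. val (x $ i))"
definition vder :: "dual ^ 5 \<Rightarrow> complex ^ 5" where "vder x = (\<chi> i. der (x $ i))"
definition const :: "complex \<Rightarrow> dual" where "const c = Dual c 0"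

lemma const_simps [simp]: "val (const c) = c" "der (const c) = 0"
  by (simp_all add: const_def)

lemma const_ops: "const (a + b) = const a + const b" "const (a - b) = const a - const b"
  "const (a * b) = const a * const b" "const (- a) = - const a" "const 1 = 1" "const 0 = 0"
  by (simp_all add: dual.expand)

lemma vval_ops [simp]: "vval (x + y) = vval x + vval y" "vval (x - y) = vval x - vval y"
  "vval (- x) = - vval x" "vval (c *s x) = val c *s vval x"
  by (simp_all add: vval_def vec_eq_iff)

lemma vder_ops [simp]: "vder (x + y) = vder x + vder y" "vder (x - y) = vder x - vder y"
  "vder (- x) = - vder x" "vder (c *s x) = der c *s vval x + val c *s vder x"
  by (simp_all add: vval_def vder_def vec_eq_iff)

lemma val_sgn [simp]: "val (if b then - 1 else 1) = (if b then - 1 else 1)"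
  "der (if b then - 1 else 1) = 0"
  by simp_all

lemma val_lform: "val (lform x y) = lform (vval x) (vval y)"
  by (simp add: lform_def val_sum vval_def)

lemma der_lform: "der (lform x y) = lform (vder x) (vval y) + lform (vval x) (vder y)"
  by (simp add: lform_def der_sum vval_def vder_def sum.distrib [symmetric] algebra_simps)

lemma vval_hrot [simp]: "vval (hrot n m C D x) = hrot (vval n) (vval m) (val C) (val D) (vval x)"
  by (simp add: hrot_def val_lform)

lemma hpair_vval: "hpair n m \<Longrightarrow> hpair (vval n) (vval m)"
  by (auto simp: hpair_def val_lform [symmetric])

section \<open>Dressing of first-order operators\<close>

text \<open>A metric connection at one point in one direction: the argument is a first-order jet, so
  \<open>der f\<close> is the derivative of the coefficient in the Leibniz rule.\<close>

definition connection :: "(dual ^ 5 \<Rightarrow> complex ^ 5) \<Rightarrow> bool" where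
  "connection nb \<longleftrightarrow> (\<forall>x y. nb (x + y) = nb x + nb y) \<and>
     (\<forall>f x. nb (f *s x) = der f *s vval x + val f *s nb x) \<and>
     (\<forall>x y. der (lform x y) = lform (nb x) (vval y) + lform (vval x) (nb y))"

text \<open>Data of a family quadratic in the spectral variable. \<open>nb\<close> holds everything
  of degree 0, hence also the constant part of the q term; \<open>b\<close> is the derivative of the
  normal and \<open>A\<close> the quadratic coefficient.\<close>

definition lax :: "(dual ^ 5 \<Rightarrow> complex ^ 5) \<Rightarrow> dual ^ 5 \<Rightarrow> complex ^ 5 \<Rightarrow> (complex ^ 5 \<Rightarrow> complex ^ 5) \<Rightarrow> bool" where
  "lax nb n b A \<longleftrightarrow> connection nb \<and> lform n n = 1 \<and> nb n = 0 \<and> lform b (vval n) = 0 \<and>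
     (\<forall>x y. A (x + y) = A x + A y) \<and> (\<forall>c x. A (c *s x) = c *s A x) \<and>
     (\<forall>x y. lform (A x) y = - lform x (A y)) \<and> A (vval n) = 0"

text \<open>The connection \<open>d\<^sub>S^{lam,q}\<close> along \<open>\<partial>\<^sub>z\<close> (then \<open>\<mu>\<close> is \<open>1 / lam\<close>) or along the conjugate field (then \<open>\<mu>\<close>
  is \<open>lam\<close>): the coefficients of \<open>\<mu>\<close> and \<open>\<mu>\<^sup>2\<close> come from \<open>\<N>\<close>, which is \<open>n \<and> b\<close>, and from \<open>q\<close>.\<close>

definition nabla :: "(dual ^ 5 \<Rightarrow> complex ^ 5) \<Rightarrow> dual ^ 5 \<Rightarrow> complex ^ 5 \<Rightarrow> (complex ^ 5 \<Rightarrow> complex ^ 5) \<Rightarrow>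
    complex \<Rightarrow> dual ^ 5 \<Rightarrow> complex ^ 5" where
  "nabla nb n b A \<mu> x = nb x + \<mu> *s (lform (vval x) (vval n) *s b - lform (vval x) b *s vval n)
     + \<mu>\<^sup>2 *s A (vval x)"

text \<open>Conjugation of \<open>F\<close> by a rotation. The inverse rotation, with
  \<open>- D\<close>, acts on jets, so the derivatives of \<open>n\<close> and \<open>m\<close>
  enter, while \<open>const\<close> keeps the coefficients constant along the surface.\<close>

definition gauge_op :: "dual ^ 5 \<Rightarrow> dual ^ 5 \<Rightarrow> complex \<Rightarrow> complex \<Rightarrow> (dual ^ 5 \<Rightarrow> complex ^ 5) \<Rightarrow> dual ^ 5 \<Rightarrow> complex ^ 5" where
  "gauge_op n m C D F x = hrot (vval n) (vval m) C D (F (hrot n m (const C) (- const D) x))"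

lemma connectionD:
  assumes "connection nb"
  shows "nb (x + y) = nb x + nb y" "nb (f *s x) = der f *s vval x + val f *s nb x"
    "lform (nb x) (vval y) + lform (vval x) (nb y) = der (lform x y)"
  using assms by (auto simp: connection_def)

lemma laxD:
  assumes "lax nb n b A"
  shows "connection nb" "lform n n = 1" "nb n = 0" "lform b (vval n) = 0" "lform (vval n) b = 0"
    "A (x + y) = A x + A y" "A (c *s x) = c *s A x" "lform (A x) y = - lform x (A y)" "A (vval n) = 0"
    "lform (A x) (vval n) = 0"
proof -
  note lx = assms[unfolded lax_def]
  show "connection nb" "lform n n = 1" "nb n = 0" and b: "lform b (vval n) = 0"
    and "A (x + y) = A x + A y" "A (c *s x) = c *s A x" and A: "\<And>x y. lform (A x) y = - lform x (A y)"
    and An: "A (vval n) = 0"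
    using lx by blast+
  show "lform (vval n) b = 0" using b by (simp add: lform_commute)
  show "lform (A x) (vval n) = 0" using A[of x "vval n"] by (simp add: An)
qed

text \<open>Two operators with the same Leibniz rule differ by a linear map of values, so comparison
  on \<open>n\<close>, \<open>m\<close> and their complement is enough. This reduces the gauge
  formulas to three computations.\<close>

lemma leibniz_unique:
  fixes F F' :: "dual ^ 5 \<Rightarrow> complex ^ 5"
  assumes F: "\<And>x y. F (x + y) = F x + F y" "\<And>f x. F (f *s x) = der f *s vval x + val f *s F x"
    and F': "\<And>x y. F' (x + y) = F' x + F' y" "\<And>f x. F' (f *s x) = der f *s vval x + val f *s F' x"
    and nm: "hpair n m" and "F n = F' n" "F m = F' m"
    and perp: "\<And>y. lform y n = 0 \<Longrightarrow> lform y m = 0 \<Longrightarrow> F y = F' y"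
  shows "F x = F' x"
proof -
  obtain y where y: "lform y n = 0" "lform y m = 0" "x = y + lform x n *s n + (- lform x m) *s m"
    using hrot_decomp[OF nm] by blast
  show ?thesis
    by (subst (1 2) y(3)) (simp add: F F' assms(6,7) perp[OF y(1,2)] del: vector_sneg_minus1)
qed

lemma gauge_leibniz:
  assumes nm: "hpair n m" and CD: "C * C - D * D = 1"
    and F: "\<And>x y. F (x + y) = F x + F y" "\<And>f x. F (f *s x) = der f *s vval x + val f *s F x"
  shows "gauge_op n m C D F (x + y) = gauge_op n m C D F x + gauge_op n m C D F y"
    "gauge_op n m C D F (f *s x) = der f *s vval x + val f *s gauge_op n m C D F x"
  using hrot_inverse[OF hpair_vval[OF nm] CD]
  by (simp_all add: gauge_op_def hrot_add hrot_scale F)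

lemma connection_gauge:
  assumes nb: "connection nb" and nm: "hpair n m" and CD: "C * C - D * D = 1"
  shows "connection (gauge_op n m C D nb)"
proof -
  have cD: "const C * const C - (- const D) * (- const D) = 1"
    using CD by (simp add: dual.expand flip: const_ops)
  have "der (lform x y) = lform (gauge_op n m C D nb x) (vval y) + lform (vval x) (gauge_op n m C D nb y)" for x y
  proof -
    let ?h = "hrot n m (const C) (- const D)"
    have "der (lform x y) = der (lform (?h x) (?h y))"
      using hrot_orthogonal[OF nm cD] by simp
    also have "\<dots> = lform (nb (?h x)) (vval (?h y)) + lform (vval (?h x)) (nb (?h y))"
      by (simp only: connectionD(3)[OF nb])
    also have "lform (nb (?h x)) (vval (?h y)) = lform (gauge_op n m C D nb x) (vval y)"
      by (simp add: gauge_op_def hrot_adjoint)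
    also have "lform (vval (?h x)) (nb (?h y)) = lform (vval x) (gauge_op n m C D nb y)"
      by (simp add: gauge_op_def hrot_adjoint)
    finally show ?thesis .
  qed
  then show ?thesis
    using gauge_leibniz[OF nm CD connectionD(1,2)[OF nb]] by (simp add: connection_def)
qed

lemma nabla_leibniz:
  assumes "lax nb n b A"
  shows "nabla nb n b A \<mu> (x + y) = nabla nb n b A \<mu> x + nabla nb n b A \<mu> y"
    "nabla nb n b A \<mu> (f *s x) = der f *s vval x + val f *s nabla nb n b A \<mu> x"
  using laxD[OF assms] connectionD[OF laxD(1)[OF assms]]
  by (simp_all add: nabla_def vec_eq_iff lform_simps algebra_simps)

text \<open>The sign change of the plane sends \<open>n\<close> to \<open>- n\<close>, so
  \<open>n\<close> stays parallel for the conjugated connection. The clauses on \<open>A\<close>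
  refer only to \<open>n\<close> and survive unchanged.\<close>

lemma lax_gauge_flip:
  assumes lx: "lax nb n b A" and nm: "hpair n m" and b': "lform b' (vval n) = 0"
  shows "lax (gauge_op n m (- 1) 0 nb) n b' A"
proof -
  have "hrot n m (const (- 1)) (- const 0) n = - n"
    using hrot_n[OF nm, of "- 1" 0] by (simp add: const_ops flip: vector_sneg_minus1)
  moreover have "nb (- n) = 0"
    using connectionD(2)[OF laxD(1)[OF lx], of "- 1" n] laxD(3)[OF lx] by (simp flip: vector_sneg_minus1)
  ultimately have "gauge_op n m (- 1) 0 nb n = 0"
    by (simp only: gauge_op_def) (simp add: hrot_def)
  then show ?thesis
    using lx b' connection_gauge[OF laxD(1)[OF lx] nm, of "- 1" 0] by (auto simp: lax_def)
qed

text \<open>The line spanned by \<open>n + m\<close> is parallel at \<open>\<mu> = e\<close>. Because of this, the gauge transformations below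
  have no poles at \<open>\<plusminus> e\<close>. Along \<open>\<partial>\<^sub>z\<close> (where \<open>e = 1 / a\<close>) the factor \<open>p\<^sub>a\<close> acts as in \<open>gauge_P\<close> and \<open>q\<^sub>a\<close> as in
  \<open>gauge_Q\<close>; along the conjugate field (where \<open>e = a\<close>) the roles are exchanged.\<close>

locale dressing =
  fixes nb n b A m e \<theta>
  assumes lx: "lax nb n b A" and nm: "hpair n m"
    and par: "nabla nb n b A e (n + m) = \<theta> *s (vval n + vval m)"
begin

abbreviation "n0 \<equiv> vval n"
abbreviation "m0 \<equiv> vval m"

lemma nm0: "hpair n0 m0" "lform n0 n0 = 1" "lform m0 m0 = - 1" "lform n0 m0 = 0" "lform m0 n0 = 0"
  using hpair_vval[OF nm] hpairD[OF hpair_vval[OF nm]] by auto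

lemma Am_m: "lform (A m0) m0 = 0" "lform m0 (A m0) = 0"
  using laxD(8)[OF lx, of m0 m0] by (simp_all add: lform_commute)

lemma An: "lform (A x) n0 = 0" "lform n0 (A x) = 0"
  using laxD(10)[OF lx] by (simp_all add: lform_commute)

text \<open>Since \<open>n\<close> is parallel for \<open>nb\<close>, pairing the parallelism
  equation with \<open>n0\<close> determines \<open>\<theta>\<close>; solving the equation then
  gives the derivative of \<open>m\<close>.\<close>

lemma nb_m: "nb m = - (e *s (b + lform m0 b *s m0)) - e\<^sup>2 *s A m0"
proof -
  note [simp] = laxD[OF lx] connectionD(1)[OF laxD(1)[OF lx]] nm0 An
  have "lform (nb m) n0 = 0"
    using connectionD(3)[OF laxD(1)[OF lx], of m n] hpairD[OF nm] by simp
  have eq: "nb m + e *s (b - lform m0 b *s n0) + e\<^sup>2 *s A m0 = \<theta> *s (n0 + m0)"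
    using par by (simp add: nabla_def lform_simps)
  then have "lform (nb m + e *s (b - lform m0 b *s n0) + e\<^sup>2 *s A m0) n0 = lform (\<theta> *s (n0 + m0)) n0"
    by simp
  then have th: "\<theta> = - (e * lform m0 b)"
    using \<open>lform (nb m) n0 = 0\<close> by (simp add: lform_simps)
  have "nb m = \<theta> *s (n0 + m0) - e *s (b - lform m0 b *s n0) - e\<^sup>2 *s A m0"
    unfolding eq[symmetric] by simp
  also have "\<dots> = - (e *s (b + lform m0 b *s m0)) - e\<^sup>2 *s A m0"
    unfolding th by (simp add: vec_eq_iff algebra_simps)
  finally show ?thesis .
qed

text \<open>Read off from the gauged operator on \<open>n\<close>: there
  \<open>D * (\<mu>^2 - e^2) = - 2 * e * \<mu>\<close> turns the quadratic term into a linear one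
  along \<open>A m0\<close>.\<close>

definition bP where "bP = b + (2 * e) *s A m0"

lemma bP_n: "lform bP n0 = 0"
  using laxD[OF lx] by (simp add: bP_def lform_simps An)

text \<open>The relations for \<open>C\<close> and \<open>D\<close> replace each rational
  coefficient by a polynomial in \<open>\<mu>\<close> of degree at most two. At
  \<open>\<mu> = 0\<close> the factor is the sign change of the plane, which explains the new
  connection on the right.\<close>

lemma gauge_P:
  assumes CD: "C * C - D * D = 1" "C * \<mu> + D * e = \<mu>" "C * e + D * \<mu> = - e"
    "D * \<mu>\<^sup>2 = D * e\<^sup>2 - 2 * e * \<mu>" "C * \<mu>\<^sup>2 = C * e\<^sup>2 + (\<mu>\<^sup>2 + e\<^sup>2)"
  shows "gauge_op n m C D (nabla nb n b A \<mu>) x = nabla (gauge_op n m (- 1) 0 nb) n bP A \<mu> x"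
proof (rule leibniz_unique[OF _ _ _ _ nm])
  note lx' = lax_gauge_flip[OF lx nm bP_n]
  note nabla_add = nabla_leibniz[OF lx]
  \<comment> \<open>The component of \<open>b\<close> orthogonal to \<open>n0\<close> and
    \<open>m0\<close>, which every rotation of the plane fixes; the plus sign reflects
    \<open>lform m0 m0 = - 1\<close>.\<close>
  define bp where "bp = b + lform m0 b *s m0"
  have bp: "lform bp n0 = 0" "lform bp m0 = 0"
    using laxD[OF lx] by (simp_all add: bp_def lform_simps nm0 lform_commute[of b m0])
  have nabla_n: "nabla nb n b A \<mu> n = \<mu> *s bp - (\<mu> * lform m0 b) *s m0"
    using laxD[OF lx] nm0 by (simp add: nabla_def bp_def vec_eq_iff algebra_simps)
  have nabla_m: "nabla nb n b A \<mu> m = - (e *s bp) + (\<mu>\<^sup>2 - e\<^sup>2) *s A m0 - (\<mu> * lform m0 b) *s n0"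
    using nm0 by (simp add: nabla_def nb_m bp_def[symmetric] vec_eq_iff algebra_simps)
  have h: "hrot n0 m0 C' D' bp = bp" "hrot n0 m0 C' D' (A m0) = A m0" 
     "hrot n0 m0 C' D' n0 = C' *s n0 + D' *s m0" "hrot n0 m0 C' D' m0 = C' *s m0 + D' *s n0" for C' D'
    by (simp_all add: hrot_perp bp An Am_m hrot_n[OF nm0(1)] hrot_m[OF nm0(1)])
  note hs = hrot_add hrot_diff hrot_minus hrot_scale
  show "gauge_op n m C D (nabla nb n b A \<mu>) (x + y) =
      gauge_op n m C D (nabla nb n b A \<mu>) x + gauge_op n m C D (nabla nb n b A \<mu>) y" for x y
    by (intro gauge_leibniz[OF nm CD(1)] nabla_add)
  show "gauge_op n m C D (nabla nb n b A \<mu>) (f *s x) = der f *s vval x + val f *s gauge_op n m C D (nabla nb n b A \<mu>) x"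
    for f x
    by (intro gauge_leibniz[OF nm CD(1)] nabla_add)
  show "nabla (gauge_op n m (- 1) 0 nb) n bP A \<mu> (x + y) =
      nabla (gauge_op n m (- 1) 0 nb) n bP A \<mu> x + nabla (gauge_op n m (- 1) 0 nb) n bP A \<mu> y" for x y
    by (rule nabla_leibniz[OF lx'])
  show "nabla (gauge_op n m (- 1) 0 nb) n bP A \<mu> (f *s x) =
     der f *s vval x + val f *s nabla (gauge_op n m (- 1) 0 nb) n bP A \<mu> x" for f x
    by (rule nabla_leibniz[OF lx'])
  have "gauge_op n m C D (nabla nb n b A \<mu>) n = 
      (C * \<mu> + D * e) *s bp - (\<mu> * lform m0 b * (C * C - D * D)) *s m0 + (D * e\<^sup>2 - D * \<mu>\<^sup>2) *s A m0"
    unfolding gauge_op_def hrot_n[OF nm] nabla_add nabla_n nabla_m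
    by (simp add: hs h vec_eq_iff algebra_simps)
  also have "\<dots> = \<mu> *s bp - (\<mu> * lform m0 b) *s m0 + (2 * e * \<mu>) *s A m0"
    using CD by simp
  also have "\<dots> = nabla (gauge_op n m (- 1) 0 nb) n bP A \<mu> n"
    using laxD(3,4,5)[OF lx'] laxD(9)[OF lx] nm0
    by (simp add: nabla_def bP_def bp_def lform_simps vec_eq_iff algebra_simps)
  finally show "gauge_op n m C D (nabla nb n b A \<mu>) n = nabla (gauge_op n m (- 1) 0 nb) n bP A \<mu> n" .
  have "gauge_op n m C D (nabla nb n b A \<mu>) m = 
      (- (C * e + D * \<mu>)) *s bp - (\<mu> * lform m0 b * (C * C - D * D)) *s n0 + (C * \<mu>\<^sup>2 - C * e\<^sup>2) *s A m0"
    unfolding gauge_op_def hrot_m[OF nm] nabla_add nabla_n nabla_m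
    by (simp add: hs h vec_eq_iff algebra_simps)
  also have "\<dots> = e *s bp + (\<mu>\<^sup>2 + e\<^sup>2) *s A m0 - (\<mu> * lform m0 b) *s n0"
    using CD by simp
  also have "\<dots> = nabla (gauge_op n m (- 1) 0 nb) n bP A \<mu> m"
  proof -
    have "gauge_op n m (- 1) 0 nb m = e *s bp + e\<^sup>2 *s A m0"
      unfolding gauge_op_def hrot_m[OF nm] connectionD(1,2)[OF laxD(1)[OF lx]] laxD(3)[OF lx]
      by (simp add: nb_m bp_def[symmetric] hs h vec_eq_iff algebra_simps)
    then show ?thesis
      using nm0 by (simp add: nabla_def bP_def lform_simps Am_m vec_eq_iff algebra_simps)
  qed
  finally show "gauge_op n m C D (nabla nb n b A \<mu>) m = nabla (gauge_op n m (- 1) 0 nb) n bP A \<mu> m" .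
  fix y assume y: "lform y n = 0" "lform y m = 0"
  have hy: "hrot n m C' D' y = y" for C' D'
    using y by (rule hrot_perp)
  have y0: "lform (vval y) n0 = 0" "lform (vval y) m0 = 0"
    using y by (simp_all flip: val_lform)
  define \<beta> \<gamma> where "\<beta> = lform (vval y) b" and "\<gamma> = lform (vval y) (A m0)"
  \<comment> \<open>The components of \<open>nb y\<close> and \<open>A (vval y)\<close> fixed by the
    rotations. Differentiating \<open>lform y m = 0\<close> gives the component of
    \<open>nb y\<close> along \<open>m0\<close>.\<close>
  define Y Z where "Y = nb y + (e * \<beta> + e\<^sup>2 * \<gamma>) *s m0" and "Z = A (vval y) - \<gamma> *s m0"
  have nby: "nb y = Y - (e * \<beta> + e\<^sup>2 * \<gamma>) *s m0" and Ay: "A (vval y) = Z + \<gamma> *s m0"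
    by (simp_all add: Y_def Z_def)
  have "lform (nb y) n0 = 0"
    using connectionD(3)[OF laxD(1)[OF lx], of y n] y laxD(3)[OF lx] by simp
  moreover have "lform (nb y) m0 = e * \<beta> + e\<^sup>2 * \<gamma>"
    using connectionD(3)[OF laxD(1)[OF lx], of y m] y y0
    by (simp add: nb_m lform_simps \<beta>_def \<gamma>_def algebra_simps)
  ultimately have Y: "hrot n0 m0 C' D' Y = Y" for C' D'
    by (intro hrot_perp) (simp_all add: Y_def lform_simps nm0)
  have Z: "hrot n0 m0 C' D' Z = Z" for C' D'
    using laxD(8)[OF lx, of "vval y" m0] by (intro hrot_perp) (simp_all add: Z_def lform_simps nm0 An \<gamma>_def)
  have "gauge_op n m C D (nabla nb n b A \<mu>) y = Y + \<mu>\<^sup>2 *s Z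
      + ((C * \<mu>\<^sup>2 - C * e\<^sup>2) * \<gamma> - (C * e + D * \<mu>) * \<beta>) *s m0
      + ((D * \<mu>\<^sup>2 - D * e\<^sup>2) * \<gamma> - (C * \<mu> + D * e) * \<beta>) *s n0"
    unfolding gauge_op_def hy nabla_def nby Ay y0 \<beta>_def[symmetric]
    by (simp add: hs h Y Z vec_eq_iff algebra_simps)
  also have "\<dots> = Y + \<mu>\<^sup>2 *s Z + ((\<mu>\<^sup>2 + e\<^sup>2) * \<gamma> + e * \<beta>) *s m0 - (2 * e * \<mu> * \<gamma> + \<mu> * \<beta>) *s n0"
  proof -
    have c: "C * \<mu>\<^sup>2 - C * e\<^sup>2 = \<mu>\<^sup>2 + e\<^sup>2" "D * \<mu>\<^sup>2 - D * e\<^sup>2 = - (2 * e * \<mu>)"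
      using CD by simp_all
    show ?thesis
      unfolding c CD(2,3) by (simp add: vec_eq_iff algebra_simps)
  qed
  also have "\<dots> = nabla (gauge_op n m (- 1) 0 nb) n bP A \<mu> y"
  proof -
    have "gauge_op n m (- 1) 0 nb y = Y + (e * \<beta> + e\<^sup>2 * \<gamma>) *s m0"
      unfolding gauge_op_def hy nby by (simp add: hs h Y vec_eq_iff)
    then show ?thesis
      by (simp add: nabla_def bP_def lform_simps y0 Ay \<beta>_def[symmetric] \<gamma>_def[symmetric] vec_eq_iff algebra_simps)
  qed
  finally show "gauge_op n m C D (nabla nb n b A \<mu>) y = nabla (gauge_op n m (- 1) 0 nb) n bP A \<mu> y" .
qed

definition "flip = hrot n0 m0 (- 1) 0"
text \<open>The minus sign compensates \<open>flip n0 = - n0\<close> when the linear term, built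
  from \<open>n0\<close> and \<open>bP\<close>, is conjugated by \<open>flip\<close>.\<close>

definition "bQ = - flip bP"
definition "AQ x = flip (A (flip x))"

lemma flip_n: "flip n0 = - n0"
  by (simp add: flip_def hrot_n[OF nm0(1)] vec_eq_iff)

lemma flip_adjoint: "lform (flip x) y = lform x (flip y)"
  by (simp add: flip_def hrot_adjoint)

lemma flip_flip: "flip (flip x) = x"
  by (simp add: flip_def hrot_hrot[OF nm0(1)] hrot_id)

lemma flip_ops: "flip (x + y) = flip x + flip y" "flip (c *s x) = c *s flip x" "flip (- x) = - flip x"
   "flip (x - y) = flip x - flip y"
  by (simp_all add: flip_def hrot_add hrot_scale hrot_minus hrot_diff)

lemma lax_P: "lax (gauge_op n m (- 1) 0 nb) n bP A"
  by (rule lax_gauge_flip[OF lx nm bP_n])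

lemma lax_Q: "lax nb n bQ AQ"
proof -
  have "A (- n0) = 0" using laxD(7)[OF lx, of "- 1" n0] laxD(9)[OF lx] by (simp flip: vector_sneg_minus1)
  then have "AQ n0 = 0" using flip_ops(2)[of 0] by (simp add: AQ_def flip_n)
  moreover have "lform bQ n0 = 0" by (simp add: bQ_def lform_simps flip_adjoint flip_n bP_n)
  ultimately show ?thesis
    using lx unfolding lax_def by (auto simp: AQ_def flip_ops flip_adjoint)
qed

text \<open>This factor is \<open>flip\<close> after the one of \<open>gauge_P\<close>. The extra
  \<open>flip\<close> cancels the one on the connection and is carried by \<open>bQ\<close> and
  \<open>AQ\<close> instead; accordingly the factor is the identity at
  \<open>\<mu> = 0\<close>.\<close>

lemma gauge_Q:
  assumes CD: "C * C - D * D = 1" "C * \<mu> + D * e = \<mu>" "C * e + D * \<mu> = - e"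
    "D * \<mu>\<^sup>2 = D * e\<^sup>2 - 2 * e * \<mu>" "C * \<mu>\<^sup>2 = C * e\<^sup>2 + (\<mu>\<^sup>2 + e\<^sup>2)"
  shows "gauge_op n m (- C) (- D) (nabla nb n b A \<mu>) x = nabla nb n bQ AQ \<mu> x"
proof -
  have t: "hrot n m (const (- 1)) (- const 0) = hrot n m (- 1) 0"
  proof -
    have "const (- 1) = - 1" "- const 0 = 0" by (simp_all add: dual.expand)
    then show ?thesis by simp
  qed
  let ?t = "hrot n m (- 1) 0"
  have "hrot n m (const (- C)) (- const (- D)) x = hrot n m (const C) (- const D) (?t x)"
    by (simp add: hrot_hrot[OF nm] const_ops)
  moreover have "hrot n0 m0 (- C) (- D) z = flip (hrot n0 m0 C D z)" for z
    by (simp add: flip_def hrot_hrot[OF nm0(1)])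
  ultimately have "gauge_op n m (- C) (- D) (nabla nb n b A \<mu>) x = flip (gauge_op n m C D (nabla nb n b A \<mu>) (?t x))"
    by (simp add: gauge_op_def)
  also have "\<dots> = flip (nabla (gauge_op n m (- 1) 0 nb) n bP A \<mu> (?t x))"
    by (simp only: gauge_P[OF CD])
  also have "\<dots> = nabla nb n bQ AQ \<mu> x"
  proof -
    have tt: "?t (?t x) = x" by (simp add: hrot_hrot[OF nm] hrot_id)
    have v: "vval (?t x) = flip (vval x)" by (simp add: flip_def)
    show ?thesis
      unfolding nabla_def gauge_op_def t tt v flip_def[symmetric] flip_ops flip_flip flip_adjoint flip_n AQ_def bQ_def
      by (simp add: vec_eq_iff lform_simps)
  qed
  finally show ?thesis .
qed

end

text \<open>Here \<open>C + D = (\<mu> - e) / (\<mu> + e)\<close> and \<open>C - D\<close> is its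
  inverse. The second and third relations say that the rotation sends \<open>(\<mu>, e)\<close> to
  \<open>(\<mu>, - e)\<close>; the last two express cancellation of the poles at \<open>e\<close>
  and \<open>- e\<close>.\<close>

lemma dressing_coeffs:
  fixes e \<mu> :: complex
  assumes "\<mu>\<^sup>2 \<noteq> e\<^sup>2" "C = (\<mu>\<^sup>2 + e\<^sup>2) / (\<mu>\<^sup>2 - e\<^sup>2)" "D = - (2 * e * \<mu>) / (\<mu>\<^sup>2 - e\<^sup>2)"
  shows "C * C - D * D = 1" "C * \<mu> + D * e = \<mu>" "C * e + D * \<mu> = - e"
    "D * \<mu>\<^sup>2 = D * e\<^sup>2 - 2 * e * \<mu>" "C * \<mu>\<^sup>2 = C * e\<^sup>2 + (\<mu>\<^sup>2 + e\<^sup>2)"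
proof -
  have nz: "\<mu>\<^sup>2 - e\<^sup>2 \<noteq> 0" using assms by simp
  have C: "C * (\<mu>\<^sup>2 - e\<^sup>2) = \<mu>\<^sup>2 + e\<^sup>2" and D: "D * (\<mu>\<^sup>2 - e\<^sup>2) = - (2 * e * \<mu>)"
    using nz assms by simp_all
  have "(C * C - D * D - 1) * (\<mu>\<^sup>2 - e\<^sup>2)\<^sup>2 = 0" using C D by algebra
  then show "C * C - D * D = 1" using nz by simp
  have "(C * \<mu> + D * e - \<mu>) * (\<mu>\<^sup>2 - e\<^sup>2) = 0" using C D by algebra
  then show "C * \<mu> + D * e = \<mu>" using nz by simp
  have "(C * e + D * \<mu> + e) * (\<mu>\<^sup>2 - e\<^sup>2) = 0" using C D by algebra
  then show "C * e + D * \<mu> = - e" using nz by (simp add: eq_neg_iff_add_eq_0)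
  show "D * \<mu>\<^sup>2 = D * e\<^sup>2 - 2 * e * \<mu>" "C * \<mu>\<^sup>2 = C * e\<^sup>2 + (\<mu>\<^sup>2 + e\<^sup>2)"
    using C D by algebra+
qed

section \<open>Smooth maps\<close>

lemma dd_eq: "(f has_derivative f') (at z) \<Longrightarrow> dd f z X = f' X"
  by (metis frechet_derivative_at)

lemma has_derivative_dd: "f differentiable (at z) \<Longrightarrow> (f has_derivative (\<lambda>X. dd f z X)) (at z)"
  by (simp add: frechet_derivative_works)

lemma dd_cong:
  assumes "open U" "z \<in> U" "\<And>y. y \<in> U \<Longrightarrow> f y = g y"
  shows "dd f z X = dd g z X"
proof -
  have "(f has_derivative F) (at z) \<longleftrightarrow> (g has_derivative F) (at z)" for F
    using has_derivative_transform_within_open[OF _ assms(1,2)] assms(3) by metis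
  then show ?thesis by (simp add: frechet_derivative_def)
qed

lemma differentiable_cong_open:
  assumes "open U" "z \<in> U" "\<And>y. y \<in> U \<Longrightarrow> f y = g y"
  shows "f differentiable (at z) \<longleftrightarrow> g differentiable (at z)"
  unfolding differentiable_def
  using has_derivative_transform_within_open[OF _ assms(1,2)] assms(3) by metis

lemma Ck_cong:
  assumes "open U" "\<And>x. x \<in> U \<Longrightarrow> f x = g x"
  shows "Ck k U f \<longleftrightarrow> Ck k U g"
  using assms(2)
proof (induction k arbitrary: f g)
  case 0
  then show ?case using continuous_on_cong by force
next
  case (Suc k)
  have "Ck k U (\<lambda>x. dd f x v) \<longleftrightarrow> Ck k U (\<lambda>x. dd g x v)" for v
    by (rule Suc.IH) (rule dd_cong[OF assms(1) _ Suc.prems])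
  then show ?case
    using differentiable_cong_open[OF assms(1) _ Suc.prems] by simp
qed

lemma Ck_subset: "Ck k U f \<Longrightarrow> V \<subseteq> U \<Longrightarrow> Ck k V f"
  by (induction k arbitrary: f) (auto intro: continuous_on_subset)

lemma Ck_SucD: "Ck (Suc k) U f \<Longrightarrow> Ck k U f"
proof (induction k arbitrary: f)
  case 0
  then show ?case
    by (auto intro!: continuous_at_imp_continuous_on differentiable_imp_continuous_within)
next
  case (Suc k)
  then show ?case by (metis Ck.simps(2))
qed

lemma Ck_SucI:
  assumes "open U" "\<And>x. x \<in> U \<Longrightarrow> (f has_derivative f' x) (at x)" "\<And>v. Ck k U (\<lambda>x. f' x v)"
  shows "Ck (Suc k) U f"
proof -
  have "Ck k U (\<lambda>x. dd f x v)" for v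
    using Ck_cong[OF assms(1), of "\<lambda>x. dd f x v" "\<lambda>x. f' x v" k] dd_eq[OF assms(2)] assms(3) by blast
  then show ?thesis using assms(2) by (auto simp: differentiable_def)
qed

lemma Ck_bounded_linear:
  assumes "open U" "bounded_linear h"
  shows "Ck k U f \<Longrightarrow> Ck k U (\<lambda>x. h (f x))"
proof (induction k arbitrary: f)
  case 0
  then show ?case using bounded_linear.continuous_on[OF assms(2)] by auto
next
  case (Suc k)
  then show ?case
    by (intro Ck_SucI[where f' = "\<lambda>x v. h (dd f x v)"] assms)
      (auto intro!: bounded_linear.has_derivative[OF assms(2)] has_derivative_dd)
qed

lemma Ck_add:
  assumes "open U"
  shows "Ck k U f \<Longrightarrow> Ck k U g \<Longrightarrow> Ck k U (\<lambda>x. f x + g x)"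
proof (induction k arbitrary: f g)
  case 0
  then show ?case by (auto intro: continuous_on_add)
next
  case (Suc k)
  then show ?case
    by (intro Ck_SucI[where f' = "\<lambda>x v. dd f x v + dd g x v"] assms)
      (auto intro!: has_derivative_add has_derivative_dd)
qed

lemma Ck_bilinear:
  assumes "open U" "bounded_bilinear h"
  shows "Ck k U f \<Longrightarrow> Ck k U g \<Longrightarrow> Ck k U (\<lambda>x. h (f x) (g x))"
proof (induction k arbitrary: f g)
  case 0
  then show ?case using bounded_bilinear.continuous_on[OF assms(2)] by auto
next
  case (Suc k)
  then have "Ck k U f" "Ck k U g" using Ck_SucD by blast+
  with Suc show ?case
    by (intro Ck_SucI[where f' = "\<lambda>x v. h (f x) (dd g x v) + h (dd f x v) (g x)"] assms)
      (auto intro!: Ck_add assms bounded_bilinear.FDERIV[OF assms(2)] has_derivative_dd)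
qed

lemma Ck_inverse:
  fixes f :: "'a::real_normed_vector \<Rightarrow> real"
  assumes "open U" "\<And>x. x \<in> U \<Longrightarrow> f x \<noteq> 0"
  shows "Ck k U f \<Longrightarrow> Ck k U (\<lambda>x. inverse (f x))"
proof (induction k)
  case 0
  then show ?case using assms by (auto intro!: continuous_on_inverse)
next
  case (Suc k)
  then have "Ck k U (\<lambda>x. inverse (f x))" using Ck_SucD by blast
  note this [intro]
  have "Ck k U (\<lambda>x. - (inverse (f x) * dd f x v * inverse (f x)))" for v
    using Suc.prems
    by (intro Ck_bounded_linear[OF assms(1) bounded_linear_minus[OF bounded_linear_ident]]
        Ck_bilinear[OF assms(1) bounded_bilinear_mult]) auto
  then show ?case
    using Suc.prems assms
    by (intro Ck_SucI[where f' = "\<lambda>x v. - (inverse (f x) * dd f x v * inverse (f x))"])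
      (auto intro: Deriv.has_derivative_inverse[OF _ has_derivative_dd])
qed

lemma dd_complex:
  assumes "f differentiable (at z)"
  shows "dd f z X = Re X *\<^sub>R dd f z 1 + Im X *\<^sub>R dd f z \<i>"
proof -
  have l: "linear (\<lambda>X. dd f z X)"
    using has_derivative_dd[OF assms] has_derivative_linear by blast
  have "X = Re X *\<^sub>R 1 + Im X *\<^sub>R \<i>" by (simp add: complex_eq_iff)
  then show ?thesis using linear_add[OF l] linear_scale[OF l] by metis
qed

lemma dd_compose:
  assumes "T differentiable (at z)" "f differentiable (at (T z))"
  shows "dd (\<lambda>y. f (T y)) z X = dd f (T z) (dd T z X)" "(\<lambda>y. f (T y)) differentiable (at z)"
  using diff_chain_at[OF has_derivative_dd[OF assms(1)] has_derivative_dd[OF assms(2)]]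
  by (auto simp: o_def differentiable_def intro: dd_eq)

text \<open>\<open>Ck\<close> speaks of derivatives in fixed directions, so the moving direction
  \<open>dd T x v\<close> is expanded in the basis 1, \<open>\<i>\<close> of the complex
  plane.\<close>

lemma Ck_compose:
  fixes T :: "'a::real_normed_vector \<Rightarrow> complex"
  assumes U: "open U" and T: "\<And>k. Ck k U T" "\<And>x. x \<in> U \<Longrightarrow> T x \<in> V"
  shows "Ck k V f \<Longrightarrow> Ck k U (\<lambda>x. f (T x))"
proof (induction k arbitrary: f)
  case 0
  then show ?case using T(1)[of 0] T(2) continuous_on_compose2[of V f U T] by auto
next
  case (Suc k)
  have T1: "T differentiable (at x)" if "x \<in> U" for x using T(1)[of "Suc 0"] that by simp
  have f1: "f differentiable (at (T x))" if "x \<in> U" for x using Suc.prems T(2) that by simp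
  have "Ck k U (\<lambda>x. Re (dd T x v) *\<^sub>R dd f (T x) 1 + Im (dd T x v) *\<^sub>R dd f (T x) \<i>)" for v
  proof -
    have "Ck k U (\<lambda>x. dd T x v)" using T(1)[of "Suc k"] by simp
    moreover have "Ck k U (\<lambda>x. dd f (T x) w)" for w
      using Suc.IH[of "\<lambda>x. dd f x w"] Suc.prems by simp
    ultimately show ?thesis
      by (intro Ck_add U Ck_bilinear[OF U bounded_bilinear_scaleR] Ck_bounded_linear[OF U bounded_linear_Re]
          Ck_bounded_linear[OF U bounded_linear_Im])
  qed
  moreover have "((\<lambda>x. f (T x)) has_derivative
      (\<lambda>v. Re (dd T x v) *\<^sub>R dd f (T x) 1 + Im (dd T x v) *\<^sub>R dd f (T x) \<i>)) (at x)" if "x \<in> U" for x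
    using has_derivative_dd[OF dd_compose(2)[OF T1[OF that] f1[OF that]]]
    by (simp add: dd_compose(1)[OF T1[OF that] f1[OF that]] dd_complex[OF f1[OF that], symmetric])
  ultimately show ?case by (intro Ck_SucI[OF U])
qed

lemma smooth_on_subset: "smooth_on U f \<Longrightarrow> V \<subseteq> U \<Longrightarrow> smooth_on V f"
  unfolding smooth_on_def by (blast intro: Ck_subset)

lemma smooth_on_cong: "open U \<Longrightarrow> (\<And>x. x \<in> U \<Longrightarrow> f x = g x) \<Longrightarrow> smooth_on U f \<longleftrightarrow> smooth_on U g"
  unfolding smooth_on_def using Ck_cong by blast

lemma smooth_on_compose:
  fixes T :: "'a::real_normed_vector \<Rightarrow> complex"
  assumes "open U" "smooth_on U T" "\<And>x. x \<in> U \<Longrightarrow> T x \<in> V" "smooth_on V f"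
  shows "smooth_on U (\<lambda>x. f (T x))"
  using assms Ck_compose unfolding smooth_on_def by blast

lemma smooth_on_bounded_linear:
  "open U \<Longrightarrow> bounded_linear h \<Longrightarrow> smooth_on U f \<Longrightarrow> smooth_on U (\<lambda>x. h (f x))"
  unfolding smooth_on_def using Ck_bounded_linear by blast

lemma smooth_on_bilinear:
  "open U \<Longrightarrow> bounded_bilinear h \<Longrightarrow> smooth_on U f \<Longrightarrow> smooth_on U g \<Longrightarrow> smooth_on U (\<lambda>x. h (f x) (g x))"
  unfolding smooth_on_def using Ck_bilinear by blast

lemma smooth_on_inverse:
  fixes f :: "'a::real_normed_vector \<Rightarrow> real"
  shows "open U \<Longrightarrow> (\<And>x. x \<in> U \<Longrightarrow> f x \<noteq> 0) \<Longrightarrow> smooth_on U f \<Longrightarrow> smooth_on U (\<lambda>x. inverse (f x))"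
  unfolding smooth_on_def using Ck_inverse by blast

lemma smooth_on_differentiable: "smooth_on U f \<Longrightarrow> z \<in> U \<Longrightarrow> f differentiable (at z)"
  unfolding smooth_on_def by (metis Ck.simps(2))

lemma smooth_on_dd: "smooth_on U f \<Longrightarrow> smooth_on U (\<lambda>z. dd f z v)"
  unfolding smooth_on_def by (metis Ck.simps(2))

lemma smooth_on_add: "open U \<Longrightarrow> smooth_on U f \<Longrightarrow> smooth_on U g \<Longrightarrow> smooth_on U (\<lambda>x. f x + g x)"
  unfolding smooth_on_def using Ck_add by blast

lemma smooth_on_continuous: "smooth_on U f \<Longrightarrow> continuous_on U f"
  unfolding smooth_on_def by (metis Ck.simps(1))


section \<open>Wirtinger derivatives\<close>

lemma bounded_bilinear_lform:
  "bounded_bilinear (lform :: 'a::{real_normed_field, euclidean_space} ^ 5 \<Rightarrow> 'a ^ 5 \<Rightarrow> 'a)"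
  unfolding bilinear_conv_bounded_bilinear [symmetric] bilinear_def
  by (auto intro!: linearI simp: lform_simps) (simp_all add: lform_def scaleR_sum_right)

lemma bounded_bilinear_vscale:
  "bounded_bilinear ((*s) :: 'a::{real_normed_field, euclidean_space} \<Rightarrow> 'a ^ 5 \<Rightarrow> 'a ^ 5)"
  unfolding bilinear_conv_bounded_bilinear [symmetric] bilinear_def
  by (auto intro!: linearI simp: vec_eq_iff algebra_simps)

lemma bounded_linear_cx: "bounded_linear cx"
  by (intro linear_conv_bounded_linear[THEN iffD1] linearI) (auto simp: cx_def vec_eq_iff complex_eq_iff)

lemma bounded_linear_conjv: "bounded_linear conjv"
  by (intro linear_conv_bounded_linear[THEN iffD1] linearI) (auto simp: conjv_def vec_eq_iff)

text \<open>Both Wirtinger derivatives in one operator, \<open>s = - \<i>\<close> for z and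
  \<open>s = \<i>\<close> for its conjugate, so that conjugation becomes
  \<open>cnj s\<close>.\<close>

definition pd :: "complex \<Rightarrow> (complex \<Rightarrow> complex ^ 5) \<Rightarrow> complex \<Rightarrow> complex ^ 5" where
  "pd s f z = (1 / 2) *s (dd f z 1 + s *s dd f z \<i>)"

definition spd :: "complex \<Rightarrow> (complex \<Rightarrow> complex) \<Rightarrow> complex \<Rightarrow> complex" where
  "spd s f z = (1 / 2) * (dd f z 1 + s * dd f z \<i>)"

lemma dz_pd: "dz = pd (- \<i>)"
  by (intro ext) (simp add: dz_def pd_def vec_eq_iff)

lemma dzbar_pd: "dzbar = pd \<i>"
  by (intro ext) (simp add: dzbar_def pd_def)

lemma differentiable_lform [derivative_intros]:
  fixes f g :: "complex \<Rightarrow> 'a::{real_normed_field, euclidean_space} ^ 5"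
  shows "f differentiable (at z) \<Longrightarrow> g differentiable (at z) \<Longrightarrow> (\<lambda>z. lform (f z) (g z)) differentiable (at z)"
  unfolding differentiable_def using bounded_bilinear.FDERIV[OF bounded_bilinear_lform] by blast

lemma differentiable_vscale [derivative_intros]:
  fixes g :: "complex \<Rightarrow> 'a::{real_normed_field, euclidean_space} ^ 5"
  shows "f differentiable (at z) \<Longrightarrow> g differentiable (at z) \<Longrightarrow> (\<lambda>z. f z *s g z) differentiable (at z)"
  unfolding differentiable_def using bounded_bilinear.FDERIV[OF bounded_bilinear_vscale] by blast

lemma differentiable_cx [derivative_intros]:
  fixes f :: "complex \<Rightarrow> real ^ 5"
  shows "f differentiable (at z) \<Longrightarrow> (\<lambda>z. cx (f z)) differentiable (at z)"
  unfolding differentiable_def using bounded_linear.has_derivative[OF bounded_linear_cx] by blast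

lemma differentiable_conjv [derivative_intros]:
  fixes f :: "complex \<Rightarrow> complex ^ 5"
  shows "f differentiable (at z) \<Longrightarrow> (\<lambda>z. conjv (f z)) differentiable (at z)"
  unfolding differentiable_def using bounded_linear.has_derivative[OF bounded_linear_conjv] by blast

lemma dd_lform:
  fixes f g :: "complex \<Rightarrow> 'a::{real_normed_field, euclidean_space} ^ 5"
  assumes "f differentiable (at z)" "g differentiable (at z)"
  shows "dd (\<lambda>z. lform (f z) (g z)) z X = lform (f z) (dd g z X) + lform (dd f z X) (g z)"
  using assms
  by (intro dd_eq bounded_bilinear.FDERIV[OF bounded_bilinear_lform] has_derivative_dd)

lemma dd_vscale:
  fixes g :: "complex \<Rightarrow> 'a::{real_normed_field, euclidean_space} ^ 5"
  assumes "f differentiable (at z)" "g differentiable (at z)"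
  shows "dd (\<lambda>z. f z *s g z) z X = f z *s dd g z X + dd f z X *s g z"
  using assms
  by (intro dd_eq bounded_bilinear.FDERIV[OF bounded_bilinear_vscale] has_derivative_dd)

lemma dd_add: "f differentiable (at z) \<Longrightarrow> g differentiable (at z) \<Longrightarrow>
    dd (\<lambda>z. f z + g z) z X = dd f z X + dd g z X"
  by (intro dd_eq has_derivative_add has_derivative_dd)

lemma dd_diff: "f differentiable (at z) \<Longrightarrow> g differentiable (at z) \<Longrightarrow>
    dd (\<lambda>z. f z - g z) z X = dd f z X - dd g z X"
  by (intro dd_eq has_derivative_diff has_derivative_dd)

lemma dd_const: "dd (\<lambda>_. c) z X = 0"
  by (rule dd_eq) auto

lemma dd_cx: "f differentiable (at z) \<Longrightarrow> dd (\<lambda>z. cx (f z)) z X = cx (dd f z X)"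
  for f :: "complex \<Rightarrow> real ^ 5"
  by (intro dd_eq bounded_linear.has_derivative[OF bounded_linear_cx] has_derivative_dd)

lemma dd_conjv: "f differentiable (at z) \<Longrightarrow> dd (\<lambda>z. conjv (f z)) z X = conjv (dd f z X)"
  for f :: "complex \<Rightarrow> complex ^ 5"
  by (intro dd_eq bounded_linear.has_derivative[OF bounded_linear_conjv] has_derivative_dd)

lemma pd_add: "f differentiable (at z) \<Longrightarrow> g differentiable (at z) \<Longrightarrow>
    pd s (\<lambda>z. f z + g z) z = pd s f z + pd s g z"
  by (simp add: pd_def dd_add vec_eq_iff algebra_simps)

lemma pd_diff: "f differentiable (at z) \<Longrightarrow> g differentiable (at z) \<Longrightarrow>
    pd s (\<lambda>z. f z - g z) z = pd s f z - pd s g z"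
  by (simp add: pd_def dd_diff vec_eq_iff algebra_simps diff_divide_distrib)

lemma pd_vscale: "f differentiable (at z) \<Longrightarrow> g differentiable (at z) \<Longrightarrow>
    pd s (\<lambda>z. f z *s g z) z = spd s f z *s g z + f z *s pd s g z"
  by (simp add: pd_def spd_def dd_vscale vec_eq_iff algebra_simps)

lemma spd_lform: "f differentiable (at z) \<Longrightarrow> g differentiable (at z) \<Longrightarrow>
    spd s (\<lambda>z. lform (f z) (g z)) z = lform (pd s f z) (g z) + lform (f z) (pd s g z)"
  by (simp add: pd_def spd_def dd_lform lform_simps algebra_simps)

lemma spd_const: "spd s (\<lambda>_. c) z = 0"
  by (simp add: spd_def dd_const)

lemma spd_eq_0:
  assumes "open U" "z \<in> U" "\<And>y. y \<in> U \<Longrightarrow> f y = c"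
  shows "spd s f z = 0"
proof -
  have "dd f z X = dd (\<lambda>_. c) z X" for X
    by (rule dd_cong[OF assms(1,2)]) (simp add: assms)
  then show ?thesis by (simp add: spd_def dd_const)
qed

lemma pd_cong:
  assumes "open U" "z \<in> U" "\<And>y. y \<in> U \<Longrightarrow> f y = g y"
  shows "pd s f z = pd s g z"
  unfolding pd_def using dd_cong[OF assms, of "\<lambda>x. x"] by simp

lemma conjv_ops: "conjv (x + y) = conjv x + conjv y" "conjv (c *s x) = cnj c *s conjv x"
  "conjv (x - y) = conjv x - conjv y" "conjv (conjv x) = x" "conjv (cx r) = cx r" "conjv (- x) = - conjv x"
  by (simp_all add: conjv_def cx_def vec_eq_iff)

lemma lform_conjv: "lform (conjv x) (conjv y) = cnj (lform x y)"
  by (simp add: lform_def conjv_def) (intro sum.cong, auto)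

lemma lform_cx: "lform (cx x) (cx y) = complex_of_real (lform x y)"
  by (simp add: lform_def cx_def) (intro sum.cong, auto)

lemma pd_conjv: "f differentiable (at z) \<Longrightarrow> pd s (\<lambda>z. conjv (f z)) z = conjv (pd (cnj s) f z)"
  by (simp add: pd_def dd_conjv conjv_ops)

text \<open>The passage from functions to dual numbers: by the product rules it respects sums,
  scalar multiplication and the form, hence also \<open>hrot\<close>.\<close>

definition jet :: "complex \<Rightarrow> (complex \<Rightarrow> complex ^ 5) \<Rightarrow> complex \<Rightarrow> dual ^ 5" where
  "jet s f z = (\<chi> i. Dual (f z $ i) (pd s f z $ i))"

definition sjet :: "complex \<Rightarrow> (complex \<Rightarrow> complex) \<Rightarrow> complex \<Rightarrow> dual" where
  "sjet s f z = Dual (f z) (spd s f z)"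

lemma jet_simps [simp]: "vval (jet s f z) = f z" "vder (jet s f z) = pd s f z"
  "val (sjet s g z) = g z" "der (sjet s g z) = spd s g z"
  by (simp_all add: jet_def sjet_def vval_def vder_def)

lemma jet_eqI: "vval x = vval y \<Longrightarrow> vder x = vder y \<Longrightarrow> x = y"
  by (auto simp: vval_def vder_def vec_eq_iff dual.expand)

lemma jet_add: "f differentiable (at z) \<Longrightarrow> g differentiable (at z) \<Longrightarrow>
    jet s (\<lambda>z. f z + g z) z = jet s f z + jet s g z"
  by (intro jet_eqI) (simp_all add: pd_add)

lemma jet_diff: "f differentiable (at z) \<Longrightarrow> g differentiable (at z) \<Longrightarrow>
    jet s (\<lambda>z. f z - g z) z = jet s f z - jet s g z"
  by (intro jet_eqI) (simp_all add: pd_diff)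

lemma jet_vscale: "f differentiable (at z) \<Longrightarrow> g differentiable (at z) \<Longrightarrow>
    jet s (\<lambda>z. f z *s g z) z = sjet s f z *s jet s g z"
  by (intro jet_eqI) (simp_all add: pd_vscale)

lemma sjet_lform: "f differentiable (at z) \<Longrightarrow> g differentiable (at z) \<Longrightarrow>
    sjet s (\<lambda>z. lform (f z) (g z)) z = lform (jet s f z) (jet s g z)"
  by (intro dual.expand) (simp_all add: spd_lform val_lform der_lform)

lemma sjet_const: "sjet s (\<lambda>_. c) z = const c"
  by (intro dual.expand) (simp_all add: spd_const)

lemma jet_cong:
  assumes "open U" "z \<in> U" "\<And>y. y \<in> U \<Longrightarrow> f y = g y"
  shows "jet s f z = jet s g z"
  using assms by (intro jet_eqI) (simp_all add: pd_cong[OF assms])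

lemma sjet_cong:
  assumes "open U" "z \<in> U" "\<And>y. y \<in> U \<Longrightarrow> f y = g y"
  shows "sjet s f z = sjet s g z"
  using assms dd_cong[OF assms, of "\<lambda>x. x"] by (intro dual.expand) (simp_all add: spd_def)

lemma differentiable_hrot [derivative_intros]:
  fixes f :: "complex \<Rightarrow> complex ^ 5"
  assumes "n differentiable (at z)" "m differentiable (at z)" "f differentiable (at z)"
  shows "(\<lambda>z. hrot (n z) (m z) C D (f z)) differentiable (at z)"
  unfolding hrot_def by (intro derivative_intros differentiable_add differentiable_diff differentiable_const assms)

lemma jet_hrot:
  assumes "n differentiable (at z)" "m differentiable (at z)" "f differentiable (at z)"
  shows "jet s (\<lambda>z. hrot (n z) (m z) C D (f z)) z
    = hrot (jet s n z) (jet s m z) (const C) (const D) (jet s f z)"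
proof -
  note d = derivative_intros differentiable_add differentiable_diff differentiable_const assms
  show ?thesis
    unfolding hrot_def
    by (simp only: jet_add jet_diff jet_vscale sjet_lform sjet_const const_ops(2)[symmetric]
        const_ops(5)[symmetric] assms d)
qed

section \<open>The fibres\<close>

lemma span_singleton: "vec.span {v} = range (\<lambda>c. c *s v)" for v :: "'a::field ^ 'n"
  using vec.span_singleton[of v] by auto

lemma mem_orth: "x \<in> orth W \<longleftrightarrow> (\<forall>w\<in>W. lform x w = 0)"
  by (simp add: orth_def)

lemma range_scale_diff:
  "y \<in> range (\<lambda>c. c *s v) \<Longrightarrow> y' \<in> range (\<lambda>c. c *s v) \<Longrightarrow> y - y' \<in> range (\<lambda>c. c *s v)"
  for v :: "'a::field ^ 'n"
  by (auto simp flip: vector_sub_rdistrib)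

lemma proj_eqI:
  assumes "v \<in> V" "x - v \<in> W" "\<And>y. y \<in> V \<Longrightarrow> y \<in> W \<Longrightarrow> y = 0"
    and "\<And>y y'. y \<in> V \<Longrightarrow> y' \<in> V \<Longrightarrow> y - y' \<in> V" "\<And>y y'. y \<in> W \<Longrightarrow> y' \<in> W \<Longrightarrow> y - y' \<in> W"
  shows "proj V W x = v"
  unfolding proj_def
proof (rule the_equality)
  fix u assume u: "u \<in> V \<and> x - u \<in> W"
  have "u - v = (x - v) - (x - u)" by simp
  then show "u = v" using u assms by (metis eq_iff_diff_eq_0)
qed (use assms in auto)

locale unit_vector =
  fixes n :: "complex ^ 5"
  assumes nn: "lform n n = 1"
begin

lemma orth_hyperplane: "orth (orth {n}) = range (\<lambda>c. c *s n)"
proof (intro set_eqI iffI)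
  fix x assume x: "x \<in> orth (orth {n})"
  have "lform y (x - lform x n *s n) = 0" for y
  proof -
    have "y - lform y n *s n \<in> orth {n}" by (simp add: orth_def lform_simps nn)
    then have "lform x (y - lform y n *s n) = 0" using x by (simp add: orth_def)
    then show ?thesis by (simp add: lform_simps lform_commute[of y] algebra_simps)
  qed
  then have "x - lform x n *s n = 0" by (rule lform_nondegenerate)
  then show "x \<in> range (\<lambda>c. c *s n)" by (metis eq_iff_diff_eq_0 rangeI)
qed (auto simp: orth_def lform_simps lform_commute[of n])

lemma proj_hyperplane: "proj (orth {n}) (orth (orth {n})) x = x - lform x n *s n"
  unfolding orth_hyperplane
  by (rule proj_eqI) (auto simp: orth_def lform_simps nn simp flip: vector_sub_rdistrib)

lemma proj_normal: "proj (orth (orth {n})) (orth {n}) x = lform x n *s n"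
  unfolding orth_hyperplane
  by (rule proj_eqI) (auto simp: orth_def lform_simps nn simp flip: vector_sub_rdistrib)

lemma rho_hyperplane: "rho (orth {n}) x = x - (2 * lform x n) *s n"
  by (simp add: rho_def proj_hyperplane proj_normal vec_eq_iff)

end

locale null_line = unit_vector +
  fixes m :: "complex ^ 5"
  assumes hp: "hpair n m"
begin

abbreviation "S \<equiv> orth {n}"
abbreviation "L \<equiv> vec.span {n + m}"

lemmas nm = hpairD[OF hp]

lemma L: "L = range (\<lambda>c. c *s (n + m))"
  by (rule span_singleton)

lemma rho_scale: "rho S (c *s (n + m)) = c *s (m - n)"
  by (simp add: rho_hyperplane lform_simps nm vec_eq_iff algebra_simps)

lemma rho_L: "rho S ` L = range (\<lambda>c. c *s (m - n))"
  by (simp only: L image_image rho_scale)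

lemma plane: "setsum2 L (rho S ` L) = {c *s (n + m) + d *s (m - n) | c d. True}"
proof -
  have "setsum2 (range f) (range g) = {f c + g d | c d. True}" for f g :: "complex \<Rightarrow> complex ^ 5"
    by (auto simp: setsum2_def)
  then show ?thesis unfolding rho_L unfolding L .
qed

lemma planeI: "c *s (n + m) + d *s (m - n) \<in> setsum2 L (rho S ` L)"
  unfolding plane mem_Collect_eq by (rule exI[of _ c], rule exI[of _ d]) simp

lemma orth_plane: "orth (setsum2 L (rho S ` L)) = {x. lform x n = 0 \<and> lform x m = 0}"
proof (intro set_eqI iffI)
  fix x assume x: "x \<in> orth (setsum2 L (rho S ` L))"
  have "lform x (c *s (n + m) + d *s (m - n)) = 0" for c d
    using x planeI[of c d] unfolding mem_orth by (rule bspec)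
  from this[of 1 0] this[of 0 1] show "x \<in> {x. lform x n = 0 \<and> lform x m = 0}"
    by (simp add: lform_simps)
next
  fix x assume "x \<in> {x. lform x n = 0 \<and> lform x m = 0}"
  then have "lform x (c *s (n + m) + d *s (m - n)) = 0" for c d by (simp add: lform_simps)
  then show "x \<in> orth (setsum2 L (rho S ` L))" unfolding mem_orth plane by auto
qed

text \<open>\<open>n + m\<close> and \<open>m - n\<close> are null with product \<open>- 2\<close>,
  whence the factor \<open>- 1 / 2\<close>. The complement in the definition is the hyperplane
  orthogonal to \<open>m - n\<close>.\<close>

lemma piL: "piL S L x = (- (1 / 2) * lform x (m - n)) *s (n + m)"
proof -
  have W: "setsum2 (rho S ` L) (orth (setsum2 L (rho S ` L))) = {x. lform x (m - n) = 0}"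
  proof (intro set_eqI iffI)
    fix x :: "complex ^ 5" assume "x \<in> {x. lform x (m - n) = 0}"
    then have x: "lform x n = lform x m" by (simp add: lform_simps)
    have "x = (- lform x m) *s (m - n) + (x - (- lform x m) *s (m - n))" by simp
    moreover have "x - (- lform x m) *s (m - n) \<in> orth (setsum2 L (rho S ` L))"
      unfolding orth_plane using x by (simp add: lform_simps nm)
    ultimately show "x \<in> setsum2 (rho S ` L) (orth (setsum2 L (rho S ` L)))"
      unfolding rho_L setsum2_def by blast
  next
    fix x assume "x \<in> setsum2 (rho S ` L) (orth (setsum2 L (rho S ` L)))"
    then show "x \<in> {x. lform x (m - n) = 0}"
      unfolding orth_plane unfolding rho_L setsum2_def by (auto simp: lform_simps nm)
  qed
  show ?thesis
    unfolding piL_def W unfolding L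
    by (rule proj_eqI[OF rangeI _ _ range_scale_diff]) (auto simp: lform_simps nm field_simps)
qed

lemma piRhoL: "piRhoL S L x = (- (1 / 2) * lform x (n + m)) *s (m - n)"
proof -
  have W: "setsum2 L (orth (setsum2 L (rho S ` L))) = {x. lform x (n + m) = 0}"
  proof (intro set_eqI iffI)
    fix x :: "complex ^ 5" assume "x \<in> {x. lform x (n + m) = 0}"
    then have x: "lform x n = - lform x m" by (simp add: lform_simps eq_neg_iff_add_eq_0)
    have "x = (- lform x m) *s (n + m) + (x - (- lform x m) *s (n + m))" by simp
    moreover have "x - (- lform x m) *s (n + m) \<in> orth (setsum2 L (rho S ` L))"
      unfolding orth_plane using x by (simp add: lform_simps nm)
    ultimately show "x \<in> setsum2 L (orth (setsum2 L (rho S ` L)))"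
      unfolding setsum2_def L by blast
  qed (unfold orth_plane, auto simp: setsum2_def L lform_simps nm)
  show ?thesis
    unfolding piRhoL_def W unfolding rho_L
  proof (rule proj_eqI[OF rangeI _ _ range_scale_diff])
    fix y y' assume "y \<in> {x. lform x (n + m) = 0}" "y' \<in> {x. lform x (n + m) = 0}"
    then show "y - y' \<in> {x. lform x (n + m) = 0}" by (simp only: lform_diff_left mem_Collect_eq) simp
  qed (auto simp: lform_simps nm)
qed

lemma piPerp: "piPerp S L x = x - lform x n *s n + lform x m *s m"
  unfolding piPerp_def orth_plane
proof (rule proj_eqI)
  have "x - (x - lform x n *s n + lform x m *s m) =
      ((lform x n - lform x m) / 2) *s (n + m) + (- (lform x n + lform x m) / 2) *s (m - n)"
    by (simp add: vec_eq_iff field_simps)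
  then show "x - (x - lform x n *s n + lform x m *s m) \<in> setsum2 L (rho S ` L)"
    using planeI by metis
next
  fix y assume y: "y \<in> {x. lform x n = 0 \<and> lform x m = 0}" "y \<in> setsum2 L (rho S ` L)"
  then obtain c d where eq: "y = c *s (n + m) + d *s (m - n)"
    unfolding plane by blast
  have "lform y n = c - d" "lform y m = - c - d"
    unfolding eq by (simp_all add: lform_simps nm)
  then have cd: "c - d = 0" "- c - d = 0" using y(1) by auto
  have "2 * d = - (c - d) - (- c - d)" by simp
  then have "d = 0" unfolding cd by simp
  moreover have "c = 0" using cd(1) \<open>d = 0\<close> by simp
  ultimately show "y = 0" by (simp add: eq)
next
  fix y y' assume "y \<in> setsum2 L (rho S ` L)" "y' \<in> setsum2 L (rho S ` L)"
  then obtain c d c' d' where "y = c *s (n + m) + d *s (m - n)" "y' = c' *s (n + m) + d' *s (m - n)"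
    unfolding plane by blast
  then have "y - y' = (c - c') *s (n + m) + (d - d') *s (m - n)"
    by (simp add: vec_eq_iff algebra_simps)
  then show "y - y' \<in> setsum2 L (rho S ` L)" using planeI by metis
qed (simp_all add: lform_simps nm)

text \<open>\<open>n + m\<close> and \<open>m - n\<close> are eigenvectors of the rotation, with
  eigenvalues \<open>C + D = c\<close> and \<open>C - D = inverse c\<close>.\<close>

lemma sum_eq_hrot:
  assumes "c \<noteq> 0" "C = (c + inverse c) / 2" "D = (c - inverse c) / 2"
  shows "c *s piL S L x + piPerp S L x + inverse c *s piRhoL S L x = hrot n m C D x"
  using assms(1) unfolding piL piRhoL piPerp hrot_def assms(2,3)
  by (simp add: vec_eq_iff lform_simps field_simps)

lemma dress_eq_hrot:
  assumes "a\<^sup>2 \<noteq> lam\<^sup>2"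
  shows "p_dress S a L lam = hrot n m ((a\<^sup>2 + lam\<^sup>2) / (a\<^sup>2 - lam\<^sup>2)) (- (2 * a * lam) / (a\<^sup>2 - lam\<^sup>2))"
    "q_dress S a L lam = hrot n m (- ((a\<^sup>2 + lam\<^sup>2) / (a\<^sup>2 - lam\<^sup>2))) (2 * a * lam / (a\<^sup>2 - lam\<^sup>2))"
proof -
  have f: "a\<^sup>2 - lam\<^sup>2 = (a - lam) * (a + lam)" "(a - lam)\<^sup>2 = a\<^sup>2 - 2 * a * lam + lam\<^sup>2"
    by (simp_all add: power2_eq_square algebra_simps)
  then have nz: "a - lam \<noteq> 0" "a + lam \<noteq> 0" using assms by auto
  \<comment> \<open>In these variables \<open>a^2 - lam^2\<close> is \<open>u * w\<close> and the
    eigenvalue on \<open>L\<close> of the p factor is \<open>u / w\<close>; for the q factor it is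
    the negative.\<close>
  define u w where "u = a - lam" and "w = a + lam"
  have uw: "u \<noteq> 0" "w \<noteq> 0" using nz by (simp_all add: u_def w_def)
  have "a\<^sup>2 + lam\<^sup>2 = (u\<^sup>2 + w\<^sup>2) / 2" "2 * a * lam = (w\<^sup>2 - u\<^sup>2) / 2"
    by (simp_all add: u_def w_def power2_eq_square algebra_simps)
  then have C: "(a\<^sup>2 + lam\<^sup>2) / (a\<^sup>2 - lam\<^sup>2) = ((a - lam) / (a + lam) + inverse ((a - lam) / (a + lam))) / 2"
    and D: "- (2 * a * lam) / (a\<^sup>2 - lam\<^sup>2) = ((a - lam) / (a + lam) - inverse ((a - lam) / (a + lam))) / 2"
    using uw unfolding f u_def[symmetric] w_def[symmetric] by (simp_all add: divide_simps) (simp_all add: power2_eq_square algebra_simps)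
  have i: "inverse ((a - lam) / (a + lam)) = (a + lam) / (a - lam)" by simp
  show "p_dress S a L lam = hrot n m ((a\<^sup>2 + lam\<^sup>2) / (a\<^sup>2 - lam\<^sup>2)) (- (2 * a * lam) / (a\<^sup>2 - lam\<^sup>2))"
    using sum_eq_hrot[OF _ C D] nz unfolding i by (intro ext) (simp add: p_dress_def)
  have q: "(lam - a) / (lam + a) = - ((a - lam) / (a + lam))" "(lam + a) / (lam - a) = inverse (- ((a - lam) / (a + lam)))"
    using nz by (simp_all add: field_simps)
  have neg: "- ((c + inverse c) / 2) = (- c + inverse (- c)) / 2" "- ((c - inverse c) / 2) = (- c - inverse (- c)) / 2"
    for c :: complex by (simp_all add: add_divide_distrib diff_divide_distrib)
  have "- ((a\<^sup>2 + lam\<^sup>2) / (a\<^sup>2 - lam\<^sup>2)) = (- ((a - lam) / (a + lam)) + inverse (- ((a - lam) / (a + lam)))) / 2"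
    unfolding C by (rule neg)
  moreover have "2 * a * lam / (a\<^sup>2 - lam\<^sup>2) = (- ((a - lam) / (a + lam)) - inverse (- ((a - lam) / (a + lam)))) / 2"
  proof -
    have "2 * a * lam / (a\<^sup>2 - lam\<^sup>2) = - (- (2 * a * lam) / (a\<^sup>2 - lam\<^sup>2))" by simp
    then show ?thesis unfolding D neg(2) .
  qed
  ultimately have "- ((a - lam) / (a + lam)) \<noteq> 0 \<Longrightarrow> - ((a - lam) / (a + lam)) *s piL S L x + piPerp S L x
      + inverse (- ((a - lam) / (a + lam))) *s piRhoL S L x
      = hrot n m (- ((a\<^sup>2 + lam\<^sup>2) / (a\<^sup>2 - lam\<^sup>2))) (2 * a * lam / (a\<^sup>2 - lam\<^sup>2)) x" for x
    by (intro sum_eq_hrot)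
  then show
    "q_dress S a L lam = hrot n m (- ((a\<^sup>2 + lam\<^sup>2) / (a\<^sup>2 - lam\<^sup>2))) (2 * a * lam / (a\<^sup>2 - lam\<^sup>2))"
    using nz by (intro ext) (simp only: q_dress_def q, simp)
qed

lemma p_dress_inf_eq_hrot: "p_dress_inf S L = hrot n m (- 1) 0"
  unfolding p_dress_inf_def piL piRhoL piPerp hrot_def
  by (intro ext) (simp add: vec_eq_iff lform_simps field_simps)

end

text \<open>Rescaling \<open>l\<close> to normal component \<open>n\<close> leaves this tangential
  vector; nullity of \<open>l\<close> then forces its square to be \<open>- 1\<close>.\<close>

definition mvec :: "complex ^ 5 \<Rightarrow> complex ^ 5 \<Rightarrow> complex ^ 5" where
  "mvec n l = inverse (lform l n) *s l - n"

lemma mvec: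
  assumes "lform n n = 1" "lform l l = 0" "lform l n \<noteq> 0"
  shows "hpair n (mvec n l)" "l = lform l n *s (n + mvec n l)" "vec.span {l} = vec.span {n + mvec n l}"
proof -
  show "hpair n (mvec n l)"
    using assms by (simp add: hpair_def mvec_def lform_simps lform_commute[of n l])
  show l: "l = lform l n *s (n + mvec n l)"
    using assms by (simp add: mvec_def vec_eq_iff)
  have "n + mvec n l = inverse (lform l n) *s l" by (simp add: mvec_def)
  then have "n + mvec n l \<in> vec.span {l}"
    by (simp add: vec.span_base vec.span_scale)
  moreover have "l \<in> vec.span {n + mvec n l}"
    using vec.span_scale[OF vec.span_base, of "n + mvec n l" "{n + mvec n l}" "lform l n"] l by simp
  ultimately show "vec.span {l} = vec.span {n + mvec n l}"
    by (intro subset_antisym) (simp_all add: vec.span_minimal)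
qed

text \<open>A tangential \<open>l\<close> would be fixed by \<open>rho\<close>, and being null it
  would lie in both intersected sets.\<close>

lemma (in unit_vector) nondegenerate_line:
  assumes "rho (orth {n}) ` vec.span {l} \<inter> orth (vec.span {l}) = {0}" "l \<noteq> 0" "lform l l = 0"
  shows "lform l n \<noteq> 0"
proof
  assume "lform l n = 0"
  then have "rho (orth {n}) l = l" by (simp add: rho_hyperplane)
  then have "l \<in> rho (orth {n}) ` vec.span {l}" by (metis imageI insertI1 vec.span_base)
  moreover have "l \<in> orth (vec.span {l})"
    using assms(3) by (auto simp: orth_def span_singleton lform_simps)
  ultimately show False using assms by auto
qed

section \<open>Frames of a hyperplane recognised by their products\<close>

lemma gram_independent:
  fixes s :: "complex ^ 5"
  assumes "lform s s = 0" "lform s a = 0" "lform s b = 0" "lform a a = 0" "lform b b = 0"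
    and "lform a b \<noteq> 0" "lform s d \<noteq> 0"
    and zero: "x *s s + y *s a + z *s b + w *s d = 0"
  shows "x = 0" "y = 0" "z = 0" "w = 0"
proof -
  \<comment> \<open>Only \<open>d\<close> has a non-zero product with \<open>s\<close>. Pairing with
    \<open>a\<close>, \<open>b\<close> and \<open>d\<close> afterwards isolates \<open>z\<close>,
    \<open>y\<close> and \<open>x\<close>; the products of \<open>d\<close> with \<open>a\<close>,
    \<open>b\<close> and itself may be arbitrary.\<close>
  have "lform s (x *s s + y *s a + z *s b + w *s d) = 0" by (simp add: zero)
  then show w: "w = 0" using assms(1-7) by (simp add: lform_simps)
  have "lform a (x *s s + y *s a + z *s b + w *s d) = 0" by (simp add: zero)
  then show z: "z = 0" using assms(1-7) w by (simp add: lform_simps lform_commute[of a s])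
  have "lform b (x *s s + y *s a + z *s b + w *s d) = 0" by (simp add: zero)
  then show y: "y = 0" using assms(1-7) w by (simp add: lform_simps lform_commute[of b s] lform_commute[of b a])
  have "lform d (x *s s + y *s a + z *s b + w *s d) = 0" by (simp add: zero)
  then show "x = 0" using assms(1-7) w y z by (simp add: lform_simps lform_commute[of d s])
qed

text \<open>A dimension count: four independent vectors inside a proper subspace of a
  five-dimensional space. For the transform it converts orthogonality to one vector into knowledge
  of the whole central sphere.\<close>

lemma gram_span:
  fixes s :: "complex ^ 5"
  assumes gram: "lform s s = 0" "lform s a = 0" "lform s b = 0" "lform a a = 0" "lform b b = 0"
      "lform a b \<noteq> 0" "lform s d \<noteq> 0"
    and n: "n \<noteq> 0" "lform s n = 0" "lform a n = 0" "lform b n = 0" "lform d n = 0"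
  shows "vec.span {s, a, b, d} = orth {n}"
proof -
  note ind = gram_independent[OF gram]
  have ne: "s \<noteq> a" "s \<noteq> b" "s \<noteq> d" "a \<noteq> b" "a \<noteq> d" "b \<noteq> d"
    using ind(1)[of 1 "- 1" 0 0] ind(1)[of 1 0 "- 1" 0] ind(1)[of 1 0 0 "- 1"]
      ind(2)[of 0 1 "- 1" 0] ind(2)[of 0 1 0 "- 1"] ind(3)[of 0 0 1 "- 1"] by auto
  have indep: "vec.independent {s, a, b, d}"
  proof
    assume "vec.dependent {s, a, b, d}"
    then obtain u where "(\<exists>v\<in>{s, a, b, d}. u v \<noteq> 0)" "(\<Sum>v\<in>{s, a, b, d}. u v *s v) = 0"
      using vec.dependent_finite[of "{s, a, b, d}"] by auto
    then show False
      using ind[of "u s" "u a" "u b" "u d"] ne by (auto simp: add.assoc)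
  qed
  have sub: "vec.subspace (orth {n})"
    by (auto simp: vec.subspace_def orth_def lform_simps)
  have le: "vec.span {s, a, b, d} \<subseteq> orth {n}"
    using n by (intro vec.span_minimal sub) (auto simp: orth_def)
  obtain x where "lform x n \<noteq> 0" using lform_nondegenerate n(1) by blast
  then have "orth {n} \<noteq> UNIV" by (auto simp: orth_def)
  then have "vec.dim (orth {n}) < vec.dim (UNIV :: (complex ^ 5) set)"
    using sub by (metis top.not_eq_extremum vec.dim_psubset vec.span_UNIV vec.span_eq_iff)
  then have "vec.dim (orth {n}) \<le> 4" unfolding vec_dim_card by simp
  moreover have "vec.dim (vec.span {s, a, b, d}) = 4"
    using vec.dim_span_eq_card_independent[OF indep] ne by simp
  ultimately show ?thesis
    using vec.subspace_dim_equal[OF vec.subspace_span sub le] by simp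
qed

text \<open>An isotropic plane in a nondegenerate four-dimensional space is its own orthogonal
  complement. Membership in \<open>Lam10\<close> or \<open>Lam01\<close> thereby becomes a set of
  equations, which can be differentiated.\<close>

lemma gram_isotropic:
  fixes s :: "complex ^ 5"
  assumes gram: "lform s s = 0" "lform s a = 0" "lform s b = 0" "lform a a = 0" "lform b b = 0"
      "lform a b \<noteq> 0" "lform s d \<noteq> 0"
    and n: "n \<noteq> 0" "lform s n = 0" "lform a n = 0" "lform b n = 0" "lform d n = 0"
  shows "vec.span {s, a} = {x. lform x n = 0 \<and> lform x s = 0 \<and> lform x a = 0}" (is "_ = ?R")
proof
  have "vec.subspace ?R" by (auto simp: vec.subspace_def lform_simps)
  then show "vec.span {s, a} \<subseteq> ?R"
    using gram n by (intro vec.span_minimal) (auto simp: lform_commute[of a s])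
  show "?R \<subseteq> vec.span {s, a}"
  proof
    fix x assume x: "x \<in> ?R"
    then have "x \<in> vec.span {s, a, b, d}"
      unfolding gram_span[OF gram n] by (simp add: orth_def)
    then obtain p q r t where eq: "x = p *s s + q *s a + r *s b + t *s d"
      by (auto simp: vec.span_insert algebra_simps)
    have "t = 0" "r = 0"
      using x gram unfolding eq
      by (auto simp: lform_simps lform_commute[of d s] lform_commute[of a s] lform_commute[of b s] lform_commute[of b a])
    then show "x \<in> vec.span {s, a}"
      unfolding eq by simp (intro vec.span_add vec.span_scale vec.span_base; simp)
  qed
qed

text \<open>\<open>(c + 1 / c) / 2\<close> and \<open>(c - 1 / c) / 2\<close> for \<open>c = (\<mu> - e) / (\<mu> + e)\<close>.\<close>

definition hC :: "complex \<Rightarrow> complex \<Rightarrow> complex" where "hC e \<mu> = (\<mu>\<^sup>2 + e\<^sup>2) / (\<mu>\<^sup>2 - e\<^sup>2)"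
definition hD :: "complex \<Rightarrow> complex \<Rightarrow> complex" where "hD e \<mu> = - (2 * e * \<mu>) / (\<mu>\<^sup>2 - e\<^sup>2)"

text \<open>The notation matches the q factor: at \<open>lam\<close> with pole \<open>a\<close> it
  has coefficients \<open>hC a lam\<close> and \<open>hD a lam\<close>, and the p factor has their
  negatives.\<close>

lemma hC_hD_minus: "hC a \<mu> = - ((a\<^sup>2 + \<mu>\<^sup>2) / (a\<^sup>2 - \<mu>\<^sup>2))" "hD a \<mu> = 2 * a * \<mu> / (a\<^sup>2 - \<mu>\<^sup>2)"
proof -
  have nd: "x / (p - q) = - (x / (q - p))" for x p q :: complex
    by (metis minus_diff_eq minus_divide_right)
  show "hC a \<mu> = - ((a\<^sup>2 + \<mu>\<^sup>2) / (a\<^sup>2 - \<mu>\<^sup>2))" "hD a \<mu> = 2 * a * \<mu> / (a\<^sup>2 - \<mu>\<^sup>2)"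
    unfolding hC_def hD_def nd[of _ "\<mu>\<^sup>2"] by (simp_all add: add.commute)
qed

section \<open>Composition of two dressing steps\<close>

lemmas hCD = dressing_coeffs[OF _ hC_def hD_def]

text \<open>By the Leibniz rule a rescaling changes the factor in the parallelism equation by a
  logarithmic derivative only, so the normalised section \<open>n + m\<close> may be used.\<close>

lemma nabla_line:
  assumes lx: "lax nb n b A" and par: "nabla nb n b A e l = \<theta> *s vval l"
    and l: "l = \<kappa> *s y" "val \<kappa> \<noteq> 0"
  obtains \<theta>' where "nabla nb n b A e y = \<theta>' *s vval y"
proof
  have "nabla nb n b A e l = der \<kappa> *s vval y + val \<kappa> *s nabla nb n b A e y"
    unfolding l(1) by (rule nabla_leibniz[OF lx])
  then have "val \<kappa> *s nabla nb n b A e y = (\<theta> * val \<kappa> - der \<kappa>) *s vval y"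
    using par l by (simp add: vec_eq_iff algebra_simps)
  then have "inverse (val \<kappa>) *s (val \<kappa> *s nabla nb n b A e y) = inverse (val \<kappa>) *s ((\<theta> * val \<kappa> - der \<kappa>) *s vval y)"
    by simp
  then show "nabla nb n b A e y = (inverse (val \<kappa>) * (\<theta> * val \<kappa> - der \<kappa>)) *s vval y"
    using l(2) by (simp add: vec_eq_iff algebra_simps)
qed

lemma gauge_hrot:
  assumes nm: "hpair n m" and CD: "C * C - D * D = 1"
  shows "gauge_op n m C D F (hrot n m (const C) (const D) x) = hrot (vval n) (vval m) C D (F x)"
proof -
  have "const C * const C - const D * const D = 1"
    using CD by (simp add: dual.expand flip: const_ops)
  from hrot_inverse(1)[OF nm this] show ?thesis by (simp add: gauge_op_def)
qed

text \<open>\<open>m1\<close> belongs to a line parallel at \<open>e1\<close>. \<open>m2\<close>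
  will belong to the image, under the first factor at \<open>e2\<close>, of a line parallel at
  \<open>e2\<close>; that relation is left to the lemmas because the first factor is of Q type in
  one direction and of P type in the other.\<close>

locale two_lines =
  fixes nb n b A m1 m2 e1 e2 l1 l2 \<theta>1 \<theta>2 \<kappa>1 \<kappa>2
  assumes lx: "lax nb n b A" and nm1: "hpair n m1" and nm2: "hpair n m2"
    and l1: "l1 = \<kappa>1 *s (n + m1)" "val \<kappa>1 \<noteq> 0" "nabla nb n b A e1 l1 = \<theta>1 *s vval l1"
    and l2: "val \<kappa>2 \<noteq> 0" "nabla nb n b A e2 l2 = \<theta>2 *s vval l2"
    and e: "e2\<^sup>2 \<noteq> e1\<^sup>2" "1 \<noteq> e1\<^sup>2" "1 \<noteq> e2\<^sup>2"
begin

abbreviation "flip1 \<equiv> hrot (vval n) (vval m1) (- 1) 0"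
abbreviation "flip2 \<equiv> hrot (vval n) (vval m2) (- 1) 0"

lemma e1: "1\<^sup>2 \<noteq> e1\<^sup>2" "1\<^sup>2 \<noteq> e2\<^sup>2" using e by simp_all

lemma dressing1: obtains \<theta> where "dressing nb n b A m1 e1 \<theta>"
proof -
  obtain \<theta> where "nabla nb n b A e1 (n + m1) = \<theta> *s vval (n + m1)"
    using nabla_line[OF lx l1(3,1,2)] by blast
  then show thesis using that lx nm1 by (simp add: dressing_def)
qed

text \<open>The order along z. The Q step moves \<open>flip1\<close> onto the linear and quadratic
  coefficients, and the P step then changes the connection by the plane of \<open>m2\<close> and
  adds its term to the linear coefficient.\<close>

lemma dress_QP:
  assumes l2': "hrot n m1 (const (- hC e1 e2)) (const (- hD e1 e2)) l2 = \<kappa>2 *s (n + m2)"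
  shows "lax (gauge_op n m2 (- 1) 0 nb) n
      (flip1 ((2 * e2) *s A (flip1 (vval m2)) - (b + (2 * e1) *s A (vval m1)))) (\<lambda>x. flip1 (A (flip1 x)))"
    and "hrot (vval n) (vval m2) (hC e2 1) (hD e2 1)
      (hrot (vval n) (vval m1) (- hC e1 1) (- hD e1 1) (nabla nb n b A 1 x)) =
    nabla (gauge_op n m2 (- 1) 0 nb) n
      (flip1 ((2 * e2) *s A (flip1 (vval m2)) - (b + (2 * e1) *s A (vval m1)))) (\<lambda>x. flip1 (A (flip1 x))) 1
      (hrot n m2 (const (hC e2 1)) (const (hD e2 1)) (hrot n m1 (const (- hC e1 1)) (const (- hD e1 1)) x))"
proof -
  obtain \<theta> where d1: "dressing nb n b A m1 e1 \<theta>" by (rule dressing1)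
  interpret d1: dressing nb n b A m1 e1 \<theta> by (rule d1)
  have neg: "(- C) * (- C) - (- D) * (- D) = 1" if "C * C - D * D = 1" for C D :: complex using that by simp
  have g1: "nabla nb n d1.bQ d1.AQ \<mu> (hrot n m1 (const (- hC e1 \<mu>)) (const (- hD e1 \<mu>)) y)
      = hrot (vval n) (vval m1) (- hC e1 \<mu>) (- hD e1 \<mu>) (nabla nb n b A \<mu> y)" if "\<mu>\<^sup>2 \<noteq> e1\<^sup>2" for \<mu> y
    using gauge_hrot[OF nm1 neg[OF hCD(1)[OF that]], of "nabla nb n b A \<mu>" y] d1.gauge_Q[OF hCD[OF that]]
    by simp
  \<comment> \<open>Gauging at \<open>e2\<close>, which is not a pole of the first factor, carries
    the second parallel line to one parallel for the dressed family; this is the hypothesis of the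
    second step.\<close>
  obtain \<theta>' where "nabla nb n d1.bQ d1.AQ e2 (n + m2) = \<theta>' *s vval (n + m2)"
  proof (rule nabla_line[OF d1.lax_Q _ l2' l2(1)])
    show "nabla nb n d1.bQ d1.AQ e2 (hrot n m1 (const (- hC e1 e2)) (const (- hD e1 e2)) l2) =
      \<theta>2 *s vval (hrot n m1 (const (- hC e1 e2)) (const (- hD e1 e2)) l2)"
      by (simp add: g1[OF e(1)] l2(2) hrot_scale)
  qed
  then have "dressing nb n d1.bQ d1.AQ m2 e2 \<theta>'"
    using d1.lax_Q nm2 by (simp add: dressing_def)
  then interpret d2: dressing nb n d1.bQ d1.AQ m2 e2 \<theta>' .
  have "hrot (vval n) (vval m2) (hC e2 1) (hD e2 1)
      (hrot (vval n) (vval m1) (- hC e1 1) (- hD e1 1) (nabla nb n b A 1 x)) =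
    nabla (gauge_op n m2 (- 1) 0 nb) n d2.bP d1.AQ 1
      (hrot n m2 (const (hC e2 1)) (const (hD e2 1)) (hrot n m1 (const (- hC e1 1)) (const (- hD e1 1)) x))"
    unfolding g1[OF e1(1), symmetric] d2.gauge_P[OF hCD[OF e1(2)], symmetric]
    by (rule gauge_hrot[OF nm2 hCD(1)[OF e1(2)], symmetric])
  moreover have "d2.bP = flip1 ((2 * e2) *s A (flip1 (vval m2)) - (b + (2 * e1) *s A (vval m1)))"
    unfolding d2.bP_def unfolding d1.bQ_def d1.AQ_def d1.bP_def d1.flip_def hrot_diff hrot_scale by simp
  moreover have "d1.AQ = (\<lambda>x. flip1 (A (flip1 x)))"
    by (intro ext) (simp add: d1.AQ_def d1.flip_def)
  moreover note d2.lax_P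
  ultimately show "lax (gauge_op n m2 (- 1) 0 nb) n
      (flip1 ((2 * e2) *s A (flip1 (vval m2)) - (b + (2 * e1) *s A (vval m1)))) (\<lambda>x. flip1 (A (flip1 x)))"
    "hrot (vval n) (vval m2) (hC e2 1) (hD e2 1)
      (hrot (vval n) (vval m1) (- hC e1 1) (- hD e1 1) (nabla nb n b A 1 x)) =
    nabla (gauge_op n m2 (- 1) 0 nb) n
      (flip1 ((2 * e2) *s A (flip1 (vval m2)) - (b + (2 * e1) *s A (vval m1)))) (\<lambda>x. flip1 (A (flip1 x))) 1
      (hrot n m2 (const (hC e2 1)) (const (hD e2 1)) (hrot n m1 (const (- hC e1 1)) (const (- hD e1 1)) x))"
    by simp_all
qed

text \<open>The order along the conjugate direction. The P step leaves \<open>A\<close> alone, so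
  both contributions to the linear coefficient accumulate before the Q step applies
  \<open>flip2\<close>.\<close>

lemma dress_PQ:
  assumes l2': "hrot n m1 (const (hC e1 e2)) (const (hD e1 e2)) l2 = \<kappa>2 *s (n + m2)"
  shows "lax (gauge_op n m1 (- 1) 0 nb) n
      (flip2 (- (b + (2 * e1) *s A (vval m1) + (2 * e2) *s A (vval m2)))) (\<lambda>x. flip2 (A (flip2 x)))"
    and "hrot (vval n) (vval m2) (- hC e2 1) (- hD e2 1)
      (hrot (vval n) (vval m1) (hC e1 1) (hD e1 1) (nabla nb n b A 1 x)) =
    nabla (gauge_op n m1 (- 1) 0 nb) n
      (flip2 (- (b + (2 * e1) *s A (vval m1) + (2 * e2) *s A (vval m2)))) (\<lambda>x. flip2 (A (flip2 x))) 1
      (hrot n m2 (const (- hC e2 1)) (const (- hD e2 1)) (hrot n m1 (const (hC e1 1)) (const (hD e1 1)) x))"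
proof -
  obtain \<theta> where d1: "dressing nb n b A m1 e1 \<theta>" by (rule dressing1)
  interpret d1: dressing nb n b A m1 e1 \<theta> by (rule d1)
  have neg: "(- C) * (- C) - (- D) * (- D) = 1" if "C * C - D * D = 1" for C D :: complex using that by simp
  let ?nb = "gauge_op n m1 (- 1) 0 nb"
  have g1: "nabla ?nb n d1.bP A \<mu> (hrot n m1 (const (hC e1 \<mu>)) (const (hD e1 \<mu>)) y)
      = hrot (vval n) (vval m1) (hC e1 \<mu>) (hD e1 \<mu>) (nabla nb n b A \<mu> y)" if "\<mu>\<^sup>2 \<noteq> e1\<^sup>2" for \<mu> y
    using gauge_hrot[OF nm1 hCD(1)[OF that], of "nabla nb n b A \<mu>" y] d1.gauge_P[OF hCD[OF that]]
    by simp
  obtain \<theta>' where "nabla ?nb n d1.bP A e2 (n + m2) = \<theta>' *s vval (n + m2)"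
  proof (rule nabla_line[OF d1.lax_P _ l2' l2(1)])
    show "nabla ?nb n d1.bP A e2 (hrot n m1 (const (hC e1 e2)) (const (hD e1 e2)) l2) =
      \<theta>2 *s vval (hrot n m1 (const (hC e1 e2)) (const (hD e1 e2)) l2)"
      by (simp add: g1[OF e(1)] l2(2) hrot_scale)
  qed
  then have "dressing ?nb n d1.bP A m2 e2 \<theta>'"
    using d1.lax_P nm2 by (simp add: dressing_def)
  then interpret d2: dressing ?nb n d1.bP A m2 e2 \<theta>' .
  have "hrot (vval n) (vval m2) (- hC e2 1) (- hD e2 1)
      (hrot (vval n) (vval m1) (hC e1 1) (hD e1 1) (nabla nb n b A 1 x)) =
    nabla ?nb n d2.bQ d2.AQ 1
      (hrot n m2 (const (- hC e2 1)) (const (- hD e2 1)) (hrot n m1 (const (hC e1 1)) (const (hD e1 1)) x))"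
    unfolding g1[OF e1(1), symmetric] d2.gauge_Q[OF hCD[OF e1(2)], symmetric]
    by (rule gauge_hrot[OF nm2 neg[OF hCD(1)[OF e1(2)]], symmetric])
  moreover have "d2.bQ = flip2 (- (b + (2 * e1) *s A (vval m1) + (2 * e2) *s A (vval m2)))"
    unfolding d2.bQ_def d2.flip_def unfolding d2.bP_def unfolding d1.bP_def by (simp only: hrot_minus)
  moreover have "d2.AQ = (\<lambda>x. flip2 (A (flip2 x)))"
    by (intro ext) (simp add: d2.AQ_def d2.flip_def)
  moreover note d2.lax_Q
  ultimately show "lax ?nb n
      (flip2 (- (b + (2 * e1) *s A (vval m1) + (2 * e2) *s A (vval m2)))) (\<lambda>x. flip2 (A (flip2 x)))"
    "hrot (vval n) (vval m2) (- hC e2 1) (- hD e2 1)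
      (hrot (vval n) (vval m1) (hC e1 1) (hD e1 1) (nabla nb n b A 1 x)) =
    nabla ?nb n
      (flip2 (- (b + (2 * e1) *s A (vval m1) + (2 * e2) *s A (vval m2)))) (\<lambda>x. flip2 (A (flip2 x))) 1
      (hrot n m2 (const (- hC e2 1)) (const (- hD e2 1)) (hrot n m1 (const (hC e1 1)) (const (hD e1 1)) x))"
    by simp_all
qed

end

text \<open>The left-hand vectors are the values of \<open>p_inf\<close>. Orthogonality at \<open>a\<close> makes the tangential part of the
  image independent of \<open>\<mu>\<close>, so that the second factor can be treated in the same way.\<close>

lemma dress_vector:
  fixes n m u :: "complex ^ 5"
  assumes nm: "hpair n m" and u: "lform u n = 0" and a: "a \<noteq> 0" "\<mu> \<noteq> 0" "a\<^sup>2 \<noteq> \<mu>\<^sup>2"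
    and perp: "lform ((h1 / a + h2 * a) *s n + u) (n + m) = 0"
  shows "hrot n m ((a\<^sup>2 + \<mu>\<^sup>2) / (a\<^sup>2 - \<mu>\<^sup>2)) (- (2 * a * \<mu>) / (a\<^sup>2 - \<mu>\<^sup>2)) ((h1 / \<mu> + h2 * \<mu>) *s n + u)
    = (h1 / \<mu> - h2 * \<mu>) *s n + (u + lform u m *s m + (h2 * a - h1 / a) *s m)"
proof -
  note [simp] = hpairD[OF nm]
  have um: "lform u m = - (h1 / a + h2 * a)"
    using perp u by (simp add: lform_simps eq_neg_iff_add_eq_0 add.commute del: minus_add_distrib)
  define C D where "C = (a\<^sup>2 + \<mu>\<^sup>2) / (a\<^sup>2 - \<mu>\<^sup>2)" and "D = - (2 * a * \<mu>) / (a\<^sup>2 - \<mu>\<^sup>2)"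
  have nz: "a\<^sup>2 - \<mu>\<^sup>2 \<noteq> 0" using a by simp
  \<comment> \<open>The factor \<open>a^2 - \<mu>^2\<close> cancels in both combinations, and in the
    normal one the term with \<open>h2\<close> changes sign.\<close>
  have c1: "C * (h1 / \<mu> + h2 * \<mu>) + D * (h1 / a + h2 * a) = h1 / \<mu> - h2 * \<mu>"
    unfolding C_def D_def using nz a by (simp add: divide_simps) (simp add: power2_eq_square algebra_simps)
  have c2: "C * (h1 / a + h2 * a) + D * (h1 / \<mu> + h2 * \<mu>) = h2 * a - h1 / a"
    unfolding C_def D_def using nz a by (simp add: divide_simps) (simp add: power2_eq_square algebra_simps)
  have "hrot n m C D ((h1 / \<mu> + h2 * \<mu>) *s n + u) = (C * (h1 / \<mu> + h2 * \<mu>) + D * (h1 / a + h2 * a)) *s n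
     + (u + lform u m *s m + (C * (h1 / a + h2 * a) + D * (h1 / \<mu> + h2 * \<mu>)) *s m)"
    by (simp add: hrot_def lform_simps u um vec_eq_iff algebra_simps)
  then show ?thesis unfolding c1 c2 unfolding C_def D_def .
qed

section \<open>Charts and frames\<close>

lemma open_overlap:
  assumes "chart c" "chart c'"
  shows "open (overlap c c')"
proof -
  obtain D \<psi> D' \<psi>' where c: "c = (D, \<psi>)" "c' = (D', \<psi>')" by fastforce
  have "overlap c c' = \<psi> -` (\<psi>' ` D') \<inter> D" by (auto simp: overlap_def c)
  then show ?thesis
    using assms continuous_on_open_vimage[of D \<psi>] by (auto simp: chart_def c)
qed

lemma transition_in: "z \<in> overlap c c' \<Longrightarrow> transition c c' z \<in> fst c'"
  by (auto simp: overlap_def transition_def inv_into_into)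

lemma transition_eq: "z \<in> overlap c c' \<Longrightarrow> snd c' (transition c c' z) = snd c z"
  by (auto simp: overlap_def transition_def f_inv_into_f)

lemma transition_unique:
  "chart c' \<Longrightarrow> z' \<in> fst c' \<Longrightarrow> snd c' z' = snd c z \<Longrightarrow> transition c c' z = z'"
  by (auto simp: transition_def chart_def inv_into_f_f split: prod.splits) (metis inv_into_f_f)

abbreviation jdet :: "(complex \<Rightarrow> complex) \<Rightarrow> complex \<Rightarrow> real" where
  "jdet T z \<equiv> Im (cnj (dd T z 1) * dd T z \<i>)"

lemma jdet_compose:
  assumes "T differentiable (at z)" "R differentiable (at (T z))"
  shows "jdet (\<lambda>y. R (T y)) z = jdet R (T z) * jdet T z"
  by (simp add: dd_compose(1)[OF assms] dd_complex[OF assms(2), of "dd T z _"] algebra_simps)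

lemma oriented_chartsD: "c \<in> oriented_charts A \<Longrightarrow> chart c"
  by (simp add: oriented_charts_def)

lemma atlas_oriented: "oriented_atlas A \<Longrightarrow> c \<in> A \<Longrightarrow> c \<in> oriented_charts A"
  by (auto simp: oriented_atlas_def oriented_charts_def)

lemma atlas_cover:
  assumes "oriented_atlas A"
  obtains c z where "c \<in> A" "z \<in> fst c" "snd c z = p"
proof -
  have "p \<in> (\<Union>(D, \<psi>)\<in>A. \<psi> ` D)" using assms by (simp add: oriented_atlas_def)
  then show thesis using that by fastforce
qed

text \<open>Oriented charts are compatible with atlas charts by definition, but not explicitly with
  each other. The transition therefore factors locally through an atlas chart, and Jacobians
  multiply.\<close>

lemma local_transition:
  assumes A: "oriented_atlas A" and c: "c \<in> oriented_charts A" "c' \<in> oriented_charts A"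
    and z: "z \<in> overlap c c'"
  obtains U where "open U" "z \<in> U" "U \<subseteq> overlap c c'" "smooth_on U (transition c c')"
    "\<And>y. y \<in> U \<Longrightarrow> 0 < jdet (transition c c') y"
proof -
  obtain a za where a: "a \<in> A" "za \<in> fst a" "snd a za = snd c z" using atlas_cover[OF A] by metis
  define U where "U = overlap c c' \<inter> overlap c a"
  define T1 T2 where "T1 = transition c a" and "T2 = transition a c'"
  have ch: "chart c" "chart c'" "chart a"
    using c atlas_oriented[OF A a(1)] by (auto intro: oriented_chartsD)
  have oc: "oriented_compatible c a" "oriented_compatible a c'"
    using c a(1) by (auto simp: oriented_charts_def)
  have oU: "open U" unfolding U_def by (intro open_Int open_overlap ch)
  have zU: "z \<in> U" using z a unfolding U_def by (auto simp: overlap_def intro!: image_eqI[of _ _ za])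
  have T1: "T1 y \<in> overlap a c'" if "y \<in> U" for y
    using that transition_in[of y c a] transition_eq[of y c a]
    by (auto simp: U_def T1_def overlap_def)
  have eq: "transition c c' y = T2 (T1 y)" if "y \<in> U" for y
  proof (rule transition_unique[OF ch(2)])
    show "T2 (T1 y) \<in> fst c'" using transition_in[OF T1[OF that]] by (simp add: T2_def)
    show "snd c' (T2 (T1 y)) = snd c y"
      using transition_eq[OF T1[OF that]] transition_eq[of y c a] that by (simp add: T1_def T2_def U_def)
  qed
  have s1: "smooth_on U T1" and s2: "smooth_on (overlap a c') T2"
    using oc by (auto simp: oriented_compatible_def U_def T1_def T2_def intro: smooth_on_subset)
  have s: "smooth_on U (\<lambda>y. T2 (T1 y))" by (rule smooth_on_compose[OF oU s1 T1 s2])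
  show thesis
  proof (rule that[OF oU zU])
    show "U \<subseteq> overlap c c'" by (auto simp: U_def)
    show "smooth_on U (transition c c')" using smooth_on_cong[OF oU, of "transition c c'" "\<lambda>y. T2 (T1 y)"] eq s by blast
    fix y assume y: "y \<in> U"
    have "jdet (transition c c') y = jdet (\<lambda>y. T2 (T1 y)) y"
      by (simp only: dd_cong[OF oU y, of "transition c c'" "\<lambda>y. T2 (T1 y)", OF eq])
    also have "\<dots> = jdet T2 (T1 y) * jdet T1 y"
      by (rule jdet_compose[OF smooth_on_differentiable[OF s1 y] smooth_on_differentiable[OF s2 T1[OF y]]])
    also have "\<dots> > 0"
      using oc y T1[OF y] unfolding oriented_compatible_def T1_def T2_def U_def by (intro mult_pos_pos) auto
    finally show "0 < jdet (transition c c') y" .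
  qed
qed

lemma frame_transfer:
  assumes A: "oriented_atlas A" and c: "c \<in> oriented_charts A" "c' \<in> oriented_charts A"
    and fr: "frame (E \<circ> snd c) W s" "W \<subseteq> fst c" "z \<in> W" and z': "z' \<in> fst c'" "snd c' z' = snd c z"
  obtains W' where "open W'" "z' \<in> W'" "W' \<subseteq> overlap c' c" "smooth_on W' (transition c' c)"
    "\<And>y. y \<in> W' \<Longrightarrow> 0 < jdet (transition c' c) y" "\<And>y. y \<in> W' \<Longrightarrow> transition c' c y \<in> W"
    "frame (E \<circ> snd c') W' (\<lambda>y. s (transition c' c y))"
proof -
  let ?T = "transition c' c"
  have zo: "z' \<in> overlap c' c" using fr z' by (auto simp: overlap_def intro: image_eqI[of _ _ z])
  obtain U where U: "open U" "z' \<in> U" "U \<subseteq> overlap c' c" "smooth_on U ?T"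
    "\<And>y. y \<in> U \<Longrightarrow> 0 < jdet ?T y"
    using local_transition[OF A c(2,1) zo] by metis
  define W' where "W' = ?T -` W \<inter> U"
  have oW: "open W" using fr by (simp add: frame_def)
  then have oW': "open W'"
    using smooth_on_continuous[OF U(4)] continuous_on_open_vimage[OF U(1), of ?T] unfolding W'_def by blast
  have "?T z' = z" using transition_unique[OF oriented_chartsD[OF c(1)], of z c' z'] fr z' by auto
  then have z'W: "z' \<in> W'" using fr U by (simp add: W'_def)
  have TW: "?T y \<in> W" if "y \<in> W'" for y using that by (simp add: W'_def)
  have sT: "smooth_on W' ?T" using U(4) by (rule smooth_on_subset) (simp add: W'_def)
  have "frame (E \<circ> snd c') W' (\<lambda>y. s (?T y))"
    unfolding frame_def
  proof (intro conjI ballI oW')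
    show "smooth_on W' (\<lambda>y. s (?T y))"
      using fr by (intro smooth_on_compose[OF oW' sT TW]) (auto simp: frame_def)
    fix y assume y: "y \<in> W'"
    have "snd c' y = snd c (?T y)" using transition_eq[of y c' c] y U(3) by (auto simp: W'_def)
    then show "s (?T y) \<noteq> 0" "(E \<circ> snd c') y = vec.span {s (?T y)}"
      using fr(1) TW[OF y] by (auto simp: frame_def)
  qed
  then show thesis using that[OF oW' z'W _ sT _ TW] U by (auto simp: W'_def)
qed

lemma frame_exists:
  assumes A: "oriented_atlas A" and E: "null_line_subbundle A E" and c: "c \<in> oriented_charts A" "z \<in> fst c"
  obtains W s where "z \<in> W" "W \<subseteq> fst c" "frame (E \<circ> snd c) W s"
proof -
  obtain a za where a: "a \<in> A" "za \<in> fst a" "snd a za = snd c z" using atlas_cover[OF A] by metis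
  then obtain W s where W: "za \<in> W" "W \<subseteq> fst a" "frame (E \<circ> snd a) W s"
    using E unfolding null_line_subbundle_def by fastforce
  obtain W' where "z \<in> W'" "W' \<subseteq> overlap c a" "frame (E \<circ> snd c) W' (\<lambda>y. s (transition c a y))"
    using frame_transfer[OF A atlas_oriented[OF A a(1)] c(1) W(3,2,1) c(2) a(3)[symmetric]] by metis
  then show thesis using that by (auto simp: overlap_def)
qed

lemma real_basis:
  fixes u w X :: complex
  assumes "Im (cnj u * w) \<noteq> 0"
  obtains Y where "X = Re Y *\<^sub>R u + Im Y *\<^sub>R w"
proof
  define d where "d = Im (cnj u * w)"
  \<comment> \<open>Cramer's rule in the basis \<open>u\<close>, \<open>w\<close>.\<close>
  let ?Y = "Complex (Im (cnj X * w) / d) (Im (cnj u * X) / d)"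
  have "d *\<^sub>R X = d *\<^sub>R (Re ?Y *\<^sub>R u + Im ?Y *\<^sub>R w)"
    using assms unfolding d_def[symmetric]
    by (simp add: complex_eq_iff scaleR_add_right) (simp add: d_def algebra_simps)
  then show "X = Re ?Y *\<^sub>R u + Im ?Y *\<^sub>R w" using assms by (simp add: d_def)
qed

text \<open>\<open>immerses\<close> tests atlas charts only. A non-zero Jacobian lifts the direction
  \<open>X\<close> to an atlas chart, where the condition applies.\<close>

lemma immersion_at:
  assumes A: "oriented_atlas A" and im: "immerses A \<Gamma>" and c: "c \<in> oriented_charts A"
    and fr: "frame (\<Gamma> \<circ> snd c) W s" "W \<subseteq> fst c" "z \<in> W" and X: "dd s z X \<in> \<Gamma> (snd c z)"
  shows "X = 0"
proof -
  obtain a za where a: "a \<in> A" "za \<in> fst a" "snd a za = snd c z" using atlas_cover[OF A] by metis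
  let ?T = "transition a c"
  obtain W' where W': "open W'" "za \<in> W'" "W' \<subseteq> overlap a c" "smooth_on W' ?T"
    "\<And>y. y \<in> W' \<Longrightarrow> 0 < jdet ?T y" "\<And>y. y \<in> W' \<Longrightarrow> ?T y \<in> W"
    "frame (\<Gamma> \<circ> snd a) W' (\<lambda>y. s (?T y))"
    using frame_transfer[OF A c atlas_oriented[OF A a(1)] fr a(2,3)] by metis
  have T: "?T differentiable (at za)" using W' smooth_on_differentiable by blast
  have Tza: "?T za = z"
    using transition_unique[OF oriented_chartsD[OF c], of z a za] fr a by auto
  then have s: "s differentiable (at (?T za))"
    using fr smooth_on_differentiable[of W s z] by (simp add: frame_def)
  have "jdet ?T za \<noteq> 0" using W'(5)[OF W'(2)] by simp
  then obtain Y where Y: "X = Re Y *\<^sub>R dd ?T za 1 + Im Y *\<^sub>R dd ?T za \<i>" by (rule real_basis)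
  then have TY: "X = dd ?T za Y" by (simp add: dd_complex[OF T, of Y])
  have "dd (\<lambda>y. s (?T y)) za Y \<in> \<Gamma> (snd a za)"
    using X unfolding dd_compose(1)[OF T s] TY[symmetric] Tza a(3) .
  moreover have "\<forall>W \<sigma>. W \<subseteq> fst a \<longrightarrow> frame (\<Gamma> \<circ> snd a) W \<sigma> \<longrightarrow>
      (\<forall>z\<in>W. \<forall>X. dd \<sigma> z X \<in> \<Gamma> (snd a z) \<longrightarrow> X = 0)"
    using im a(1) unfolding immerses_def case_prod_beta by blast
  moreover have "W' \<subseteq> fst a" using W'(3) by (auto simp: overlap_def)
  ultimately have "Y = 0" using W'(2,7) by blast
  then show "X = 0" by (simp add: Y)
qed

text \<open>Subtracting a multiple of \<open>\<sigma>\<close> removes the timelike coordinate of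
  \<open>x\<close> without changing its square, which is then a sum of squares.\<close>

lemma lform_null_perp:
  fixes \<sigma> x :: "real ^ 5"
  assumes "lform \<sigma> \<sigma> = 0" "\<sigma> \<noteq> 0" "lform x \<sigma> = 0"
  shows "\<sigma> $ 0 \<noteq> 0" "0 \<le> lform x x" "lform x x = 0 \<Longrightarrow> x \<in> vec.span {\<sigma>}"
proof -
  have sq: "lform y y = (\<Sum>i\<in>UNIV. y $ i * y $ i)" if "y $ 0 = 0" for y :: "real ^ 5"
    unfolding lform_def by (intro sum.cong) (use that in auto)
  have pos: "0 \<le> lform y y" "lform y y = 0 \<Longrightarrow> y = 0" if "y $ 0 = 0" for y :: "real ^ 5"
    unfolding sq[OF that] by (auto simp: sum_nonneg sum_nonneg_eq_0_iff vec_eq_iff)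
  show nz: "\<sigma> $ 0 \<noteq> 0" using pos(2)[of \<sigma>] assms by blast
  define y where "y = x - (x $ 0 / \<sigma> $ 0) *s \<sigma>"
  have y0: "y $ 0 = 0" using nz by (simp add: y_def)
  have yy: "lform y y = lform x x"
    using assms by (simp add: y_def lform_simps lform_commute[of \<sigma> x])
  show "0 \<le> lform x x" using pos(1)[OF y0] yy by simp
  assume "lform x x = 0"
  then have "x = (x $ 0 / \<sigma> $ 0) *s \<sigma>" using pos(2)[OF y0] yy by (simp add: y_def)
  then show "x \<in> vec.span {\<sigma>}" unfolding span_singleton by blast
qed

lemma dd_null_perp:
  fixes s :: "complex \<Rightarrow> 'a::{real_normed_field, euclidean_space} ^ 5"
  assumes "open W" "z \<in> W" "s differentiable (at z)" "\<And>y. y \<in> W \<Longrightarrow> lform (s y) (s y) = 0"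
  shows "lform (dd s z X) (s z) = 0"
proof -
  have "dd (\<lambda>y. lform (s y) (s y)) z X = 0"
    using dd_cong[OF assms(1,2), of "\<lambda>y. lform (s y) (s y)" "\<lambda>_. 0"] assms(4) by (simp add: dd_const)
  then have "2 * lform (dd s z X) (s z) = 0"
    using assms by (simp add: dd_lform lform_commute)
  then show ?thesis by simp
qed

lemma frameD:
  assumes "frame E W s"
  shows "open W" "smooth_on W s" "z \<in> W \<Longrightarrow> s z \<noteq> 0" "z \<in> W \<Longrightarrow> E z = vec.span {s z}"
    "z \<in> W \<Longrightarrow> s z \<in> E z"
  using assms by (auto simp: frame_def vec.span_base)

text \<open>The derivative of a null section is orthogonal to it, so its square is non-negative; a
  zero square would put it into the line, against immersion.\<close>

lemma metric_pos:
  assumes A: "oriented_atlas A" and im: "immerses A \<Gamma>" and c: "c \<in> oriented_charts A"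
    and fr: "frame (\<Gamma> \<circ> snd c) W s" "W \<subseteq> fst c" "z \<in> W" and X: "X \<noteq> 0"
  shows "0 < lform (dd s z X) (dd s z X)"
proof -
  have null: "lform (s y) (s y) = 0" if "y \<in> W" for y
    using im frameD(5)[OF fr(1) that] by (auto simp: immerses_def null_line_subbundle_def)
  have "lform (dd s z X) (s z) = 0"
    by (rule dd_null_perp[OF frameD(1)[OF fr(1)] fr(3) _ null])
      (use frameD[OF fr(1)] fr(3) smooth_on_differentiable in auto)
  note np = lform_null_perp[OF null[OF fr(3)] frameD(3)[OF fr(1,3)] this]
  show ?thesis
  proof (rule ccontr)
    assume "\<not> 0 < lform (dd s z X) (dd s z X)"
    then have "dd s z X \<in> \<Gamma> (snd c z)" using np(2,3) frameD(4)[OF fr(1,3)] by auto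
    then show False using immersion_at[OF A im c fr] X by blast
  qed
qed


section \<open>Holomorphic charts\<close>

lemma hol_chartsD:
  assumes "c \<in> hol_charts A \<Gamma>"
  shows "c \<in> oriented_charts A"
    "W \<subseteq> fst c \<Longrightarrow> frame (\<Gamma> \<circ> snd c) W s \<Longrightarrow> z \<in> W \<Longrightarrow>
      lform (dd s z (\<i> * X)) (dd s z (\<i> * Y)) = lform (dd s z X) (dd s z Y)"
  using assms by (auto simp: hol_charts_def)

lemma conformal_form:
  fixes B :: "complex \<Rightarrow> real ^ 5"
  assumes B: "\<And>X. B X = Re X *\<^sub>R B 1 + Im X *\<^sub>R B \<i>"
    and conf: "\<And>X Y. lform (B (\<i> * X)) (B (\<i> * Y)) = lform (B X) (B Y)"
  shows "lform (B X) (B Y) = lform (B 1) (B 1) * Re (X * cnj Y)"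
proof -
  have 1: "lform (B \<i>) (B \<i>) = lform (B 1) (B 1)" using conf[of 1 1] by simp
  have "B (- 1) = - B 1" using B[of "- 1"] by simp
  then have 2: "lform (B 1) (B \<i>) = 0" "lform (B \<i>) (B 1) = 0"
    using conf[of 1 "\<i>"] lform_commute[of "B \<i>" "B 1"] by (simp_all add: lform_simps)
  show ?thesis
    by (subst B[of X], subst B[of Y])
      (simp add: lform_simps 1 2 scalar_mult_eq_scaleR[symmetric] algebra_simps)
qed

text \<open>Equal lengths and orthogonality leave \<open>w = \<i> * u\<close> or
  \<open>w = - \<i> * u\<close>; positive orientation selects the first.\<close>

lemma conformal_linear:
  fixes u w :: complex
  assumes "norm u = norm w" "Re (u * cnj w) = 0" "0 < Im (cnj u * w)"
  shows "w = \<i> * u"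
proof -
  have "(Re w + Im u)\<^sup>2 + (Im w - Re u)\<^sup>2 = 
     (Re u)\<^sup>2 + (Im u)\<^sup>2 + (Re w)\<^sup>2 + (Im w)\<^sup>2 - 2 * Im (cnj u * w)"
    by (simp add: power2_eq_square algebra_simps)
  have n: "(Re u)\<^sup>2 + (Im u)\<^sup>2 = (Re w)\<^sup>2 + (Im w)\<^sup>2"
    using assms(1) by (simp add: cmod_def)
  have "(Im (cnj u * w))\<^sup>2 + (Re (u * cnj w))\<^sup>2 = ((Re u)\<^sup>2 + (Im u)\<^sup>2) * ((Re w)\<^sup>2 + (Im w)\<^sup>2)"
    by (simp add: power2_eq_square algebra_simps)
  then have "(Im (cnj u * w))\<^sup>2 = ((Re u)\<^sup>2 + (Im u)\<^sup>2)\<^sup>2"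
    unfolding n assms(2) by (simp add: power2_eq_square)
  then have "Im (cnj u * w) = (Re u)\<^sup>2 + (Im u)\<^sup>2"
    using assms(3) by (simp add: power2_eq_iff) (smt (verit) zero_le_power2)
  then have "(Re w + Im u)\<^sup>2 + (Im w - Re u)\<^sup>2 = 0"
    using n \<open>(Re w + Im u)\<^sup>2 + _ = _\<close> by simp
  then show ?thesis by (simp add: complex_eq_iff sum_power2_eq_zero_iff)
qed

lemma dd_chart_linear:
  assumes "frame E W s" "z \<in> W"
  shows "dd s z X = Re X *\<^sub>R dd s z 1 + Im X *\<^sub>R dd s z \<i>"
  by (intro dd_complex smooth_on_differentiable[OF frameD(2)[OF assms(1)] assms(2)])

text \<open>The induced metric is a positive multiple of the Euclidean one in both charts, so the
  transition is conformal, and orientation yields the Cauchy-Riemann equation.\<close>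

lemma hol_transition:
  assumes A: "oriented_atlas A" and im: "immerses A \<Gamma>"
    and c: "c \<in> hol_charts A \<Gamma>" "c' \<in> hol_charts A \<Gamma>" and z: "z \<in> overlap c c'"
  shows "dd (transition c c') z \<i> = \<i> * dd (transition c c') z 1"
proof -
  let ?T = "transition c c'"
  note oc = hol_chartsD(1)[OF c(1)] hol_chartsD(1)[OF c(2)]
  have nl: "null_line_subbundle A \<Gamma>" using im by (simp add: immerses_def)
  obtain W s where W: "?T z \<in> W" "W \<subseteq> fst c'" "frame (\<Gamma> \<circ> snd c') W s"
    using frame_exists[OF A nl oc(2) transition_in[OF z]] by metis
  have z1: "z \<in> fst c" "snd c z = snd c' (?T z)"
    using z transition_eq[OF z] by (auto simp: overlap_def)
  obtain W' where W': "open W'" "z \<in> W'" "W' \<subseteq> overlap c c'" "smooth_on W' ?T"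
    "\<And>y. y \<in> W' \<Longrightarrow> 0 < jdet ?T y" "\<And>y. y \<in> W' \<Longrightarrow> ?T y \<in> W"
    "frame (\<Gamma> \<circ> snd c) W' (\<lambda>y. s (?T y))"
    using frame_transfer[OF A oc(2,1) W(3,2,1) z1] by metis
  have T: "?T differentiable (at z)" using W' smooth_on_differentiable by blast
  have s: "s differentiable (at (?T z))"
    using W smooth_on_differentiable frameD(2) by blast
  define B where "B = dd s (?T z)"
  have B: "lform (B X) (B Y) = lform (B 1) (B 1) * Re (X * cnj Y)" for X Y
    unfolding B_def
    by (rule conformal_form[OF dd_chart_linear[OF W(3,1)] hol_chartsD(2)[OF c(2) W(2,3,1)]])
  have e: "lform (B 1) (B 1) > 0"
    unfolding B_def by (rule metric_pos[OF A im oc(2) W(3,2,1)]) simp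
  have "W' \<subseteq> fst c" using W'(3) by (auto simp: overlap_def)
  from hol_chartsD(2)[OF c(1) this W'(7,2)]
  have conf: "lform (B (dd ?T z (\<i> * X))) (B (dd ?T z (\<i> * Y))) = lform (B (dd ?T z X)) (B (dd ?T z Y))" for X Y
    by (simp add: dd_compose(1)[OF T s] B_def)
  define u w where "u = dd ?T z 1" and "w = dd ?T z \<i>"
  have m1: "dd ?T z (\<i> * \<i>) = - u" using dd_complex[OF T, of "- 1"] by (simp add: u_def)
  have "lform (B w) (B w) = lform (B u) (B u)" "lform (B w) (B (- u)) = lform (B u) (B w)"
    using conf[of 1 1] conf[of 1 "\<i>"] unfolding m1 by (simp_all add: u_def w_def)
  then have "Re (w * cnj w) = Re (u * cnj u)" "Re (w * cnj (- u)) = Re (u * cnj w)"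
    using e unfolding B[of w w] B[of u u] B[of w "- u"] B[of u w] by simp_all
  then have "norm u = norm w" "Re (u * cnj w) = 0"
    by (simp_all add: cmod_def power2_eq_square algebra_simps)
  then show ?thesis
    using conformal_linear[of u w] W'(5)[OF W'(2)] by (simp add: u_def w_def)
qed

lemma bounded_linear_vscale_right: "bounded_linear (\<lambda>v :: complex ^ 5. c *s v)"
  by (rule bounded_bilinear.bounded_linear_right[OF bounded_bilinear_vscale])

lemma smooth_on_pd: "open W \<Longrightarrow> smooth_on W f \<Longrightarrow> smooth_on W (pd k f)"
  unfolding pd_def
  by (intro smooth_on_bounded_linear[OF _ bounded_linear_vscale_right] smooth_on_add smooth_on_dd)

lemma smooth_on_spd: "open W \<Longrightarrow> smooth_on W f \<Longrightarrow> smooth_on W (spd k f)"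
  unfolding spd_def
  by (intro smooth_on_bounded_linear[OF _ bounded_linear_mult_right] smooth_on_add smooth_on_dd)

lemma pd_compose:
  assumes T: "T differentiable (at z)" and t: "t differentiable (at (T z))" and lin: "dd T z \<i> = \<i> * dd T z 1"
  shows "pd (- \<i>) (\<lambda>y. t (T y)) z = dd T z 1 *s pd (- \<i>) t (T z)"
    "pd \<i> (\<lambda>y. t (T y)) z = cnj (dd T z 1) *s pd \<i> t (T z)"
proof -
  define P Q where "P = complex_of_real (Re (dd T z 1))" and "Q = complex_of_real (Im (dd T z 1))"
  have u: "dd T z 1 = P + \<i> * Q" "cnj (dd T z 1) = P - \<i> * Q"
    by (simp_all add: P_def Q_def complex_eq_iff)
  have d: "dd t (T z) (P + \<i> * Q) = P *s dd t (T z) 1 + Q *s dd t (T z) \<i>"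
    "dd t (T z) (\<i> * (P + \<i> * Q)) = (- Q) *s dd t (T z) 1 + P *s dd t (T z) \<i>"
    unfolding P_def Q_def by (subst dd_complex[OF t], simp add: vec_eq_iff complex_eq_iff)+
  show "pd (- \<i>) (\<lambda>y. t (T y)) z = dd T z 1 *s pd (- \<i>) t (T z)"
    "pd \<i> (\<lambda>y. t (T y)) z = cnj (dd T z 1) *s pd \<i> t (T z)"
    unfolding u(2) unfolding pd_def dd_compose(1)[OF T t] lin u(1) d
    by (simp_all add: vec_eq_iff field_simps)
qed

text \<open>For a holomorphic \<open>T\<close> each Wirtinger derivative of \<open>t\<close>
  composed with \<open>T\<close> is a multiple of the same derivative of \<open>t\<close>. No pure
  second derivative enters the mixed one, and the old vectors depend triangularly on the new
  ones.\<close>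

lemma chart_change_span:
  assumes U: "open U" "z \<in> U" and T: "smooth_on U T" "\<And>y. y \<in> U \<Longrightarrow> T y \<in> V"
      "\<And>y. y \<in> U \<Longrightarrow> dd T y \<i> = \<i> * dd T y 1"
    and f: "smooth_on U f" and t: "open V" "smooth_on V t" and s: "\<And>y. y \<in> U \<Longrightarrow> s y = f y *s t (T y)"
  shows "vec.span {s z, dz s z} \<subseteq> vec.span {t (T z), dz t (T z)}"
    "vec.span {s z, dzbar s z} \<subseteq> vec.span {t (T z), dzbar t (T z)}"
    "vec.span {s z, dz s z, dzbar s z, dz (dzbar s) z} \<subseteq>
      vec.span {t (T z), dz t (T z), dzbar t (T z), dz (dzbar t) (T z)}"
proof -
  have dT: "T differentiable (at y)" and df: "f differentiable (at y)" and dt: "t differentiable (at (T y))"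
    if "y \<in> U" for y
    using that T f t smooth_on_differentiable by blast+
  have dtT: "(\<lambda>y. t (T y)) differentiable (at y)" if "y \<in> U" for y
    by (rule dd_compose(2)[OF dT[OF that] dt[OF that]])
  have pd1: "pd k s y = spd k f y *s t (T y) + f y *s pd k (\<lambda>y. t (T y)) y" if y: "y \<in> U" for y k
    using pd_cong[OF U(1) y, of s "\<lambda>y. f y *s t (T y)", OF s] pd_vscale[OF df[OF y] dtT[OF y]] by simp
  have dz1: "dz s y = spd (- \<i>) f y *s t (T y) + (f y * dd T y 1) *s dz t (T y)" if y: "y \<in> U" for y
    unfolding dz_pd pd1[OF y] pd_compose[OF dT[OF y] dt[OF y] T(3)[OF y]] by simp
  have dzb1: "dzbar s y = spd \<i> f y *s t (T y) + (f y * cnj (dd T y 1)) *s dzbar t (T y)" if y: "y \<in> U" for y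
    unfolding dzbar_pd pd1[OF y] pd_compose[OF dT[OF y] dt[OF y] T(3)[OF y]] by simp
  have da: "spd \<i> f differentiable (at z)"
    using smooth_on_spd[OF U(1) f] smooth_on_differentiable U(2) by blast
  have db: "(\<lambda>y. f y * cnj (dd T y 1)) differentiable (at z)"
    by (intro differentiable_mult df[OF U(2)] smooth_on_differentiable[OF _ U(2)]
        smooth_on_bounded_linear[OF U(1) bounded_linear_cnj] smooth_on_dd[OF T(1)])
  have dtb: "dzbar t differentiable (at (T z))"
    unfolding dzbar_pd using smooth_on_pd[OF t] T(2)[OF U(2)] smooth_on_differentiable by blast
  have dtbT: "(\<lambda>y. dzbar t (T y)) differentiable (at z)" 
    by (rule dd_compose(2)[OF dT[OF U(2)] dtb])
  have "dz (dzbar s) z = pd (- \<i>) (\<lambda>y. spd \<i> f y *s t (T y) + (f y * cnj (dd T y 1)) *s dzbar t (T y)) z"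
    unfolding dz_pd by (rule pd_cong[OF U dzb1])
  also have "\<dots> = spd (- \<i>) (spd \<i> f) z *s t (T z) + spd \<i> f z *s (dd T z 1 *s dz t (T z))
      + (spd (- \<i>) (\<lambda>y. f y * cnj (dd T y 1)) z *s dzbar t (T z)
      + (f z * cnj (dd T z 1)) *s (dd T z 1 *s dz (dzbar t) (T z)))"
    using U(2) unfolding dz_pd
    by (simp only: pd_add pd_vscale differentiable_vscale da db dtT dtbT
        pd_compose(1)[OF dT dt T(3)] pd_compose(1)[OF dT[OF U(2)] dtb T(3)[OF U(2)]])
  finally have dzz: "dz (dzbar s) z = \<dots>" .
  note sp = vec.span_add vec.span_scale vec.span_base
  show "vec.span {s z, dz s z} \<subseteq> vec.span {t (T z), dz t (T z)}"
    "vec.span {s z, dzbar s z} \<subseteq> vec.span {t (T z), dzbar t (T z)}"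
    "vec.span {s z, dz s z, dzbar s z, dz (dzbar s) z} \<subseteq>
      vec.span {t (T z), dz t (T z), dzbar t (T z), dz (dzbar t) (T z)}"
    unfolding s[OF U(2)] dz1[OF U(2)] dzb1[OF U(2)] dzz
    by (intro vec.span_minimal vec.subspace_span insert_subsetI empty_subsetI sp; simp)+
qed

lemma frame_null:
  assumes "null_line_subbundle A \<Gamma>" "frame (\<Gamma> \<circ> snd c) W \<sigma>" "z \<in> W"
  shows "lform (\<sigma> z) (\<sigma> z) = 0"
  using frameD(5)[OF assms(2,3)] assms(1) by (auto simp: null_line_subbundle_def)

lemma smooth_on_cx: "open W \<Longrightarrow> smooth_on W \<sigma> \<Longrightarrow> smooth_on W (cx \<circ> \<sigma>)"
  using smooth_on_bounded_linear[OF _ bounded_linear_cx] by (simp add: o_def)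

lemma hol_frame_span:
  assumes A: "oriented_atlas A" and im: "immerses A \<Gamma>"
    and h: "hol_frame_at A \<Gamma> p D \<psi> z W \<sigma>" and h': "hol_frame_at A \<Gamma> p D' \<psi>' z' W' \<sigma>'"
  defines "s \<equiv> cx \<circ> \<sigma>" and "t \<equiv> cx \<circ> \<sigma>'"
  shows "vec.span {s z, dz s z} \<subseteq> vec.span {t z', dz t z'}"
    "vec.span {s z, dzbar s z} \<subseteq> vec.span {t z', dzbar t z'}"
    "vec.span {s z, dz s z, dzbar s z, dz (dzbar s) z} \<subseteq> vec.span {t z', dz t z', dzbar t z', dz (dzbar t) z'}"
proof -
  let ?c = "(D, \<psi>)" and ?c' = "(D', \<psi>')"
  let ?T = "transition ?c ?c'"
  have c: "?c \<in> hol_charts A \<Gamma>" "z \<in> W" "W \<subseteq> fst ?c" "frame (\<Gamma> \<circ> snd ?c) W \<sigma>"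
    and c': "?c' \<in> hol_charts A \<Gamma>" "z' \<in> W'" "W' \<subseteq> fst ?c'" "frame (\<Gamma> \<circ> snd ?c') W' \<sigma>'"
    and p: "\<psi> z = p" "\<psi>' z' = p"
    using h h' by (auto simp: hol_frame_at_def)
  note oc = hol_chartsD(1)[OF c(1)] hol_chartsD(1)[OF c'(1)]
  have nl: "null_line_subbundle A \<Gamma>" using im by (simp add: immerses_def)
  have "z \<in> fst ?c" "snd ?c z = snd ?c' z'" using c p by auto
  then obtain U0 where U0: "open U0" "z \<in> U0" "U0 \<subseteq> overlap ?c ?c'" "smooth_on U0 ?T"
    "\<And>y. y \<in> U0 \<Longrightarrow> ?T y \<in> W'" "frame (\<Gamma> \<circ> snd ?c) U0 (\<lambda>y. \<sigma>' (?T y))"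
    using frame_transfer[OF A oc(2,1) c'(4,3,2)] by metis
  define U where "U = U0 \<inter> W"
  have U: "open U" "z \<in> U" using U0 c frameD(1)[OF c(4)] by (auto simp: U_def)
  have Tz: "?T z = z'"
    using transition_unique[OF oriented_chartsD[OF oc(2)], of z' ?c z] c' p by auto
  \<comment> \<open>Non-zero null vectors have non-zero timelike coordinate, so a quotient of these
    coordinates is a smooth ratio of the two sections.\<close>
  define f where "f y = \<sigma> y $ 0 * inverse (\<sigma>' (?T y) $ 0)" for y
  have nz: "\<sigma>' (?T y) $ 0 \<noteq> 0" if "y \<in> U" for y
    using lform_null_perp(1)[OF frame_null[OF nl c'(4)] frameD(3)[OF c'(4)] lform_zero(1)] U0(5)[of y] that frame_null[OF nl c'(4)]
    by (simp add: U_def)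
  have sU: "smooth_on U \<sigma>" "smooth_on U (\<lambda>y. \<sigma>' (?T y))" "smooth_on U ?T"
    using frameD(2)[OF c(4)] frameD(2)[OF U0(6)] U0(4) by (auto simp: U_def intro: smooth_on_subset)
  have "smooth_on U f"
    unfolding f_def
    by (intro smooth_on_bilinear[OF U(1) bounded_bilinear_mult] smooth_on_inverse[OF U(1) nz]
        smooth_on_bounded_linear[OF U(1) bounded_linear_vec_nth] sU)
  then have f: "smooth_on U (\<lambda>y. complex_of_real (f y))"
    by (rule smooth_on_bounded_linear[OF U(1) bounded_linear_of_real])
  have s: "s y = complex_of_real (f y) *s t (?T y)" if y: "y \<in> U" for y
  proof -
    have "\<sigma> y \<in> vec.span {\<sigma>' (?T y)}"
      using frameD(5)[OF c(4), of y] frameD(4)[OF U0(6), of y] y by (simp add: U_def)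
    then obtain k where k: "\<sigma> y = k *s \<sigma>' (?T y)" unfolding span_singleton by blast
    then have "f y = k" using nz[OF y] by (simp add: f_def)
    then show ?thesis using k by (simp add: s_def t_def cx_def vec_eq_iff)
  qed
  have lin: "dd ?T y \<i> = \<i> * dd ?T y 1" if "y \<in> U" for y
    using hol_transition[OF A im c(1) c'(1)] that U0(3) by (auto simp: U_def)
  have TW: "?T y \<in> W'" if "y \<in> U" for y using that U0(5) by (simp add: U_def)
  note r = chart_change_span[OF U sU(3) TW lin f frameD(1)[OF c'(4)]
      smooth_on_cx[OF frameD(1,2)[OF c'(4)], folded t_def] s, unfolded Tz]
  show "vec.span {s z, dz s z} \<subseteq> vec.span {t z', dz t z'}" by (rule r(1))
  show "vec.span {s z, dzbar s z} \<subseteq> vec.span {t z', dzbar t z'}" by (rule r(2))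
  show "vec.span {s z, dz s z, dzbar s z, dz (dzbar s) z} \<subseteq> vec.span {t z', dz t z', dzbar t z', dz (dzbar t) z'}"
    by (rule r(3))
qed

text \<open>Independence of the choices behind each \<open>THE\<close>: the inclusions of
  \<open>hol_frame_span\<close> hold with the two frames interchanged, hence are equalities.\<close>

lemma hol_frame_bundles:
  assumes A: "oriented_atlas A" and im: "immerses A \<Gamma>" and h: "hol_frame_at A \<Gamma> p D \<psi> z W \<sigma>"
  defines "s \<equiv> cx \<circ> \<sigma>"
  shows "Lam10 A \<Gamma> p = vec.span {s z, dz s z}"
    "Lam01 A \<Gamma> p = vec.span {s z, dzbar s z}"
    "central_sphere A \<Gamma> p = vec.span {s z, dz s z, dzbar s z, dz (dzbar s) z}"
proof -
  note sub = hol_frame_span[OF A im]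
  show "Lam10 A \<Gamma> p = vec.span {s z, dz s z}"
    unfolding Lam10_def s_def
  proof (rule the_equality)
    show "\<exists>D \<psi> z' W \<sigma>'. hol_frame_at A \<Gamma> p D \<psi> z' W \<sigma>' \<and>
      vec.span {(cx \<circ> \<sigma>) z, dz (cx \<circ> \<sigma>) z} = vec.span {cx (\<sigma>' z'), dz (cx \<circ> \<sigma>') z'}"
      using h by (auto intro!: exI)
  next
    fix V assume "\<exists>D \<psi> z W \<sigma>. hol_frame_at A \<Gamma> p D \<psi> z W \<sigma> \<and> V = vec.span {cx (\<sigma> z), dz (cx \<circ> \<sigma>) z}"
    then obtain D' \<psi>' z' W' \<sigma>' where h': "hol_frame_at A \<Gamma> p D' \<psi>' z' W' \<sigma>'"
      and V: "V = vec.span {(cx \<circ> \<sigma>') z', dz (cx \<circ> \<sigma>') z'}" by auto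
    show "V = vec.span {(cx \<circ> \<sigma>) z, dz (cx \<circ> \<sigma>) z}"
      unfolding V by (intro subset_antisym sub(1)[OF h h'] sub(1)[OF h' h])
  qed
  show "Lam01 A \<Gamma> p = vec.span {s z, dzbar s z}"
    unfolding Lam01_def s_def
  proof (rule the_equality)
    show "\<exists>D \<psi> z' W \<sigma>'. hol_frame_at A \<Gamma> p D \<psi> z' W \<sigma>' \<and>
      vec.span {(cx \<circ> \<sigma>) z, dzbar (cx \<circ> \<sigma>) z} = vec.span {cx (\<sigma>' z'), dzbar (cx \<circ> \<sigma>') z'}"
      using h by (auto intro!: exI)
  next
    fix V assume "\<exists>D \<psi> z W \<sigma>. hol_frame_at A \<Gamma> p D \<psi> z W \<sigma> \<and> V = vec.span {cx (\<sigma> z), dzbar (cx \<circ> \<sigma>) z}"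
    then obtain D' \<psi>' z' W' \<sigma>' where h': "hol_frame_at A \<Gamma> p D' \<psi>' z' W' \<sigma>'"
      and V: "V = vec.span {(cx \<circ> \<sigma>') z', dzbar (cx \<circ> \<sigma>') z'}" by auto
    show "V = vec.span {(cx \<circ> \<sigma>) z, dzbar (cx \<circ> \<sigma>) z}"
      unfolding V by (intro subset_antisym sub(2)[OF h h'] sub(2)[OF h' h])
  qed
  show "central_sphere A \<Gamma> p = vec.span {s z, dz s z, dzbar s z, dz (dzbar s) z}"
    unfolding central_sphere_def s_def
  proof (rule the_equality)
    show "\<exists>D \<psi> z' W \<sigma>'. hol_frame_at A \<Gamma> p D \<psi> z' W \<sigma>' \<and>
      vec.span {(cx \<circ> \<sigma>) z, dz (cx \<circ> \<sigma>) z, dzbar (cx \<circ> \<sigma>) z, dz (dzbar (cx \<circ> \<sigma>)) z} =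
      vec.span {cx (\<sigma>' z'), dz (cx \<circ> \<sigma>') z', dzbar (cx \<circ> \<sigma>') z', dz (dzbar (cx \<circ> \<sigma>')) z'}"
      using h by (auto intro!: exI)
  next
    fix V assume "\<exists>D \<psi> z W \<sigma>. hol_frame_at A \<Gamma> p D \<psi> z W \<sigma> \<and>
      V = vec.span {cx (\<sigma> z), dz (cx \<circ> \<sigma>) z, dzbar (cx \<circ> \<sigma>) z, dz (dzbar (cx \<circ> \<sigma>)) z}"
    then obtain D' \<psi>' z' W' \<sigma>' where h': "hol_frame_at A \<Gamma> p D' \<psi>' z' W' \<sigma>'"
      and V: "V = vec.span {(cx \<circ> \<sigma>') z', dz (cx \<circ> \<sigma>') z', dzbar (cx \<circ> \<sigma>') z', dz (dzbar (cx \<circ> \<sigma>')) z'}"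
      by auto
    show "V = vec.span {(cx \<circ> \<sigma>) z, dz (cx \<circ> \<sigma>) z, dzbar (cx \<circ> \<sigma>) z, dz (dzbar (cx \<circ> \<sigma>)) z}"
      unfolding V by (intro subset_antisym sub(3)[OF h h'] sub(3)[OF h' h])
  qed
qed


section \<open>Null frames in holomorphic charts\<close>

text \<open>The real and imaginary parts of the complex square are the length difference and the
  product of the coordinate derivatives. One direction yields null frames in holomorphic charts, the
  other shows that charts remain holomorphic for the transform.\<close>

lemma conformal_iff_null:
  fixes \<sigma> :: "complex \<Rightarrow> real ^ 5"
  assumes d: "\<sigma> differentiable (at z)"
  shows "lform (dzbar (cx \<circ> \<sigma>) z) (dzbar (cx \<circ> \<sigma>) z) = 0 \<longleftrightarrow>
    (\<forall>X Y. lform (dd \<sigma> z (\<i> * X)) (dd \<sigma> z (\<i> * Y)) = lform (dd \<sigma> z X) (dd \<sigma> z Y))"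
    (is "?l \<longleftrightarrow> ?r")
proof -
  define a b where "a = dd \<sigma> z 1" and "b = dd \<sigma> z \<i>"
  have lin: "dd \<sigma> z X = Re X *s a + Im X *s b" for X
    using dd_complex[OF d, of X] by (simp add: a_def b_def scalar_mult_eq_scaleR)
  have "dzbar (cx \<circ> \<sigma>) z = (1 / 2) *s (cx a + \<i> *s cx b)"
    by (simp add: dzbar_def o_def dd_cx[OF d] a_def b_def)
  then have eq: "lform (dzbar (cx \<circ> \<sigma>) z) (dzbar (cx \<circ> \<sigma>) z) =
      (complex_of_real (lform a a - lform b b) + 2 * \<i> * complex_of_real (lform a b)) / 4"
    by (simp add: lform_simps lform_cx lform_commute[of b a] algebra_simps)
  have l: "?l \<longleftrightarrow> lform a a = lform b b \<and> lform a b = 0"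
    unfolding eq by (simp add: complex_eq_iff)
  have r: ?r if "lform a a = lform b b" "lform a b = 0"
    using that by (simp add: lin lform_simps lform_commute[of b a] algebra_simps)
  have "lform a a = lform b b \<and> lform a b = 0" if ?r
    using that[rule_format, of 1 1] that[rule_format, of 1 "\<i>"]
    by (simp add: lin lform_simps lform_commute[of b a])
  with l r show ?thesis by blast
qed

lemma conj_dz: 
  fixes \<sigma> :: "complex \<Rightarrow> real ^ 5"
  assumes "\<sigma> differentiable (at z)"
  shows "conjv (dzbar (cx \<circ> \<sigma>) z) = dz (cx \<circ> \<sigma>) z" "conjv (dz (cx \<circ> \<sigma>) z) = dzbar (cx \<circ> \<sigma>) z"
  by (simp_all add: dz_def dzbar_def o_def dd_cx[OF assms] conjv_ops)

text \<open>All products come from differentiating the nullity of \<open>s\<close> and of its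
  conjugate derivative. In particular the product of \<open>s\<close> with the mixed derivative is
  minus that of the two first derivatives, a positive metric value.\<close>

lemma null_frame_gram:
  assumes A: "oriented_atlas A" and im: "immerses A \<Gamma>" and h: "hol_frame_at A \<Gamma> p D \<psi> z W \<sigma>"
  defines "s \<equiv> cx \<circ> \<sigma>"
  shows "lform (s z) (s z) = 0" "lform (s z) (dz s z) = 0" "lform (s z) (dzbar s z) = 0"
    "lform (dz s z) (dz s z) = 0" "lform (dzbar s z) (dzbar s z) = 0" "lform (dz s z) (dzbar s z) \<noteq> 0"
    "lform (s z) (dz (dzbar s) z) \<noteq> 0" "lform (s z) (dzbar (dzbar s) z) = 0" 
    "lform (dzbar s z) (dzbar (dzbar s) z) = 0"
proof -
  let ?c = "(D, \<psi>)"
  have c: "?c \<in> hol_charts A \<Gamma>" "W \<subseteq> fst ?c" "frame (\<Gamma> \<circ> snd ?c) W \<sigma>" and z: "z \<in> W"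
    using h by (auto simp: hol_frame_at_def)
  note W = frameD(1)[OF c(3)]
  have nl: "null_line_subbundle A \<Gamma>" using im by (simp add: immerses_def)
  have d\<sigma>: "\<sigma> differentiable (at y)" if "y \<in> W" for y
    using frameD(2)[OF c(3)] that smooth_on_differentiable by blast
  have ss: "smooth_on W s" unfolding s_def by (rule smooth_on_cx[OF frameD(1,2)[OF c(3)]])
  have d: "s differentiable (at y)" and db: "dzbar s differentiable (at y)" if "y \<in> W" for y
    using ss smooth_on_pd[OF W ss] that smooth_on_differentiable unfolding dzbar_pd by blast+
  have null: "lform (s y) (s y) = 0" if "y \<in> W" for y
    using frame_null[OF nl c(3) that] by (simp add: s_def lform_cx)
  have perp: "lform (s y) (pd k s y) = 0" if y: "y \<in> W" for y k
  proof -
    have "lform (pd k s y) (s y) + lform (s y) (pd k s y) = 0"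
      using spd_eq_0[OF W y, of "\<lambda>y. lform (s y) (s y)", OF null] spd_lform[OF d[OF y] d[OF y]] by metis
    then show ?thesis by (simp add: lform_commute[of "pd k s y"])
  qed
  have bb: "lform (dzbar s y) (dzbar s y) = 0" if y: "y \<in> W" for y
    using hol_chartsD(2)[OF c y] by (simp add: s_def conformal_iff_null[OF d\<sigma>[OF y]])
  show "lform (s z) (s z) = 0" "lform (s z) (dz s z) = 0" "lform (s z) (dzbar s z) = 0"
    "lform (dzbar s z) (dzbar s z) = 0"
    using null[OF z] perp[OF z] bb[OF z] by (simp_all add: dz_pd dzbar_pd)
  show "lform (dz s z) (dz s z) = 0"
    using lform_conjv[of "dzbar s z" "dzbar s z"] bb[OF z] conj_dz[OF d\<sigma>[OF z]] by (simp add: s_def)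
  have ds: "dz s z = (1 / 2) *s (cx (dd \<sigma> z 1) - \<i> *s cx (dd \<sigma> z \<i>))"
    "dzbar s z = (1 / 2) *s (cx (dd \<sigma> z 1) + \<i> *s cx (dd \<sigma> z \<i>))"
    by (simp_all add: s_def dz_def dzbar_def o_def dd_cx[OF d\<sigma>[OF z]])
  have e: "lform (dz s z) (dzbar s z) =
      complex_of_real ((lform (dd \<sigma> z 1) (dd \<sigma> z 1) + lform (dd \<sigma> z \<i>) (dd \<sigma> z \<i>)) / 4)"
    unfolding ds by (simp add: lform_simps lform_cx lform_commute[of "dd \<sigma> z \<i>" "dd \<sigma> z 1"] algebra_simps)
  have "0 < lform (dd \<sigma> z X) (dd \<sigma> z X)" if "X \<noteq> 0" for X
    by (rule metric_pos[OF A im hol_chartsD(1)[OF c(1)] c(3,2) z that])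
  from this[of 1] this[of "\<i>"] have "lform (dd \<sigma> z 1) (dd \<sigma> z 1) + lform (dd \<sigma> z \<i>) (dd \<sigma> z \<i>) \<noteq> 0"
    by simp
  then show ne: "lform (dz s z) (dzbar s z) \<noteq> 0"
    unfolding e of_real_eq_0_iff by simp
  have sb: "lform (s y) (dzbar s y) = 0" if "y \<in> W" for y
    using perp[OF that] by (simp add: dzbar_pd)
  have "lform (pd k s z) (dzbar s z) + lform (s z) (pd k (dzbar s) z) = 0" for k
    using spd_eq_0[OF W z, of "\<lambda>y. lform (s y) (dzbar s y)", OF sb] spd_lform[OF d[OF z] db[OF z]] by metis
  from this[of "- \<i>"] this[of "\<i>"] show "lform (s z) (dz (dzbar s) z) \<noteq> 0" "lform (s z) (dzbar (dzbar s) z) = 0"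
    using ne bb[OF z] by (auto simp: dz_pd[symmetric] dzbar_pd[symmetric] add_eq_0_iff)
  show "lform (dzbar s z) (dzbar (dzbar s) z) = 0"
  proof -
    have "lform (pd \<i> (dzbar s) z) (dzbar s z) + lform (dzbar s z) (pd \<i> (dzbar s) z) = 0"
      using spd_eq_0[OF W z, of "\<lambda>y. lform (dzbar s y) (dzbar s y)", OF bb] spd_lform[OF db[OF z] db[OF z]]
      by metis
    then show ?thesis
      by (simp add: dzbar_pd[symmetric] lform_commute[of "dzbar (dzbar s) z" "dzbar s z"])
  qed
qed

section \<open>The dressed frame\<close>

text \<open>The same connection for functions, along \<open>\<partial>\<^sub>z\<close> for \<open>k = - \<i>\<close> and along the conjugate field for \<open>k = \<i>\<close>;
  \<open>f\<close> plays the role of \<open>\<sigma>\<^sub>\<infinity>\<close>, and \<open>h\<close> that of \<open>(H + k t) / 2\<close>.\<close>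

definition flat_op :: "complex \<Rightarrow> (complex \<Rightarrow> complex ^ 5) \<Rightarrow> (complex \<Rightarrow> complex ^ 5) \<Rightarrow> complex \<Rightarrow> complex \<Rightarrow>
    (complex \<Rightarrow> complex ^ 5) \<Rightarrow> complex \<Rightarrow> complex ^ 5" where
  "flat_op h n f k \<mu> x y = pd k x y + (\<mu> - 1) *s wedge (n y) (pd k n y) (x y)
     + (\<mu>\<^sup>2 - 1) *s (h *s wedge (f y) (pd k n y) (x y))"

text \<open>The degree 0 part, arranged so that the full operator at \<open>\<mu> = 1\<close> is
  plain differentiation.\<close>

definition base_op :: "dual ^ 5 \<Rightarrow> (complex ^ 5 \<Rightarrow> complex ^ 5) \<Rightarrow> dual ^ 5 \<Rightarrow> complex ^ 5" where
  "base_op n A x = vder x - wedge (vval n) (vder n) (vval x) - A (vval x)"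

lemma vec_scale_add: "c *s (x + y) = c *s x + c *s y" for x y :: "'a::comm_ring_1 ^ 'n"
  by (simp add: vec_eq_iff distrib_left)

lemma wedge_ops: "wedge a b (x + y) = wedge a b x + wedge a b y" "wedge a b (c *s x) = c *s wedge a b x"
  by (simp_all add: wedge_def lform_simps vec_eq_iff algebra_simps)

lemma wedge_skew: "lform (wedge a b x) y = - lform x (wedge a b y)"
  by (simp add: wedge_def lform_simps lform_commute[of a y] lform_commute[of b y])

lemma lax_base:
  assumes nn: "lform n n = 1"
    and A: "\<And>x y. A (x + y) = A x + A y" "\<And>c x. A (c *s x) = c *s A x" "\<And>x y. lform (A x) y = - lform x (A y)"
      "A (vval n) = 0"
  shows "lax (base_op n A) n (vder n) A"
proof -
  have n0: "lform (vval n) (vval n) = 1" using nn by (simp flip: val_lform)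
  have "lform (vder n) (vval n) + lform (vval n) (vder n) = 0" using nn by (simp flip: der_lform)
  then have b: "lform (vder n) (vval n) = 0" "lform (vval n) (vder n) = 0"
    by (simp_all add: lform_commute[of "vval n"])
  have "connection (base_op n A)"
    unfolding connection_def
  proof (intro conjI allI)
    fix x y f
    show "base_op n A (x + y) = base_op n A x + base_op n A y"
      by (simp add: base_op_def A wedge_def lform_simps vec_eq_iff algebra_simps)
    show "base_op n A (f *s x) = der f *s vval x + val f *s base_op n A x"
      by (simp add: base_op_def A wedge_def lform_simps vec_eq_iff algebra_simps)
    show "der (lform x y) = lform (base_op n A x) (vval y) + lform (vval x) (base_op n A y)"
      by (simp add: der_lform base_op_def wedge_def lform_simps A(3)
          lform_commute[of "vval n" "vval y"] lform_commute[of "vder n" "vval y"])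
  qed
  then show ?thesis
    using A nn by (simp add: lax_def base_op_def wedge_def n0 b)
qed

text \<open>Along z the spectral variable is \<open>inverse lam\<close>. Inverting pole and variable
  negates both coefficients, that is, exchanges factors of P and Q type.\<close>

lemma hCD_inverse:
  assumes "a \<noteq> 0" "\<mu> \<noteq> 0"
  shows "hC (inverse a) (inverse \<mu>) = - hC a \<mu>" "hD (inverse a) (inverse \<mu>) = - hD a \<mu>"
proof -
  have d: "(inverse \<mu>)\<^sup>2 - (inverse a)\<^sup>2 = - (\<mu>\<^sup>2 - a\<^sup>2) / (a\<^sup>2 * \<mu>\<^sup>2)"
    "(inverse \<mu>)\<^sup>2 + (inverse a)\<^sup>2 = (\<mu>\<^sup>2 + a\<^sup>2) / (a\<^sup>2 * \<mu>\<^sup>2)"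
    "- (2 * inverse a * inverse \<mu>) = - (2 * a * \<mu>) / (a\<^sup>2 * \<mu>\<^sup>2)"
    using assms by (simp_all add: field_simps power2_eq_square)
  have nz: "a\<^sup>2 * \<mu>\<^sup>2 \<noteq> 0" using assms by simp
  have fr: "X / e / (- Y / e) = - (X / Y)" if "e \<noteq> 0" for X Y e :: complex
    using that by simp
  show "hC (inverse a) (inverse \<mu>) = - hC a \<mu>" "hD (inverse a) (inverse \<mu>) = - hD a \<mu>"
    unfolding hC_def hD_def d by (rule fr[OF nz])+
qed

text \<open>\<open>f\<close> is a multiple of the null frame \<open>s\<close>, and \<open>l\<close> spans the parallel line bundle.\<close>

locale local_frames =
  fixes W :: "complex set" and s n f l :: "complex \<Rightarrow> complex ^ 5" and h \<alpha> :: complex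
  assumes W: "open W"
    and ds: "\<And>y. y \<in> W \<Longrightarrow> s differentiable (at y)" "\<And>y. y \<in> W \<Longrightarrow> dzbar s differentiable (at y)"
    and dn: "\<And>y. y \<in> W \<Longrightarrow> n differentiable (at y)" and dl: "\<And>y. y \<in> W \<Longrightarrow> l differentiable (at y)"
    and real: "\<And>y. conjv (s y) = s y" "\<And>y. conjv (n y) = n y" "\<And>y. conjv (f y) = f y"
    and nn: "\<And>y. y \<in> W \<Longrightarrow> lform (n y) (n y) = 1"
    and gram: "\<And>y. y \<in> W \<Longrightarrow> lform (s y) (s y) = 0" "\<And>y. y \<in> W \<Longrightarrow> lform (s y) (dz s y) = 0"
      "\<And>y. y \<in> W \<Longrightarrow> lform (s y) (dzbar s y) = 0" "\<And>y. y \<in> W \<Longrightarrow> lform (dz s y) (dz s y) = 0"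
      "\<And>y. y \<in> W \<Longrightarrow> lform (dzbar s y) (dzbar s y) = 0" "\<And>y. y \<in> W \<Longrightarrow> lform (dz s y) (dzbar s y) \<noteq> 0"
      "\<And>y. y \<in> W \<Longrightarrow> lform (s y) (dz (dzbar s) y) \<noteq> 0"
      "\<And>y. y \<in> W \<Longrightarrow> lform (s y) (dzbar (dzbar s) y) = 0"
      "\<And>y. y \<in> W \<Longrightarrow> lform (dzbar s y) (dzbar (dzbar s) y) = 0"
    and n: "\<And>y. y \<in> W \<Longrightarrow> lform (s y) (n y) = 0" "\<And>y. y \<in> W \<Longrightarrow> lform (dz s y) (n y) = 0"
      "\<And>y. y \<in> W \<Longrightarrow> lform (dzbar s y) (n y) = 0" "\<And>y. y \<in> W \<Longrightarrow> lform (dz (dzbar s) y) (n y) = 0"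
    and f: "\<And>y. y \<in> W \<Longrightarrow> \<exists>c. f y = c *s s y"
    and \<alpha>: "\<alpha> \<noteq> 0" "cmod \<alpha> \<noteq> 1"
    and l: "\<And>y. y \<in> W \<Longrightarrow> lform (l y) (l y) = 0" "\<And>y. y \<in> W \<Longrightarrow> lform (l y) (n y) \<noteq> 0"
    and par: "\<And>y. y \<in> W \<Longrightarrow> \<exists>\<theta>. flat_op (cnj h) n f (- \<i>) (inverse \<alpha>) l y = \<theta> *s l y"
      "\<And>y. y \<in> W \<Longrightarrow> \<exists>\<theta>. flat_op h n f \<i> \<alpha> l y = \<theta> *s l y"
begin

definition "\<beta> = inverse (cnj \<alpha>)"
definition "m1 y = mvec (n y) (conjv (l y))"
text \<open>Spans \<open>L_tilde\<close>: the q factor with pole \<open>\<beta>\<close> and the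
  conjugate line, evaluated at \<open>\<alpha>\<close>.\<close>

definition "lt y = hrot (n y) (m1 y) (hC \<beta> \<alpha>) (hD \<beta> \<alpha>) (l y)"
definition "m2 y = mvec (n y) (lt y)"
definition "R1 y = hrot (n y) (m1 y) (hC \<beta> 1) (hD \<beta> 1)"
definition "R2 y = hrot (n y) (m2 y) (- hC \<alpha> 1) (- hD \<alpha> 1)"
text \<open>The preimage of the normal under \<open>r_star\<close> at 1: the inverse rotations in
  reversed order.\<close>

definition "ns y = hrot (n y) (m1 y) (hC \<beta> 1) (- hD \<beta> 1) (hrot (n y) (m2 y) (- hC \<alpha> 1) (hD \<alpha> 1) (n y))"
text \<open>\<open>Lam10\<close> by equations instead of generators; see
  \<open>V10_span\<close>.\<close>

definition "V10 y = {x. lform x (n y) = 0 \<and> lform x (s y) = 0 \<and> lform x (dz s y) = 0}"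
definition "V01 y = {x. lform x (n y) = 0 \<and> lform x (s y) = 0 \<and> lform x (dzbar s y) = 0}"

text \<open>Everything rests on \<open>cmod \<beta> = inverse (cmod \<alpha>)\<close> and
  \<open>cmod \<alpha> \<noteq> 1\<close>: the poles differ up to sign, and 1 avoids both.\<close>

lemma \<beta>: "\<beta> \<noteq> 0" "\<beta>\<^sup>2 \<noteq> \<alpha>\<^sup>2" "\<alpha>\<^sup>2 \<noteq> \<beta>\<^sup>2" "1 \<noteq> \<beta>\<^sup>2" "1 \<noteq> \<alpha>\<^sup>2" "(inverse \<alpha>)\<^sup>2 \<noteq> (inverse \<beta>)\<^sup>2" "1 \<noteq> (inverse \<beta>)\<^sup>2"
    "1 \<noteq> (inverse \<alpha>)\<^sup>2"
proof -
  have a: "0 < cmod \<alpha>" using \<alpha> by simp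
  show 0: "\<beta> \<noteq> 0" using \<alpha> by (simp add: \<beta>_def)
  have nb: "cmod \<beta> = inverse (cmod \<alpha>)" by (simp add: \<beta>_def norm_inverse)
  have "cmod (\<beta>\<^sup>2) \<noteq> cmod (\<alpha>\<^sup>2)"
  proof
    assume "cmod (\<beta>\<^sup>2) = cmod (\<alpha>\<^sup>2)"
    then have "inverse (cmod \<alpha>) = cmod \<alpha>" using a by (simp add: norm_power nb power2_eq_iff_nonneg)
    then have "cmod \<alpha> * cmod \<alpha> = 1" using a by (simp add: field_simps)
    then show False using \<alpha>(2) a by (simp add: square_eq_1_iff)
  qed
  then show 1: "\<beta>\<^sup>2 \<noteq> \<alpha>\<^sup>2" "\<alpha>\<^sup>2 \<noteq> \<beta>\<^sup>2" by auto
  have one: "cmod w = 1" if "1 = w\<^sup>2" for w :: complex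
    using that by (metis norm_ge_zero norm_one norm_power power2_eq_1_iff abs_norm_cancel abs_of_nonneg
        neg_0_le_iff_le not_one_le_zero)
  show "1 \<noteq> \<alpha>\<^sup>2" using one[of \<alpha>] \<alpha> by auto
  show "1 \<noteq> \<beta>\<^sup>2" using one[of \<beta>] \<alpha> nb by auto
  show "(inverse \<alpha>)\<^sup>2 \<noteq> (inverse \<beta>)\<^sup>2" using 1 by (simp add: power_inverse)
  show "1 \<noteq> (inverse \<beta>)\<^sup>2" "1 \<noteq> (inverse \<alpha>)\<^sup>2" 
    using one[of "inverse \<beta>"] one[of "inverse \<alpha>"] \<alpha> nb by (auto simp: norm_inverse)
qed

lemma lbar: 
  assumes "y \<in> W"
  shows "lform (conjv (l y)) (conjv (l y)) = 0" "lform (conjv (l y)) (n y) \<noteq> 0"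
  using l[OF assms] lform_conjv[of "l y" "l y"] lform_conjv[of "l y" "n y"] by (simp_all add: real)

lemma m1:
  assumes "y \<in> W"
  shows "hpair (n y) (m1 y)" "conjv (l y) = lform (conjv (l y)) (n y) *s (n y + m1 y)"
  using mvec[OF nn[OF assms] lbar[OF assms]] by (simp_all add: m1_def)

lemma differentiable_mvec:
  assumes "x differentiable (at y)" "n differentiable (at y)" "lform (x y) (n y) \<noteq> 0"
  shows "(\<lambda>y. mvec (n y) (x y)) differentiable (at y)"
  unfolding mvec_def using assms
  by (intro differentiable_diff differentiable_vscale differentiable_inverse differentiable_lform)

lemma dm1: "y \<in> W \<Longrightarrow> m1 differentiable (at y)"
  unfolding m1_def
  by (intro differentiable_mvec differentiable_conjv dl dn lbar(2))

lemma dlt: "y \<in> W \<Longrightarrow> lt differentiable (at y)"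
  unfolding lt_def by (intro differentiable_hrot dn dm1 dl)

lemma lt_null:
  assumes "y \<in> W" shows "lform (lt y) (lt y) = 0"
  using hrot_orthogonal[OF m1(1)[OF assms] hCD(1)] l(1)[OF assms] \<beta> by (simp add: lt_def)

text \<open>The relations hold on an open set, so their derivatives vanish as well, which is what
  the relations over the dual numbers add.\<close>

lemma hpair_jet:
  assumes y: "y \<in> W" and m: "\<And>y. y \<in> W \<Longrightarrow> hpair (n y) (m y)" "m differentiable (at y)"
  shows "hpair (jet k n y) (jet k m y)"
proof -
  have "sjet k (\<lambda>y. lform (n y) (n y)) y = const 1" "sjet k (\<lambda>y. lform (m y) (m y)) y = const (- 1)"
    "sjet k (\<lambda>y. lform (n y) (m y)) y = const 0"
    unfolding sjet_const[of k _ y, symmetric] by (rule sjet_cong[OF W y], simp add: hpairD[OF m(1)])+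
  then show ?thesis
    using dn[OF y] m(2) by (simp add: hpair_def sjet_lform const_ops)
qed

definition "b k y = pd k n y"
definition "A c k y x = c *s wedge (f y) (b k y) x"
definition "nb c k y = base_op (jet k n y) (A c k y)"

lemma f_perp:
  assumes "y \<in> W"
  shows "lform (f y) (n y) = 0" "lform (f y) (s y) = 0" "lform (f y) (dz s y) = 0" "lform (f y) (dzbar s y) = 0"
    "lform (f y) (f y) = 0"
  using f[OF assms] gram[OF assms] n[OF assms] by (auto simp: lform_simps)

lemma b_n:
  assumes y: "y \<in> W"
  shows "lform (b k y) (n y) = 0" "lform (n y) (b k y) = 0"
proof -
  have "lform (b k y) (n y) + lform (n y) (b k y) = 0"
    using spd_eq_0[OF W y, of "\<lambda>y. lform (n y) (n y)", OF nn, of k] spd_lform[OF dn[OF y] dn[OF y]]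
    unfolding b_def by metis
  then show "lform (b k y) (n y) = 0" "lform (n y) (b k y) = 0"
    by (simp_all add: lform_commute[of "n y"])
qed

text \<open>Differentiating \<open>lform n s = 0\<close> and \<open>lform n (dzbar s) = 0\<close>
  along z moves the derivative onto vectors of the central sphere, the mixed derivative
  included.\<close>

lemma b_V01:
  assumes y: "y \<in> W"
  shows "b (- \<i>) y \<in> V01 y"
proof -
  have "lform (b (- \<i>) y) (s y) + lform (n y) (dz s y) = 0"
    using spd_eq_0[OF W y, of "\<lambda>y. lform (n y) (s y)" 0 "- \<i>"] spd_lform[OF dn[OF y] ds(1)[OF y], of "- \<i>"] n(1)
    unfolding b_def dz_pd by (simp add: lform_commute[of "n _" "s _"])
  moreover have "lform (b (- \<i>) y) (dzbar s y) + lform (n y) (dz (dzbar s) y) = 0"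
    using spd_eq_0[OF W y, of "\<lambda>y. lform (n y) (dzbar s y)" 0 "- \<i>"] spd_lform[OF dn[OF y] ds(2)[OF y], of "- \<i>"] n(3)
    unfolding b_def dz_pd by (simp add: lform_commute[of "n _" "dzbar s _"])
  ultimately show ?thesis
    using b_n[OF y] n[OF y] by (simp add: V01_def lform_commute[of "n y"])
qed

lemma conj_n: "y \<in> W \<Longrightarrow> conjv (b k y) = b (cnj k) y"
  using pd_conjv[OF dn, of y "cnj k"] by (simp add: b_def real)

lemma conj_s: "y \<in> W \<Longrightarrow> conjv (dzbar s y) = dz s y"
  using pd_conjv[OF ds(1), of y "- \<i>"] by (simp add: dz_pd dzbar_pd real)

lemma b_V10:
  assumes y: "y \<in> W"
  shows "b \<i> y \<in> V10 y"
proof -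
  have "lform (conjv (b (- \<i>) y)) (conjv x) = 0" if "lform (b (- \<i>) y) x = 0" for x
    using that by (simp add: lform_conjv)
  from this[of "n y"] this[of "s y"] this[of "dzbar s y"] show ?thesis
    using b_V01[OF y] by (simp add: V01_def V10_def conj_n[OF y] conj_s[OF y] real)
qed

lemma jet_nn: "y \<in> W \<Longrightarrow> lform (jet k n y) (jet k n y) = 1"
  using hpair_jet[OF _ m1(1) dm1] by (simp add: hpair_def)

lemma lax_frame:
  assumes y: "y \<in> W"
  shows "lax (nb c k y) (jet k n y) (b k y) (A c k y)"
proof -
  have "lax (base_op (jet k n y) (A c k y)) (jet k n y) (vder (jet k n y)) (A c k y)"
  proof (rule lax_base[OF jet_nn[OF y]])
    show "A c k y (vval (jet k n y)) = 0"
      using f_perp(1)[OF y] b_n(2)[OF y] by (simp add: A_def wedge_def lform_commute[of "n y" "f y"])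
  qed (simp_all add: A_def wedge_ops wedge_skew lform_scale_left lform_scale_right vec_scale_add mult.commute)
  then show ?thesis by (simp add: nb_def b_def)
qed

lemma nabla_flat:
  assumes "y \<in> W"
  shows "nabla (nb c k y) (jet k n y) (b k y) (A c k y) \<mu> (jet k x y) = flat_op c n f k \<mu> x y"
  by (simp add: nabla_def nb_def base_op_def flat_op_def A_def b_def wedge_def vec_eq_iff algebra_simps)

lemma nabla_one: "nabla (nb c k y) (jet k n y) (b k y) (A c k y) 1 x = vder x"
  by (simp add: nabla_def nb_def base_op_def A_def b_def wedge_def vec_eq_iff algebra_simps)

lemma flat_conj:
  assumes y: "y \<in> W"
  shows "conjv (flat_op c n f k \<mu> l y) = flat_op (cnj c) n f (cnj k) (cnj \<mu>) (\<lambda>y. conjv (l y)) y"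
proof -
  have "lform (conjv (l y)) (n y) = cnj (lform (l y) (n y))" "lform (conjv (l y)) (f y) = cnj (lform (l y) (f y))"
    "lform (conjv (l y)) (b (cnj k) y) = cnj (lform (l y) (b k y))"
    by (simp_all add: lform_conjv[symmetric] real conj_n[OF y])
  then show ?thesis
    using conj_n[OF y, of k] pd_conjv[OF dl[OF y], of "cnj k"]
    by (simp add: flat_op_def wedge_def conjv_ops real b_def)
qed

text \<open>Conjugation swaps the two directions, \<open>h\<close> with \<open>cnj h\<close>, and
  \<open>lam\<close> with \<open>inverse (cnj lam)\<close>; parallelism of \<open>l\<close> at
  \<open>\<alpha>\<close> thus gives that of its conjugate at \<open>\<beta>\<close>.\<close>

lemma par_conj:
  assumes y: "y \<in> W"
  shows "\<exists>\<theta>. flat_op (cnj h) n f (- \<i>) (inverse \<beta>) (\<lambda>y. conjv (l y)) y = \<theta> *s conjv (l y)"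
    "\<exists>\<theta>. flat_op h n f \<i> \<beta> (\<lambda>y. conjv (l y)) y = \<theta> *s conjv (l y)"
proof -
  obtain \<theta> where "flat_op h n f \<i> \<alpha> l y = \<theta> *s l y" using par(2)[OF y] by blast
  then have "conjv (\<theta> *s l y) = flat_op (cnj h) n f (- \<i>) (inverse \<beta>) (\<lambda>y. conjv (l y)) y"
    using flat_conj[OF y, of h "\<i>" \<alpha>] by (simp add: \<beta>_def)
  then show "\<exists>\<theta>. flat_op (cnj h) n f (- \<i>) (inverse \<beta>) (\<lambda>y. conjv (l y)) y = \<theta> *s conjv (l y)"
    unfolding conjv_ops by metis
  obtain \<theta> where "flat_op (cnj h) n f (- \<i>) (inverse \<alpha>) l y = \<theta> *s l y" using par(1)[OF y] by blast
  then have "conjv (\<theta> *s l y) = flat_op h n f \<i> \<beta> (\<lambda>y. conjv (l y)) y"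
    using flat_conj[OF y, of "cnj h" "- \<i>" "inverse \<alpha>"] by (simp add: \<beta>_def)
  then show "\<exists>\<theta>. flat_op h n f \<i> \<beta> (\<lambda>y. conjv (l y)) y = \<theta> *s conjv (l y)"
    unfolding conjv_ops by metis
qed

end

text \<open>The nondegeneracy of \<open>L_tilde\<close>, stated separately because \<open>lt\<close>
  is only available after the first factor.\<close>

locale dressed_frames = local_frames +
  assumes lt_n: "\<And>y. y \<in> W \<Longrightarrow> lform (lt y) (n y) \<noteq> 0"
begin

lemma m2:
  assumes "y \<in> W"
  shows "hpair (n y) (m2 y)" "lt y = lform (lt y) (n y) *s (n y + m2 y)"
  using mvec[OF nn[OF assms] lt_null[OF assms] lt_n[OF assms]] by (simp_all add: m2_def)

lemma dm2: "y \<in> W \<Longrightarrow> m2 differentiable (at y)"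
  unfolding m2_def by (intro differentiable_mvec dlt dn lt_n)

lemma jet_line:
  assumes y: "y \<in> W" and x: "\<And>y. y \<in> W \<Longrightarrow> x y = lform (x y) (n y) *s (n y + m y)"
    "x differentiable (at y)" "m differentiable (at y)"
  shows "jet k x y = sjet k (\<lambda>y. lform (x y) (n y)) y *s (jet k n y + jet k m y)"
proof -
  have "jet k x y = jet k (\<lambda>y. lform (x y) (n y) *s (n y + m y)) y"
    by (rule jet_cong[OF W y x(1)])
  also have "\<dots> = sjet k (\<lambda>y. lform (x y) (n y)) y *s (jet k n y + jet k m y)"
    using x(2,3) dn[OF y] by (simp add: jet_vscale jet_add differentiable_lform del: vector_add_ldistrib)
  finally show ?thesis .
qed

lemma jet_lt:
  assumes y: "y \<in> W"
  shows "hrot (jet k n y) (jet k m1 y) (const (hC \<beta> \<alpha>)) (const (hD \<beta> \<alpha>)) (jet k l y) =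
    sjet k (\<lambda>y. lform (lt y) (n y)) y *s (jet k n y + jet k m2 y)"
  using jet_line[OF y m2(2) dlt[OF y] dm2[OF y]] jet_hrot[OF dn[OF y] dm1[OF y] dl[OF y]]
  by (simp add: lt_def[abs_def])

lemma two_lines_frame:
  assumes y: "y \<in> W" and e: "e2\<^sup>2 \<noteq> e1\<^sup>2" "1 \<noteq> e1\<^sup>2" "1 \<noteq> e2\<^sup>2"
    and par1: "flat_op c n f k e1 (\<lambda>y. conjv (l y)) y = \<theta>1 *s conjv (l y)" and par2: "flat_op c n f k e2 l y = \<theta>2 *s l y"
  shows "two_lines (nb c k y) (jet k n y) (b k y) (A c k y) (jet k m1 y) (jet k m2 y) e1 e2
    (jet k (\<lambda>y. conjv (l y)) y) (jet k l y) \<theta>1 \<theta>2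
    (sjet k (\<lambda>y. lform (conjv (l y)) (n y)) y) (sjet k (\<lambda>y. lform (lt y) (n y)) y)"
  using e par1 par2 lbar(2)[OF y] lt_n[OF y]
  by (intro two_lines.intro lax_frame[OF y] hpair_jet[OF y m1(1) dm1[OF y]] hpair_jet[OF y m2(1) dm2[OF y]]
      jet_line[OF y m1(2) differentiable_conjv[OF dl[OF y]] dm1[OF y]])
    (simp_all add: nabla_flat[OF y])

text \<open>The values of \<open>r_star\<close> at 0 and, for \<open>F2\<close>, at infinity; see
  \<open>r_star_eq\<close>.\<close>

definition "F1 y = hrot (n y) (m1 y) (- 1) 0"
definition "F2 y = hrot (n y) (m2 y) (- 1) 0"

lemma jet_R:
  assumes y: "y \<in> W" and u: "u differentiable (at y)"
  shows "hrot (jet k n y) (jet k m2 y) (const (- hC \<alpha> 1)) (const (- hD \<alpha> 1))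
      (hrot (jet k n y) (jet k m1 y) (const (hC \<beta> 1)) (const (hD \<beta> 1)) (jet k u y)) =
    jet k (\<lambda>y. R2 y (R1 y (u y))) y"
  unfolding R1_def R2_def using dn[OF y] dm1[OF y] dm2[OF y] u
  by (simp add: jet_hrot differentiable_hrot)

text \<open>The linear coefficient is \<open>F1\<close> of a combination of the derivative of
  \<open>n\<close> with values of \<open>A\<close>, all in \<open>V01\<close> because
  \<open>f\<close> and \<open>n_z\<close> are. For the derivative of \<open>ns\<close> only this
  position matters, so the operators stay existential.\<close>

lemma dressed_dz:
  assumes y: "y \<in> W"
  shows "\<exists>nb' b' A' v. lax nb' (jet (- \<i>) n y) b' A' \<and> b' = F1 y v \<and> v \<in> V01 y \<and>
    (\<forall>u. u differentiable (at y) \<longrightarrow> R2 y (R1 y (dz u y)) =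
       nabla nb' (jet (- \<i>) n y) b' A' 1 (jet (- \<i>) (\<lambda>y. R2 y (R1 y (u y))) y))"
proof -
  let ?k = "- \<i>" and ?c = "cnj h"
  obtain \<theta>1 \<theta>2 where th: "flat_op ?c n f ?k (inverse \<beta>) (\<lambda>y. conjv (l y)) y = \<theta>1 *s conjv (l y)"
    "flat_op ?c n f ?k (inverse \<alpha>) l y = \<theta>2 *s l y"
    using par_conj(1)[OF y] par(1)[OF y] by blast
  note tl = two_lines_frame[OF y \<beta>(6,7,8) th]
  have hl: "hrot (jet ?k n y) (jet ?k m1 y) (const (- hC (inverse \<beta>) (inverse \<alpha>))) (const (- hD (inverse \<beta>) (inverse \<alpha>)))
     (jet ?k l y) = sjet ?k (\<lambda>y. lform (lt y) (n y)) y *s (jet ?k n y + jet ?k m2 y)"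
    using jet_lt[OF y] hCD_inverse[OF \<beta>(1) \<alpha>(1)] by simp
  have one: "hC (inverse \<alpha>) 1 = - hC \<alpha> 1" "hD (inverse \<alpha>) 1 = - hD \<alpha> 1"
    "- hC (inverse \<beta>) 1 = hC \<beta> 1" "- hD (inverse \<beta>) 1 = hD \<beta> 1"
    using hCD_inverse[of \<alpha> 1] hCD_inverse[of \<beta> 1] \<alpha>(1) \<beta>(1) by simp_all
  note QP = two_lines.dress_QP[OF tl hl, unfolded one]
  let ?v = "(2 * inverse \<alpha>) *s A ?c ?k y (F1 y (m2 y)) - (b ?k y + (2 * inverse \<beta>) *s A ?c ?k y (m1 y))"
  have AV: "A ?c ?k y x \<in> V01 y" for x
    using b_V01[OF y] f_perp[OF y] by (simp add: A_def wedge_def V01_def lform_simps)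
  have v: "?v \<in> V01 y"
    using AV[of "F1 y (m2 y)"] AV[of "m1 y"] b_V01[OF y] by (simp add: V01_def lform_simps)
  show ?thesis
    by (intro exI conjI allI impI, rule QP(1))
      (use v QP(2)[of "jet ?k _ y"] jet_R[OF y] in \<open>simp_all add: F1_def nabla_one R1_def R2_def dz_pd\<close>)
qed

text \<open>Unlike along z, connection and quadratic coefficient stay explicit: sections of the
  transform will be differentiated in this direction.\<close>

lemma dressed_dzbar:
  assumes y: "y \<in> W"
  shows "\<exists>b' A' v. lax (gauge_op (jet \<i> n y) (jet \<i> m1 y) (- 1) 0 (nb h \<i> y)) (jet \<i> n y) b' A' \<and>
    b' = F2 y v \<and> v \<in> V10 y \<and> (\<forall>x. A' x = F2 y (A h \<i> y (F2 y x))) \<and>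
    (\<forall>u. u differentiable (at y) \<longrightarrow> R2 y (R1 y (dzbar u y)) =
       nabla (gauge_op (jet \<i> n y) (jet \<i> m1 y) (- 1) 0 (nb h \<i> y)) (jet \<i> n y) b' A' 1
         (jet \<i> (\<lambda>y. R2 y (R1 y (u y))) y))"
proof -
  let ?k = "\<i>" and ?c = "h"
  obtain \<theta>1 \<theta>2 where th: "flat_op ?c n f ?k \<beta> (\<lambda>y. conjv (l y)) y = \<theta>1 *s conjv (l y)"
    "flat_op ?c n f ?k \<alpha> l y = \<theta>2 *s l y"
    using par_conj(2)[OF y] par(2)[OF y] by blast
  note tl = two_lines_frame[OF y \<beta>(3,4,5) th]
  note PQ = two_lines.dress_PQ[OF tl jet_lt[OF y]]
  let ?v = "- (b ?k y + (2 * \<beta>) *s A ?c ?k y (m1 y) + (2 * \<alpha>) *s A ?c ?k y (m2 y))"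
  have AV: "A ?c ?k y x \<in> V10 y" for x
    using b_V10[OF y] f_perp[OF y] by (simp add: A_def wedge_def V10_def lform_simps)
  have v: "?v \<in> V10 y"
    using AV[of "m2 y"] AV[of "m1 y"] b_V10[OF y] by (simp add: V10_def lform_simps)
  show ?thesis
    by (intro exI conjI allI impI, rule PQ(1))
      (use v PQ(2)[of "jet ?k _ y"] jet_R[OF y] in \<open>simp_all add: F2_def nabla_one R1_def R2_def dzbar_pd\<close>)
qed

section \<open>The new normal and sections of the transform\<close>

lemma nabla_n: "lax nb' n' b' A' \<Longrightarrow> nabla nb' n' b' A' 1 n' = b'"
  using laxD[of nb' n' b' A'] by (simp add: nabla_def val_lform[symmetric])

lemma hCD1: "hC \<beta> 1 * hC \<beta> 1 - hD \<beta> 1 * hD \<beta> 1 = 1" 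
    "(- hC \<alpha> 1) * (- hC \<alpha> 1) - (- hD \<alpha> 1) * (- hD \<alpha> 1) = 1"
  using hCD(1)[of 1 \<beta>] hCD(1)[of 1 \<alpha>] \<beta> by simp_all

lemma R_ns:
  assumes "y \<in> W"
  shows "R2 y (R1 y (ns y)) = n y"
  using hrot_inverse(2)[OF m1(1)[OF assms] hCD1(1)] hrot_inverse(2)[OF m2(1)[OF assms] hCD1(2)]
  by (simp add: R1_def R2_def ns_def)

lemma R_orthogonal:
  assumes "y \<in> W"
  shows "lform (R2 y (R1 y x)) (R2 y (R1 y x')) = lform x x'"
  using hrot_orthogonal[OF m1(1)[OF assms] hCD1(1)] hrot_orthogonal[OF m2(1)[OF assms] hCD1(2)]
  by (simp add: R1_def R2_def)

lemma dns: "y \<in> W \<Longrightarrow> ns differentiable (at y)"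
  unfolding ns_def by (intro differentiable_hrot dn dm1 dm2)

lemma F_adjoint: "lform (F1 y x) x' = lform x (F1 y x')" "lform (F2 y x) x' = lform x (F2 y x')"
  by (simp_all add: F1_def F2_def hrot_adjoint)

lemma F_F: "y \<in> W \<Longrightarrow> F1 y (F1 y x) = x" "y \<in> W \<Longrightarrow> F2 y (F2 y x) = x"
  using m1(1) m2(1) by (simp_all add: F1_def F2_def hrot_hrot hrot_id)

lemma F_n: "y \<in> W \<Longrightarrow> F1 y (n y) = - n y" "y \<in> W \<Longrightarrow> F2 y (n y) = - n y"
  using m1(1) m2(1) by (simp_all add: F1_def F2_def hrot_n vec_eq_iff)

lemma V10_span:
  assumes "y \<in> W"
  shows "V10 y = vec.span {s y, dz s y}"
  unfolding V10_def
  by (rule gram_isotropic[symmetric, where b = "dzbar s y" and d = "dz (dzbar s) y"])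
    (use gram[OF assms] n[OF assms] nn[OF assms] in auto)

lemma V01_span:
  assumes "y \<in> W"
  shows "V01 y = vec.span {s y, dzbar s y}"
  unfolding V01_def
  by (rule gram_isotropic[symmetric, where b = "dz s y" and d = "dz (dzbar s) y"])
    (use gram[OF assms] n[OF assms] nn[OF assms] in \<open>auto simp: lform_commute[of "dzbar s y" "dz s y"]\<close>)

lemma V01_combination:
  assumes "y \<in> W" "x \<in> V01 y"
  obtains c d where "x = c *s s y + d *s dzbar s y"
proof -
  have "x \<in> vec.span {s y, dzbar s y}" using assms V01_span by simp
  then obtain c d where "x - c *s s y - d *s dzbar s y = 0" by (auto simp: vec.span_insert)
  then show thesis by (intro that[of c d]) (simp add: algebra_simps)
qed

lemma V10_combination:
  assumes "y \<in> W" "x \<in> V10 y"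
  obtains c d where "x = c *s s y + d *s dz s y"
proof -
  have "x \<in> vec.span {s y, dz s y}" using assms V10_span by simp
  then obtain c d where "x - c *s s y - d *s dz s y = 0" by (auto simp: vec.span_insert)
  then show thesis by (intro that[of c d]) (simp add: algebra_simps)
qed

lemma isotropic:
  assumes y: "y \<in> W"
  shows "x \<in> V01 y \<Longrightarrow> x' \<in> V01 y \<Longrightarrow> lform x x' = 0" "x \<in> V10 y \<Longrightarrow> x' \<in> V10 y \<Longrightarrow> lform x x' = 0"
proof -
  assume x: "x \<in> V01 y" "x' \<in> V01 y"
  obtain c d where "x' = c *s s y + d *s dzbar s y" using V01_combination[OF y x(2)] .
  then show "lform x x' = 0" using x(1) by (simp add: V01_def lform_simps)
next
  assume x: "x \<in> V10 y" "x' \<in> V10 y"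
  obtain c d where "x' = c *s s y + d *s dz s y" using V10_combination[OF y x(2)] .
  then show "lform x x' = 0" using x(1) by (simp add: V10_def lform_simps)
qed

lemma F_isotropic:
  assumes "y \<in> W"
  shows "x \<in> F1 y ` V01 y \<Longrightarrow> x' \<in> F1 y ` V01 y \<Longrightarrow> lform x x' = 0"
    "x \<in> F2 y ` V10 y \<Longrightarrow> x' \<in> F2 y ` V10 y \<Longrightarrow> lform x x' = 0"
  using isotropic[OF assms] F_F[OF assms] by (auto simp: F_adjoint)

text \<open>At parameter 1 the dressed operator is plain differentiation seen through
  \<open>R2 y\<close> and \<open>R1 y\<close>, which carry \<open>ns\<close> to \<open>n\<close>. As
  \<open>n\<close> is parallel for the connection part, only the linear coefficient remains.\<close>

lemma ns_dz:
  assumes y: "y \<in> W"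
  shows "R2 y (R1 y (dz ns y)) \<in> F1 y ` V01 y"
proof -
  obtain nb' b' A' v where d: "lax nb' (jet (- \<i>) n y) b' A'" "b' = F1 y v" "v \<in> V01 y"
    "\<And>u. u differentiable (at y) \<Longrightarrow> R2 y (R1 y (dz u y)) =
       nabla nb' (jet (- \<i>) n y) b' A' 1 (jet (- \<i>) (\<lambda>y. R2 y (R1 y (u y))) y)"
    using dressed_dz[OF y] by blast
  have "jet (- \<i>) (\<lambda>y. R2 y (R1 y (ns y))) y = jet (- \<i>) n y"
    by (rule jet_cong[OF W y R_ns])
  then show ?thesis using d(2,3,4) dns[OF y] nabla_n[OF d(1)] by simp
qed

lemma ns_dzbar:
  assumes y: "y \<in> W"
  shows "R2 y (R1 y (dzbar ns y)) \<in> F2 y ` V10 y"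
proof -
  obtain b' A' v where d: "lax (gauge_op (jet \<i> n y) (jet \<i> m1 y) (- 1) 0 (nb h \<i> y)) (jet \<i> n y) b' A'"
    "b' = F2 y v" "v \<in> V10 y" "\<And>x. A' x = F2 y (A h \<i> y (F2 y x))"
    "\<And>u. u differentiable (at y) \<Longrightarrow> R2 y (R1 y (dzbar u y)) =
       nabla (gauge_op (jet \<i> n y) (jet \<i> m1 y) (- 1) 0 (nb h \<i> y)) (jet \<i> n y) b' A' 1
         (jet \<i> (\<lambda>y. R2 y (R1 y (u y))) y)"
    using dressed_dzbar[OF y] by blast
  have "jet \<i> (\<lambda>y. R2 y (R1 y (ns y))) y = jet \<i> n y"
    by (rule jet_cong[OF W y R_ns])
  then show ?thesis using d(2,3,5) dns[OF y] nabla_n[OF d(1)] by simp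
qed

text \<open>Differentiation along the conjugate direction keeps a section of \<open>V01\<close>
  orthogonal to \<open>s\<close> and \<open>dzbar s\<close>, by the products of these with
  \<open>dzbar (dzbar s)\<close>. The normal correction in \<open>nb\<close> restores tangency, and
  the quadratic term contributes a multiple of \<open>f\<close>.\<close>

lemma nb_V01:
  assumes y: "y \<in> W" and x: "\<And>y. y \<in> W \<Longrightarrow> x y \<in> V01 y" "x differentiable (at y)"
  shows "nb h \<i> y (jet \<i> x y) \<in> V01 y"
proof -
  have x0: "lform (x y) (n y) = 0" "lform (x y) (s y) = 0" "lform (x y) (dzbar s y) = 0" if "y \<in> W" for y
    using x(1)[OF that] by (simp_all add: V01_def)
  have d: "lform (pd \<i> x y) (g y) = - lform (x y) (pd \<i> g y)"
    if "g differentiable (at y)" "\<And>y. y \<in> W \<Longrightarrow> lform (x y) (g y) = 0" for g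
  proof -
    have "lform (pd \<i> x y) (g y) + lform (x y) (pd \<i> g y) = 0"
      using spd_eq_0[OF W y, of "\<lambda>y. lform (x y) (g y)", OF that(2)] spd_lform[OF x(2) that(1)] by metis
    then show ?thesis by (simp add: eq_neg_iff_add_eq_0)
  qed
  obtain c e where xy: "x y = c *s s y + e *s dzbar s y" using V01_combination[OF y x(1)[OF y]] .
  have "lform (x y) (f y) = 0" using f[OF y] x0[OF y] by (auto simp: lform_simps)
  then have "nb h \<i> y (jet \<i> x y) = pd \<i> x y + lform (x y) (b \<i> y) *s n y + (h * lform (x y) (b \<i> y)) *s f y"
    using x0[OF y] by (simp add: nb_def base_op_def A_def b_def wedge_def vec_eq_iff)
  moreover have "lform (pd \<i> x y) (n y) = - lform (x y) (b \<i> y)"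
    using d[OF dn[OF y] x0(1)] by (simp add: b_def)
  moreover have "lform (pd \<i> x y) (s y) = 0" 
    using d[OF ds(1)[OF y] x0(2)] x0(3)[OF y] by (simp add: dzbar_pd)
  moreover have "lform (pd \<i> x y) (dzbar s y) = 0"
    using d[OF ds(2)[OF y] x0(3)] gram(8,9)[OF y] by (simp add: xy lform_simps dzbar_pd)
  ultimately show ?thesis
    using nn[OF y] n[OF y] f_perp[OF y] 
    by (simp add: V01_def lform_simps lform_commute[of "n y" "s y"] lform_commute[of "n y" "dzbar s y"])
qed

text \<open>On the image of \<open>V10\<close> under \<open>F2\<close> the linear and quadratic
  coefficients vanish by isotropy. What remains is \<open>nb\<close> conjugated by
  \<open>F1\<close>, and it preserves the image of \<open>V01\<close>.\<close>

lemma dressed_section_dzbar: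
  assumes u: "\<And>y. y \<in> W \<Longrightarrow> R2 y (R1 y (u y)) \<in> F2 y ` V10 y \<inter> F1 y ` V01 y"
    and y: "y \<in> W" and du: "u differentiable (at y)"
  shows "R2 y (R1 y (dzbar u y)) \<in> F1 y ` V01 y"
proof -
  define w where "w y = R2 y (R1 y (u y))" for y
  let ?nb = "gauge_op (jet \<i> n y) (jet \<i> m1 y) (- 1) 0 (nb h \<i> y)"
  obtain b' A' v where d: "lax ?nb (jet \<i> n y) b' A'"
    "b' = F2 y v" "v \<in> V10 y" "\<And>x. A' x = F2 y (A h \<i> y (F2 y x))"
    "\<And>u. u differentiable (at y) \<Longrightarrow> R2 y (R1 y (dzbar u y)) =
       nabla ?nb (jet \<i> n y) b' A' 1 (jet \<i> (\<lambda>y. R2 y (R1 y (u y))) y)"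
    using dressed_dzbar[OF y] by blast
  have dw: "w differentiable (at y)"
    unfolding w_def R1_def R2_def by (intro differentiable_hrot dn dm1 dm2 y du)
  obtain x where x: "x \<in> V10 y" "w y = F2 y x" using u[OF y] by (auto simp: w_def)
  have "lform (w y) (n y) = 0" using x F_n[OF y] by (simp add: F_adjoint lform_simps V10_def)
  moreover have "lform (w y) b' = 0"
    using F_isotropic(2)[OF y] x d(2,3) by blast
  moreover have "A h \<i> y (F2 y (w y)) = 0"
    using x isotropic(2)[OF y x(1) b_V10[OF y]] f[OF y]
    by (auto simp: F_F[OF y] A_def wedge_def V10_def lform_simps)
  then have "A' (w y) = 0" using hrot_scale[of "n y" "m2 y" "- 1" 0 0] by (simp add: d(4) F2_def)
  ultimately have "R2 y (R1 y (dzbar u y)) = ?nb (jet \<i> w y)"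
    using d(5)[OF du] by (simp add: nabla_def w_def[symmetric])
  also have "\<dots> = F1 y (nb h \<i> y (jet \<i> (\<lambda>y. F1 y (w y)) y))"
    unfolding gauge_op_def F1_def using jet_hrot[OF dn[OF y] dm1[OF y] dw, of "\<i>" "- 1" 0] by (simp add: const_ops)
  also have "\<dots> \<in> F1 y ` V01 y"
  proof (intro imageI nb_V01[OF y])
    show "(\<lambda>y. F1 y (w y)) differentiable (at y)"
      unfolding F1_def by (intro differentiable_hrot dn dm1 y dw)
    show "F1 y (w y) \<in> V01 y" if yW: "y \<in> W" for y
    proof -
      obtain x where "x \<in> V01 y" "w y = F1 y x" using u[OF yW] by (auto simp: w_def)
      then show ?thesis by (simp add: F_F(1)[OF yW])
    qed
  qed
  finally show ?thesis .
qed

text \<open>Each derivative is shifted onto \<open>ns\<close>: \<open>dzbar u\<close> pairs as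
  \<open>u\<close> with \<open>dzbar ns\<close> in the plane of \<open>F2\<close>, while
  \<open>dz u\<close> and the mixed derivative lead to products in the plane of \<open>F1\<close>.
  The last equation is isotropy of that plane.\<close>

lemma dressed_section:
  assumes u: "\<And>y. y \<in> W \<Longrightarrow> R2 y (R1 y (u y)) \<in> F2 y ` V10 y \<inter> F1 y ` V01 y"
    and du: "\<And>y. y \<in> W \<Longrightarrow> u differentiable (at y)" "\<And>y. y \<in> W \<Longrightarrow> dzbar u differentiable (at y)" and y: "y \<in> W"
  shows "lform (u y) (ns y) = 0" "lform (dz u y) (ns y) = 0" "lform (dzbar u y) (ns y) = 0"
    "lform (dz (dzbar u) y) (ns y) = 0" "lform (dzbar u y) (dzbar u y) = 0"
proof -
  have un: "lform (u y) (ns y) = 0" if yW: "y \<in> W" for y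
  proof -
    obtain x where x: "x \<in> V10 y" "R2 y (R1 y (u y)) = F2 y x" using u[OF yW] by auto
    have "lform (u y) (ns y) = lform (F2 y x) (n y)"
      using R_orthogonal[OF yW, of "u y" "ns y"] R_ns[OF yW] x by simp
    then show ?thesis using x F_n[OF yW] by (simp add: F_adjoint lform_simps V10_def)
  qed
  have d: "lform (pd k g y) (ns y) = - lform (g y) (pd k ns y)"
    if "y \<in> W" "g differentiable (at y)" "\<And>y. y \<in> W \<Longrightarrow> lform (g y) (ns y) = 0" for g k y
  proof -
    have "lform (pd k g y) (ns y) + lform (g y) (pd k ns y) = 0"
      using spd_eq_0[OF W that(1), of "\<lambda>y. lform (g y) (ns y)", OF that(3)] spd_lform[OF that(2) dns[OF that(1)]]
      by metis
    then show ?thesis by (simp add: eq_neg_iff_add_eq_0)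
  qed
  have ub: "lform (dzbar u y) (ns y) = 0" if "y \<in> W" for y
    using d[OF that du(1)[OF that] un, of "\<i>"] R_orthogonal[OF that, of "u y" "dzbar ns y"]
      F_isotropic(2)[OF that _ ns_dzbar[OF that]] u[OF that] by (simp add: dzbar_pd)
  have dzb: "R2 y (R1 y (dzbar u y)) \<in> F1 y ` V01 y"
    by (rule dressed_section_dzbar[OF u y du(1)[OF y]])
  show "lform (u y) (ns y) = 0" "lform (dzbar u y) (ns y) = 0" by (rule un[OF y], rule ub[OF y])
  show "lform (dz u y) (ns y) = 0"
    using d[OF y du(1)[OF y] un, of "- \<i>"] R_orthogonal[OF y, of "u y" "dz ns y"]
      F_isotropic(1)[OF y _ ns_dz[OF y]] u[OF y] by (simp add: dz_pd)
  show "lform (dz (dzbar u) y) (ns y) = 0"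
    using d[OF y du(2)[OF y] ub, of "- \<i>"] R_orthogonal[OF y, of "dzbar u y" "dz ns y"]
      F_isotropic(1)[OF y dzb ns_dz[OF y]] by (simp add: dz_pd)
  show "lform (dzbar u y) (dzbar u y) = 0"
    using R_orthogonal[OF y, of "dzbar u y" "dzbar u y"] F_isotropic(1)[OF y dzb dzb] by simp
qed

text \<open>\<open>dress_vector\<close> is applied once per factor: the q factor turns the normal
  coefficient into \<open>- cnj h / \<mu> + h * \<mu>\<close>, the p factor into
  \<open>- cnj h / \<mu> - h * \<mu>\<close>.\<close>

lemma dressed_vector:
  assumes y: "y \<in> W" and u: "lform u (n y) = 0" "conjv u = u"
    and perp: "lform ((cnj h / \<alpha> + h * \<alpha>) *s n y + u) (l y) = 0"
  shows "lform ((cnj h + h) *s n y + u) (ns y) = - (cnj h + h)"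
proof -
  let ?n = "n y" and ?m = "m1 y"
  note hp = hpairD[OF m1(1)[OF y]]
  have "cnj (lform ((cnj h / \<alpha> + h * \<alpha>) *s ?n + u) (l y)) = lform ((cnj h / \<beta> + h * \<beta>) *s ?n + u) (conjv (l y))"
    by (simp add: lform_conjv[symmetric] conjv_ops real u(2) \<beta>_def field_simps add.commute)
  then have "lform ((cnj h / \<beta> + h * \<beta>) *s ?n + u) (conjv (l y)) = 0" using perp by simp
  then have "lform (conjv (l y)) ?n * lform ((cnj h / \<beta> + h * \<beta>) *s ?n + u) (?n + ?m) = 0"
    using m1(2)[OF y] lform_scale_right by metis
  then have perp1: "lform ((cnj h / \<beta> + h * \<beta>) *s ?n + u) (?n + ?m) = 0"
    using lbar(2)[OF y] by simp
  define u' where "u' = u + lform u ?m *s ?m + (h * \<beta> - cnj h / \<beta>) *s ?m"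
  define u'' where "u'' = F1 y u'"
  have u'': "lform u'' ?n = 0"
    using hp u(1) F_n[OF y] by (simp add: u''_def u'_def F_adjoint lform_simps)
  have h': "hC \<beta> \<mu> = - ((\<beta>\<^sup>2 + \<mu>\<^sup>2) / (\<beta>\<^sup>2 - \<mu>\<^sup>2))" "hD \<beta> \<mu> = - (- (2 * \<beta> * \<mu>) / (\<beta>\<^sup>2 - \<mu>\<^sup>2))"
    "- hC \<alpha> \<mu> = (\<alpha>\<^sup>2 + \<mu>\<^sup>2) / (\<alpha>\<^sup>2 - \<mu>\<^sup>2)" "- hD \<alpha> \<mu> = - (2 * \<alpha> * \<mu>) / (\<alpha>\<^sup>2 - \<mu>\<^sup>2)" for \<mu>
    by (simp_all add: hC_hD_minus)
  \<comment> \<open>Used at \<open>\<alpha>\<close>, to carry the orthogonality over to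
    \<open>lt\<close>, and at 1, to evaluate \<open>R1\<close>; the tangential part
    \<open>u''\<close> is the same for both.\<close>
  have step1: "hrot ?n ?m (hC \<beta> \<mu>) (hD \<beta> \<mu>) ((cnj h / \<mu> + h * \<mu>) *s ?n + u) = (- cnj h / \<mu> + h * \<mu>) *s ?n + u''"
    if "\<mu> \<noteq> 0" "\<beta>\<^sup>2 \<noteq> \<mu>\<^sup>2" for \<mu>
  proof -
    have fl: "hrot ?n ?m (- C) (- D) x = F1 y (hrot ?n ?m C D x)" for C D x
      by (simp add: F1_def hrot_hrot[OF m1(1)[OF y]])
    have Fadd: "F1 y (a *s ?n + x) = (- a) *s ?n + F1 y x" for a x
      using F_n(1)[OF y] by (simp add: F1_def hrot_add hrot_scale)
    show ?thesis
      unfolding h' fl dress_vector[OF m1(1)[OF y] u(1) \<beta>(1) that perp1] u'_def[symmetric] Fadd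
      by (simp add: u''_def)
  qed
  have "lform ((- cnj h / \<alpha> + h * \<alpha>) *s ?n + u'') (lt y) = 0"
    unfolding step1[OF \<alpha>(1) \<beta>(2), symmetric] lt_def
    using hrot_orthogonal[OF m1(1)[OF y] hCD(1)] \<beta>(2,3) perp by simp
  then have "lform (lt y) ?n * lform ((- cnj h / \<alpha> + h * \<alpha>) *s ?n + u'') (?n + m2 y) = 0"
    using m2(2)[OF y] lform_scale_right by metis
  then have perp2: "lform ((- cnj h / \<alpha> + h * \<alpha>) *s ?n + u'') (?n + m2 y) = 0"
    using lt_n[OF y] by simp
  have "R1 y ((cnj h + h) *s ?n + u) = (- cnj h / 1 + h * 1) *s ?n + u''"
    using step1[of 1] \<beta> by (simp add: R1_def)
  moreover have "R2 y \<dots> = (- cnj h / 1 - h * 1) *s ?n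
      + (u'' + lform u'' (m2 y) *s m2 y + (h * \<alpha> - (- cnj h) / \<alpha>) *s m2 y)"
    unfolding R2_def h' by (rule dress_vector[OF m2(1)[OF y] u'' \<alpha>(1) _ _ perp2]) (use \<beta> in auto)
  ultimately have "lform (R2 y (R1 y ((cnj h + h) *s ?n + u))) ?n = - (cnj h + h)"
    using u'' hpairD[OF m2(1)[OF y]] by (simp add: lform_simps)
  then show ?thesis
    using R_orthogonal[OF y, of "(cnj h + h) *s ?n + u" "ns y"] R_ns[OF y] by simp
qed

end

section \<open>Identification of the dressing factors with rotations\<close>

context local_frames
begin

lemma null_line_1: "y \<in> W \<Longrightarrow> null_line (n y) (m1 y)"
  using nn m1 by unfold_locales

lemma span_lbar:
  assumes "y \<in> W"
  shows "conjv ` vec.span {l y} = vec.span {n y + m1 y}"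
proof -
  have "conjv ` vec.span {l y} = range (\<lambda>c. conjv (c *s l y))" by (simp add: span_singleton image_image)
  also have "\<dots> = range (\<lambda>c. cnj c *s conjv (l y))" by (simp add: conjv_ops)
  also have "\<dots> = range (\<lambda>c. c *s conjv (l y))"
    by (intro subset_antisym subsetI) (auto intro: image_eqI[of _ _ "cnj _"])
  also have "\<dots> = vec.span {n y + m1 y}"
    using mvec(3)[OF nn[OF assms] lbar[OF assms]] by (simp add: m1_def span_singleton)
  finally show ?thesis .
qed

lemma q_dress_eq:
  assumes "y \<in> W" "\<beta>\<^sup>2 \<noteq> lam\<^sup>2"
  shows "q_dress (orth {n y}) (inverse (cnj \<alpha>)) (conjv ` vec.span {l y}) lam = hrot (n y) (m1 y) (hC \<beta> lam) (hD \<beta> lam)"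
  unfolding span_lbar[OF assms(1)] \<beta>_def[symmetric] hC_hD_minus
  by (rule null_line.dress_eq_hrot(2)[OF null_line_1[OF assms(1)] assms(2)])

lemma L_tilde_eq:
  assumes "y \<in> W"
  shows "L_tilde (orth {n y}) \<alpha> (vec.span {l y}) = vec.span {lt y}"
  unfolding L_tilde_def q_dress_eq[OF assms \<beta>(2)]
  by (simp add: span_singleton image_image hrot_scale lt_def)

end

context dressed_frames
begin

text \<open>The p factor is the identity at 0 and the q factor at infinity, so each of these values
  consists of a single sign change.\<close>

lemma r_star_eq:
  assumes y: "y \<in> W"
  shows "r_star (orth {n y}) \<alpha> (vec.span {l y}) 1 = R2 y \<circ> R1 y"
    "r_star (orth {n y}) \<alpha> (vec.span {l y}) 0 = F1 y"
    "r_star_inf (orth {n y}) \<alpha> (vec.span {l y}) = F2 y"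
proof -
  have tilde: "L_tilde (orth {n y}) \<alpha> (vec.span {l y}) = vec.span {n y + m2 y}"
    using mvec(3)[OF nn[OF y] lt_null[OF y] lt_n[OF y]] by (simp add: L_tilde_eq[OF y] m2_def)
  interpret null_line "n y" "m2 y" using nn m2 y by unfold_locales
  have p: "p_dress (orth {n y}) \<alpha> (vec.span {n y + m2 y}) lam = hrot (n y) (m2 y) (- hC \<alpha> lam) (- hD \<alpha> lam)"
    if "\<alpha>\<^sup>2 \<noteq> lam\<^sup>2" for lam
    unfolding dress_eq_hrot(1)[OF that] hC_hD_minus by simp
  show "r_star (orth {n y}) \<alpha> (vec.span {l y}) 1 = R2 y \<circ> R1 y"
    unfolding r_star_def tilde using p[of 1] q_dress_eq[OF y, of 1] \<beta> by (simp add: R1_def R2_def)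
  have "hC \<beta> 0 = - 1" "hD \<beta> 0 = 0" "hC \<alpha> 0 = - 1" "hD \<alpha> 0 = 0"
    using \<beta>(1) \<alpha>(1) by (simp_all add: hC_hD_minus)
  then show "r_star (orth {n y}) \<alpha> (vec.span {l y}) 0 = F1 y"
    unfolding r_star_def tilde using p[of 0] q_dress_eq[OF y, of 0] \<beta>(1) \<alpha>(1) by (auto simp: F1_def hrot_id)
  show "r_star_inf (orth {n y}) \<alpha> (vec.span {l y}) = F2 y"
    unfolding r_star_inf_def tilde p_dress_inf_eq_hrot by (auto simp: F2_def q_dress_inf_def)
qed

text \<open>The transform is defined with the choice operator \<open>inv\<close>, for which
  surjectivity gives a right inverse.\<close>

lemma R_surj: "y \<in> W \<Longrightarrow> R2 y (R1 y (inv (R2 y \<circ> R1 y) x)) = x"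
proof -
  assume y: "y \<in> W"
  have "surj (R2 y \<circ> R1 y)"
  proof (rule surjI)
    fix x
    show "(R2 y \<circ> R1 y) (hrot (n y) (m1 y) (hC \<beta> 1) (- hD \<beta> 1) (hrot (n y) (m2 y) (- hC \<alpha> 1) (hD \<alpha> 1) x)) = x"
      using hrot_inverse(2)[OF m1(1)[OF y] hCD1(1)] hrot_inverse(2)[OF m2(1)[OF y] hCD1(2)]
      by (simp add: R1_def R2_def)
  qed
  from surj_f_inv_f[OF this] show ?thesis by simp
qed

end


section \<open>The flat connections of a CMC surface\<close>

lemma dd_rotate:
  assumes "f differentiable (at z)"
  shows "dd f z (- 1) = - dd f z 1" "dd f z (- \<i>) = - dd f z \<i>"
  using dd_complex[OF assms, of "- 1"] dd_complex[OF assms, of "- \<i>"] by simp_all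

lemma wedge_right_ops: "wedge a (b + b') x = wedge a b x + wedge a b' x" "wedge a (c *s b) x = c *s wedge a b x"
  "wedge a (- b) x = - wedge a b x"
  by (simp_all add: wedge_def lform_simps vec_eq_iff algebra_simps)

text \<open>For a hyperplane bundle the off-diagonal part of \<open>d\<close> is built from
  \<open>n\<close> and its derivative alone.\<close>

lemma Dcon_hyperplane:
  assumes D: "open D" "z \<in> D" and S: "\<And>y. y \<in> D \<Longrightarrow> S y = orth {n y}"
    and n: "\<And>y. y \<in> D \<Longrightarrow> lform (n y) (n y) = 1" and dn: "n differentiable (at z)" and dx: "x differentiable (at z)"
  shows "Dcon S x z X = dd x z X - wedge (n z) (dd n z X) (x z)"
proof -
  have uv: "unit_vector (n y)" if "y \<in> D" for y using n[OF that] by unfold_locales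
  have nx: "(\<lambda>y. lform (x y) (n y) *s n y) differentiable (at z)"
    by (intro differentiable_vscale differentiable_lform dn dx)
  have c: "lform (dd n z X) (n z) = 0" "lform (n z) (dd n z X) = 0"
  proof -
    have "dd (\<lambda>y. lform (n y) (n y)) z X = dd (\<lambda>_. 1) z X" by (rule dd_cong[OF D n])
    then have "lform (n z) (dd n z X) + lform (dd n z X) (n z) = 0"
      by (simp add: dd_lform[OF dn dn] dd_const)
    then show "lform (dd n z X) (n z) = 0" "lform (n z) (dd n z X) = 0"
      by (simp_all add: lform_commute[of "n z"])
  qed
  have N: "dd (\<lambda>y. lform (x y) (n y) *s n y) z X = lform (x z) (n z) *s dd n z X
      + (lform (x z) (dd n z X) + lform (dd x z X) (n z)) *s n z"
    by (simp add: dd_vscale[OF differentiable_lform[OF dx dn] dn] dd_lform[OF dx dn])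
  have "dd (\<lambda>y. proj (S y) (orth (S y)) (x y)) z X = dd (\<lambda>y. x y - lform (x y) (n y) *s n y) z X"
    using S uv by (intro dd_cong[OF D]) (simp add: unit_vector.proj_hyperplane)
  then have 1: "dd (\<lambda>y. proj (S y) (orth (S y)) (x y)) z X = dd x z X - dd (\<lambda>y. lform (x y) (n y) *s n y) z X"
    by (simp add: dd_diff[OF dx nx])
  have 2: "dd (\<lambda>y. proj (orth (S y)) (S y) (x y)) z X = dd (\<lambda>y. lform (x y) (n y) *s n y) z X"
    using S uv by (intro dd_cong[OF D]) (simp add: unit_vector.proj_normal)
  show ?thesis
    unfolding Dcon_def 1 2 S[OF D(2)] unit_vector.proj_hyperplane[OF uv[OF D(2)]] unit_vector.proj_normal[OF uv[OF D(2)]] N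
    by (simp add: lform_simps c n[OF D(2)] wedge_def vec_eq_iff algebra_simps)
qed

lemma Nform_hyperplane:
  assumes D: "open D" "z \<in> D" and S: "\<And>y. y \<in> D \<Longrightarrow> S y = orth {n y}"
    and n: "\<And>y. y \<in> D \<Longrightarrow> lform (n y) (n y) = 1" and dn: "n differentiable (at z)"
  shows "Nform S z X w = wedge (n z) (dd n z X) w"
proof -
  have "Dcon S (\<lambda>_. w) z X = dd (\<lambda>_. w) z X - wedge (n z) (dd n z X) w"
    by (rule Dcon_hyperplane[OF D _ _ dn differentiable_const]) (use S n in simp_all)
  then show ?thesis by (simp add: Nform_def)
qed

text \<open>A (1,0)-part vanishes along the conjugate direction and a (0,1)-part along z.
  \<open>star\<close> acts there as \<open>\<i>\<close> and \<open>- \<i>\<close>, which gives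
  \<open>H + \<i> * t\<close> and \<open>H - \<i> * t\<close>; the factor \<open>1 / 2\<close> is
  that of \<open>eta_inf\<close>.\<close>

lemma dlam_flat:
  assumes D: "open D" "z \<in> D" and S: "\<And>y. y \<in> D \<Longrightarrow> S y = orth {n y}"
    and n: "\<And>y. y \<in> D \<Longrightarrow> lform (n y) (n y) = 1" and dn: "n differentiable (at z)" and dx: "x differentiable (at z)"
    and q: "\<And>X w. q z X w = H *s ((1 / 2) *s wedge (f z) (dd n z X) w)
       + t *s (- ((1 / 2) *s wedge (f z) (dd n z (\<i> * X)) w))"
  shows "(1 / 2) *s (dlam S q lam x z 1 + (- \<i>) *s dlam S q lam x z \<i>) = flat_op ((H - \<i> * t) / 2) n f (- \<i>) (inverse lam) x z"
    "(1 / 2) *s (dlam S q lam x z 1 + \<i> *s dlam S q lam x z \<i>) = flat_op ((H + \<i> * t) / 2) n f \<i> lam x z"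
proof -
  define P1 Pi Q1 Qi where "P1 = wedge (n z) (dd n z 1) (x z)" and "Pi = wedge (n z) (dd n z \<i>) (x z)"
    and "Q1 = wedge (f z) (dd n z 1) (x z)" and "Qi = wedge (f z) (dd n z \<i>) (x z)"
  have w: "wedge (n z) (dd n z (- 1)) (x z) = - P1" "wedge (n z) (dd n z (- \<i>)) (x z) = - Pi"
    "wedge (f z) (dd n z (- 1)) (x z) = - Q1" "wedge (f z) (dd n z (- \<i>)) (x z) = - Qi"
    by (simp_all add: dd_rotate[OF dn] wedge_right_ops P1_def Pi_def Q1_def Qi_def)
  have p: "wedge (n z) (pd k n z) (x z) = (1 / 2) *s (P1 + k *s Pi)" "wedge (f z) (pd k n z) (x z) = (1 / 2) *s (Q1 + k *s Qi)" for k
    by (simp_all only: pd_def wedge_right_ops P1_def Pi_def Q1_def Qi_def)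
  have D1: "Dcon S x z X = dd x z X - wedge (n z) (dd n z X) (x z)"
    and N1: "Nform S z X v = wedge (n z) (dd n z X) v" for X v
    by (rule Dcon_hyperplane[OF D _ _ dn dx] Nform_hyperplane[OF D _ _ dn]; use S n in simp)+
  define \<mu> where "\<mu> = inverse lam"
  have d1: "dlam S q lam x z 1 = dd x z 1 - P1 + \<mu> *s ((1 / 2) *s (P1 - \<i> *s Pi)) + lam *s ((1 / 2) *s (P1 + \<i> *s Pi))
     + (\<mu>\<^sup>2 - 1) *s (((H - \<i> * t) / 4) *s (Q1 - \<i> *s Qi)) + (lam\<^sup>2 - 1) *s (((H + \<i> * t) / 4) *s (Q1 + \<i> *s Qi))"
    unfolding dlam_def form10_def form01_def D1 N1 q \<mu>_def[symmetric]
    by (simp add: w P1_def[symmetric] Pi_def[symmetric] Q1_def[symmetric] Qi_def[symmetric])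
      (simp add: vec_eq_iff field_simps)
  have di: "dlam S q lam x z \<i> = dd x z \<i> - Pi + \<mu> *s ((1 / 2) *s (Pi + \<i> *s P1)) + lam *s ((1 / 2) *s (Pi - \<i> *s P1))
     + (\<mu>\<^sup>2 - 1) *s (((H - \<i> * t) / 4) *s (Qi + \<i> *s Q1)) + (lam\<^sup>2 - 1) *s (((H + \<i> * t) / 4) *s (Qi - \<i> *s Q1))"
    unfolding dlam_def form10_def form01_def D1 N1 q \<mu>_def[symmetric]
    by (simp add: w P1_def[symmetric] Pi_def[symmetric] Q1_def[symmetric] Qi_def[symmetric])
      (simp add: vec_eq_iff field_simps)
  show "(1 / 2) *s (dlam S q lam x z 1 + (- \<i>) *s dlam S q lam x z \<i>) = flat_op ((H - \<i> * t) / 2) n f (- \<i>) (inverse lam) x z"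
    unfolding d1 di flat_op_def p pd_def[of _ x] \<mu>_def[symmetric] by (simp add: vec_eq_iff field_simps)
  show "(1 / 2) *s (dlam S q lam x z 1 + \<i> *s dlam S q lam x z \<i>) = flat_op ((H + \<i> * t) / 2) n f \<i> lam x z"
    unfolding d1 di flat_op_def p pd_def[of _ x] \<mu>_def[symmetric] by (simp add: vec_eq_iff field_simps)
qed

lemma frame_subset: "frame E W s \<Longrightarrow> open W' \<Longrightarrow> W' \<subseteq> W \<Longrightarrow> frame E W' s"
  by (auto simp: frame_def intro: smooth_on_subset)

section \<open>From local frames to the surface\<close>

locale cmc_backlund =
  fixes A :: "'m::{t2_space, second_countable_topology} chart set"
    and \<Lambda> :: "'m \<Rightarrow> (real ^ 5) set" and v :: "real ^ 5" and t H :: real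
    and N :: "'m \<Rightarrow> real ^ 5" and \<alpha> :: complex and L :: "'m \<Rightarrow> (complex ^ 5) set"
  assumes atlas: "oriented_atlas A"
    and im: "immerses A \<Lambda>"
    and isothermal: "\<forall>p. \<exists>(D, \<psi>)\<in>hol_charts A \<Lambda>. p \<in> \<psi> ` D"
    and in_space_form: "\<forall>p. \<forall>u\<in>\<Lambda> p. u \<noteq> 0 \<longrightarrow> lform u v \<noteq> 0"
    and cmc: "cmc A \<Lambda> v H"
    and N: "unit_normal A \<Lambda> v N"
    and bp: "real_backlund_parameters A \<Lambda> (q_inf \<Lambda> v H N t) \<alpha> L"
    and perp: "\<forall>p. \<forall>l\<in>L p. lform (p_inf A \<Lambda> v H N t \<alpha> p) l = 0"
begin

abbreviation "h \<equiv> (complex_of_real H + \<i> * complex_of_real t) / 2"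
abbreviation "n c y \<equiv> cx (N (snd c y))"
abbreviation "f c y \<equiv> cx (sigma_inf \<Lambda> v (snd c y))"

lemma nl: "null_line_subbundle A \<Lambda>" "null_line_subbundle A L"
  using im bp by (auto simp: immerses_def real_backlund_parameters_def)

lemma NN: "lform (cx (N p)) (cx (N p)) = 1"
  using N by (simp add: unit_normal_def lform_cx)

lemma unit_normal_at: "unit_vector (cx (N p))"
  using NN by unfold_locales

lemma hol_cover:
  obtains c z where "c \<in> hol_charts A \<Lambda>" "z \<in> fst c" "snd c z = p"
proof -
  obtain c where c: "c \<in> hol_charts A \<Lambda>" "case c of (D, \<psi>) \<Rightarrow> p \<in> \<psi> ` D"
    using isothermal by blast
  then have "p \<in> snd c ` fst c" by (cases c) simp
  then show thesis using that c(1) by blast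
qed

lemma hol_frame_exists:
  assumes "c \<in> hol_charts A \<Lambda>" "z \<in> fst c"
  obtains W \<sigma> where "z \<in> W" "W \<subseteq> fst c" "frame (\<Lambda> \<circ> snd c) W \<sigma>"
  using frame_exists[OF atlas nl(1) hol_chartsD(1)[OF assms(1)] assms(2)] .

lemma hol_frame_atI:
  "c \<in> hol_charts A \<Gamma> \<Longrightarrow> W \<subseteq> fst c \<Longrightarrow> frame (\<Gamma> \<circ> snd c) W \<sigma> \<Longrightarrow> y \<in> W \<Longrightarrow>
    hol_frame_at A \<Gamma> (snd c y) (fst c) (snd c) y W \<sigma>"
  by (simp add: hol_frame_at_def)

lemma frame_normal:
  assumes "hol_frame_at A \<Lambda> p D \<psi> z W \<sigma>"
  defines "s \<equiv> cx \<circ> \<sigma>"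
  shows "lform (s z) (cx (N p)) = 0" "lform (dz s z) (cx (N p)) = 0"
    "lform (dzbar s z) (cx (N p)) = 0" "lform (dz (dzbar s) z) (cx (N p)) = 0"
proof -
  have "cx (N p) \<in> orth (vec.span {s z, dz s z, dzbar s z, dz (dzbar s) z})"
    using N unfolding unit_normal_def hol_frame_bundles(3)[OF atlas im assms(1), folded s_def, symmetric] by blast
  then have "lform (cx (N p)) x = 0" if "x \<in> {s z, dz s z, dzbar s z, dz (dzbar s) z}" for x
    using that by (simp only: mem_orth vec.span_base)
  then show "lform (s z) (cx (N p)) = 0" "lform (dz s z) (cx (N p)) = 0"
    "lform (dzbar s z) (cx (N p)) = 0" "lform (dz (dzbar s) z) (cx (N p)) = 0"
    by (simp_all add: lform_commute[of _ "cx (N p)"])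
qed

text \<open>\<open>unit_normal\<close> puts \<open>N\<close> into the orthogonal complement; the
  products of a null frame make the frame fill the whole hyperplane.\<close>

lemma sphere: "central_sphere A \<Lambda> p = orth {cx (N p)}"
proof -
  obtain c z where c: "c \<in> hol_charts A \<Lambda>" "z \<in> fst c" "snd c z = p"
    using hol_cover .
  obtain W \<sigma> where W: "z \<in> W" "W \<subseteq> fst c" "frame (\<Lambda> \<circ> snd c) W \<sigma>" using hol_frame_exists[OF c(1,2)] .
  note hf = hol_frame_atI[OF c(1) W(2,3,1), unfolded c(3)]
  have "cx (N p) \<noteq> 0" using NN[of p] by auto
  from gram_span[OF null_frame_gram(1-7)[OF atlas im hf] this frame_normal[OF hf]]
  show ?thesis using hol_frame_bundles(3)[OF atlas im hf] by simp
qed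

lemma N_differentiable:
  assumes c: "c \<in> hol_charts A \<Lambda>" "z \<in> fst c"
  shows "(N \<circ> snd c) differentiable (at z)"
proof -
  obtain a za where a: "a \<in> A" "za \<in> fst a" "snd a za = snd c z" using atlas_cover[OF atlas] by metis
  have zo: "z \<in> overlap c a" using a c(2) by (auto simp: overlap_def intro!: image_eqI[of _ _ za])
  obtain U where U: "open U" "z \<in> U" "U \<subseteq> overlap c a" "smooth_on U (transition c a)"
    using local_transition[OF atlas hol_chartsD(1)[OF c(1)] atlas_oriented[OF atlas a(1)] zo] by metis
  have Na: "smooth_on (fst a) (N \<circ> snd a)" using N a(1) by (auto simp: unit_normal_def)
  have "(\<lambda>y. (N \<circ> snd a) (transition c a y)) differentiable (at z)"
    by (rule dd_compose(2)[OF smooth_on_differentiable[OF U(4,2)] smooth_on_differentiable[OF Na transition_in[OF zo]]])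
  moreover have "(N \<circ> snd c) y = (N \<circ> snd a) (transition c a y)" if "y \<in> U" for y
    using transition_eq[of y c a] that U(3) by auto
  ultimately show ?thesis
    using differentiable_cong_open[OF U(1,2), of "N \<circ> snd c"] by simp
qed

lemma n_differentiable: "c \<in> hol_charts A \<Lambda> \<Longrightarrow> z \<in> fst c \<Longrightarrow> n c differentiable (at z)"
  using differentiable_cx[OF N_differentiable] by simp

lemma v_N: "lform (cx v) (cx (N p)) = complex_of_real H" "0 \<le> H"
proof -
  have H: "mean_curvature A \<Lambda> v p = H" using cmc by (simp add: cmc_def)
  have np: "normal_part A \<Lambda> v p = complex_of_real H *s cx (N p)"
    using N H by (simp add: unit_normal_def)
  have "lform (cx v) (cx (N p)) *s cx (N p) = normal_part A \<Lambda> v p"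
    unfolding normal_part_def sphere by (rule unit_vector.proj_normal[OF unit_normal_at, symmetric])
  from arg_cong[OF trans[OF this np], of "\<lambda>x. lform x (cx (N p))"] show "lform (cx v) (cx (N p)) = complex_of_real H" by (simp add: lform_simps NN)
  \<comment> \<open>As a value of a square root \<open>H\<close> is non-negative, which settles the
    sign at the end.\<close>
  have "H = sqrt (H * H)"
    using H unfolding mean_curvature_def np by (simp add: lform_simps NN)
  then show "0 \<le> H" by (metis real_sqrt_ge_0_iff zero_le_square)
qed

lemma sigma_inf_eq:
  assumes "frame (\<Lambda> \<circ> snd c) W \<sigma>" "y \<in> W"
  shows "sigma_inf \<Lambda> v (snd c y) = - ((1 / lform (\<sigma> y) v) *s \<sigma> y)"
  unfolding sigma_inf_def
proof (rule the_equality)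
  have m: "\<sigma> y \<in> \<Lambda> (snd c y)" "\<sigma> y \<noteq> 0" and sp: "\<Lambda> (snd c y) = vec.span {\<sigma> y}"
    using frameD(3,4,5)[OF assms(1)] assms(2) by auto
  show "\<exists>u\<in>\<Lambda> (snd c y). u \<noteq> 0 \<and> - ((1 / lform (\<sigma> y) v) *s \<sigma> y) = - ((1 / lform u v) *s u)"
    using m by blast
  fix x assume "\<exists>u\<in>\<Lambda> (snd c y). u \<noteq> 0 \<and> x = - ((1 / lform u v) *s u)"
  then obtain u where u: "u \<in> \<Lambda> (snd c y)" "u \<noteq> 0" "x = - ((1 / lform u v) *s u)" by blast
  then obtain k where "u = k *s \<sigma> y" unfolding sp span_singleton by blast
  then show "x = - ((1 / lform (\<sigma> y) v) *s \<sigma> y)"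
    using u by (auto simp: lform_simps)
qed

lemma flat_line:
  assumes c: "c \<in> hol_charts A \<Lambda>" and l: "frame (L \<circ> snd c) W l" "W \<subseteq> fst c" and y: "y \<in> W"
  shows "\<exists>\<theta>. flat_op (cnj h) (n c) (f c) (- \<i>) (inverse \<alpha>) l y = \<theta> *s l y"
    "\<exists>\<theta>. flat_op h (n c) (f c) \<i> \<alpha> l y = \<theta> *s l y"
proof -
  let ?S = "central_sphere A \<Lambda> \<circ> snd c"
  let ?dl = "dlam ?S (q_inf \<Lambda> v H N t c) \<alpha> l y"
  have ch: "open (fst c)" using oriented_chartsD[OF hol_chartsD(1)[OF c]] by (auto simp: chart_def split: prod.splits)
  have y1: "y \<in> fst c" using l y by auto
  have "parallel A \<Lambda> (q_inf \<Lambda> v H N t) \<alpha> L" using bp by (simp add: real_backlund_parameters_def)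
  moreover have "\<forall>z\<in>W. l z \<in> L (snd c z)" using frameD(5)[OF l(1)] by auto
  ultimately have "?dl X \<in> L (snd c y)" for X
    using c l(2) y frameD(1,2)[OF l(1)] unfolding parallel_def by blast
  then have dl: "?dl X \<in> vec.span {l y}" for X using frameD(4)[OF l(1) y] by simp
  have sp: "\<exists>\<theta>. (1 / 2) *s (?dl 1 + k *s ?dl \<i>) = \<theta> *s l y" for k
  proof -
    have "(1 / 2) *s (?dl 1 + k *s ?dl \<i>) \<in> vec.span {l y}"
      by (intro vec.span_scale vec.span_add dl)
    then show ?thesis unfolding span_singleton by blast
  qed
  have q: "q_inf \<Lambda> v H N t c y X w = complex_of_real H *s ((1 / 2) *s wedge (f c y) (dd (n c) y X) w)
       + complex_of_real t *s (- ((1 / 2) *s wedge (f c y) (dd (n c) y (\<i> * X)) w))" for X w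
    using dd_cx[OF N_differentiable[OF c y1]] by (simp add: q_inf_def eta_inf_def star_def)
  have fl: "(1 / 2) *s (?dl 1 + (- \<i>) *s ?dl \<i>) = flat_op ((complex_of_real H - \<i> * complex_of_real t) / 2) (n c) (f c) (- \<i>) (inverse \<alpha>) l y"
    "(1 / 2) *s (?dl 1 + \<i> *s ?dl \<i>) = flat_op h (n c) (f c) \<i> \<alpha> l y"
    by (rule dlam_flat[where n = "n c" and f = "f c" and x = l and q = "q_inf \<Lambda> v H N t c"
          and H = "complex_of_real H" and t = "complex_of_real t", OF ch y1 _ NN n_differentiable[OF c y1] smooth_on_differentiable[OF frameD(2)[OF l(1)] y] q];
        simp add: sphere)+
  show "\<exists>\<theta>. flat_op (cnj h) (n c) (f c) (- \<i>) (inverse \<alpha>) l y = \<theta> *s l y"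
    using sp[of "- \<i>"] unfolding fl by simp
  show "\<exists>\<theta>. flat_op h (n c) (f c) \<i> \<alpha> l y = \<theta> *s l y"
    using sp[of "\<i>"] unfolding fl .
qed

text \<open>The neighbourhood \<open>W0\<close> is prescribed so that a frame of the transform can
  be restricted to the same domain.\<close>

lemma dressed_frames_exist:
  assumes c: "c \<in> hol_charts A \<Lambda>" "z \<in> fst c" and W0: "open W0" "z \<in> W0"
  obtains W \<sigma> l where "open W" "z \<in> W" "W \<subseteq> W0" "W \<subseteq> fst c" "frame (\<Lambda> \<circ> snd c) W \<sigma>" "frame (L \<circ> snd c) W l"
    "dressed_frames W (cx \<circ> \<sigma>) (n c) (f c) l h \<alpha>"
proof -
  note oc = hol_chartsD(1)[OF c(1)]
  obtain W1 \<sigma> where W1: "z \<in> W1" "W1 \<subseteq> fst c" "frame (\<Lambda> \<circ> snd c) W1 \<sigma>" using hol_frame_exists[OF c] .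
  obtain W2 l where W2: "z \<in> W2" "W2 \<subseteq> fst c" "frame (L \<circ> snd c) W2 l"
    using frame_exists[OF atlas nl(2) oc c(2)] .
  define W where "W = W0 \<inter> W1 \<inter> W2"
  have Wf: "open W" "z \<in> W" "W \<subseteq> W0" "W \<subseteq> fst c"
    using W0 W1 W2 frameD(1)[OF W1(3)] frameD(1)[OF W2(3)] by (auto simp: W_def)
  have f\<sigma>: "frame (\<Lambda> \<circ> snd c) W \<sigma>" and fl: "frame (L \<circ> snd c) W l"
    using frame_subset[OF W1(3) Wf(1)] frame_subset[OF W2(3) Wf(1)] by (auto simp: W_def)
  have hf: "hol_frame_at A \<Lambda> (snd c y) (fst c) (snd c) y W \<sigma>" if "y \<in> W" for y
    by (rule hol_frame_atI[OF c(1) Wf(4) f\<sigma> that])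
  have ss: "smooth_on W (cx \<circ> \<sigma>)" by (rule smooth_on_cx[OF frameD(1,2)[OF f\<sigma>]])
  have lf: "L (snd c y) = vec.span {l y}" "l y \<noteq> 0" if "y \<in> W" for y
    using frameD(3,4)[OF fl that] by auto
  have ln: "lform (l y) (l y) = 0" if "y \<in> W" for y by (rule frame_null[OF nl(2) fl that])
  have nd: "rho (orth {n c y}) ` vec.span {l y} \<inter> orth (vec.span {l y}) = {0}"
    "rho (orth {n c y}) ` L_tilde (orth {n c y}) \<alpha> (vec.span {l y}) \<inter> orth (L_tilde (orth {n c y}) \<alpha> (vec.span {l y})) = {0}"
    if "y \<in> W" for y
  proof -
    have "\<forall>p. rho (orth {cx (N p)}) ` L p \<inter> orth (L p) = {0} \<and>
        rho (orth {cx (N p)}) ` L_tilde (orth {cx (N p)}) \<alpha> (L p) \<inter> orth (L_tilde (orth {cx (N p)}) \<alpha> (L p)) = {0}"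
      using bp by (simp add: real_backlund_parameters_def Let_def sphere)
    from this[rule_format, of "snd c y"] show "rho (orth {n c y}) ` vec.span {l y} \<inter> orth (vec.span {l y}) = {0}"
      "rho (orth {n c y}) ` L_tilde (orth {n c y}) \<alpha> (vec.span {l y}) \<inter> orth (L_tilde (orth {n c y}) \<alpha> (vec.span {l y})) = {0}"
      unfolding lf(1)[OF that] by blast+
  qed
  have "local_frames W (cx \<circ> \<sigma>) (n c) (f c) l h \<alpha>"
  proof
    fix y assume y: "y \<in> W"
    note gr = null_frame_gram[OF atlas im hf[OF y]]
    show "(cx \<circ> \<sigma>) differentiable (at y)" "dzbar (cx \<circ> \<sigma>) differentiable (at y)"
      unfolding dzbar_pd using ss smooth_on_pd[OF Wf(1) ss] y smooth_on_differentiable by blast+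
    show "n c differentiable (at y)" using n_differentiable[OF c(1)] Wf(4) y by blast
    show "l differentiable (at y)" by (rule smooth_on_differentiable[OF frameD(2)[OF fl] y])
    show "\<exists>k. f c y = k *s (cx \<circ> \<sigma>) y"
      unfolding sigma_inf_eq[OF f\<sigma> y]
      by (intro exI[of _ "complex_of_real (- (1 / lform (\<sigma> y) v))"]) (simp add: cx_def vec_eq_iff)
    show "lform (l y) (n c y) \<noteq> 0"
      by (rule unit_vector.nondegenerate_line[OF unit_normal_at nd(1)[OF y] lf(2)[OF y] ln[OF y]])
  qed (use Wf bp NN ln null_frame_gram[OF atlas im hf] frame_normal[OF hf] flat_line[OF c(1) fl Wf(4)]
    in \<open>simp_all add: conjv_ops real_backlund_parameters_def\<close>)
  then interpret local_frames W "cx \<circ> \<sigma>" "n c" "f c" l h \<alpha> .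
  have df: "dressed_frames W (cx \<circ> \<sigma>) (n c) (f c) l h \<alpha>"
  proof
    fix y assume y: "y \<in> W"
    \<comment> \<open>The rotation is invertible, so \<open>lt y = 0\<close> would force
      \<open>l y = 0\<close>.\<close>
    have "lt y \<noteq> 0"
    proof
      assume "lt y = 0"
      then have "rho (orth {n c y}) ` vec.span {lt y} = {rho (orth {n c y}) 0}" by (simp add: span_singleton)
      moreover have "l y = hrot (n c y) (m1 y) (hC \<beta> \<alpha>) (- hD \<beta> \<alpha>) (lt y)"
        using hrot_inverse(1)[OF m1(1)[OF y] hCD(1)] \<beta> by (simp add: lt_def)
      then have "l y = 0" using \<open>lt y = 0\<close> by (simp add: hrot_def)
      ultimately show False using lf(2)[OF y] by simp
    qed
    then show "lform (lt y) (n c y) \<noteq> 0"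
      using unit_vector.nondegenerate_line[OF unit_normal_at nd(2)[OF y, unfolded L_tilde_eq[OF y]] _ lt_null[OF y]]
      by simp
  qed
  show thesis by (rule that[OF Wf f\<sigma> fl df])
qed

abbreviation "\<Lambda>' \<equiv> backlund_transform A \<Lambda> \<alpha> L"

lemma backlund_frame:
  assumes c: "c \<in> hol_charts A \<Lambda>" and u: "frame (\<Lambda>' \<circ> snd c) W0 u" "W0 \<subseteq> fst c" and z: "z \<in> W0"
  obtains W \<sigma> l where "z \<in> W" "W \<subseteq> W0" "frame (L \<circ> snd c) W l" "dressed_frames W (cx \<circ> \<sigma>) (n c) (f c) l h \<alpha>"
    "\<And>y. y \<in> W \<Longrightarrow> lform ((cx \<circ> u) y) (local_frames.ns (n c) l \<alpha> y) = 0"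
    "\<And>y. y \<in> W \<Longrightarrow> lform (dz (cx \<circ> u) y) (local_frames.ns (n c) l \<alpha> y) = 0"
    "\<And>y. y \<in> W \<Longrightarrow> lform (dzbar (cx \<circ> u) y) (local_frames.ns (n c) l \<alpha> y) = 0"
    "\<And>y. y \<in> W \<Longrightarrow> lform (dz (dzbar (cx \<circ> u)) y) (local_frames.ns (n c) l \<alpha> y) = 0"
    "\<And>y. y \<in> W \<Longrightarrow> lform (dzbar (cx \<circ> u) y) (dzbar (cx \<circ> u) y) = 0"
proof -
  have z1: "z \<in> fst c" using u z by auto
  obtain W \<sigma> l where Wf: "open W" "z \<in> W" "W \<subseteq> W0" "W \<subseteq> fst c" "frame (\<Lambda> \<circ> snd c) W \<sigma>" "frame (L \<circ> snd c) W l"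
    "dressed_frames W (cx \<circ> \<sigma>) (n c) (f c) l h \<alpha>"
    using dressed_frames_exist[OF c z1 frameD(1)[OF u(1)] z] .
  interpret dressed_frames W "cx \<circ> \<sigma>" "n c" "f c" l h \<alpha> by (rule Wf(7))
  have su: "smooth_on W (cx \<circ> u)"
    using smooth_on_cx[OF frameD(1,2)[OF u(1)]] Wf(3) smooth_on_subset by blast
  have du: "(cx \<circ> u) differentiable (at y)" "dzbar (cx \<circ> u) differentiable (at y)" if "y \<in> W" for y
    unfolding dzbar_pd using su smooth_on_pd[OF Wf(1) su] that smooth_on_differentiable by blast+
  \<comment> \<open>Undoing \<open>inv\<close> in the definition of the transform turns membership
    into membership in the two dressed planes.\<close>
  have sec: "R2 y (R1 y ((cx \<circ> u) y)) \<in> F2 y ` V10 y \<inter> F1 y ` V01 y" if y: "y \<in> W" for y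
  proof -
    note hf = hol_frame_atI[OF c Wf(4,5) y]
    have "u y \<in> \<Lambda>' (snd c y)" using frameD(5)[OF u(1), of y] y Wf(3) by auto
    then have "cx (u y) \<in> backlund_transform_complex A \<Lambda> \<alpha> L (snd c y)"
      by (simp add: backlund_transform_def)
    then have "cx (u y) \<in> inv (R2 y \<circ> R1 y) ` (F2 y ` V10 y \<inter> F1 y ` V01 y)"
      using frameD(4)[OF Wf(6) y] hol_frame_bundles(1,2)[OF atlas im hf] V10_span[OF y] V01_span[OF y]
      by (simp add: backlund_transform_complex_def sphere r_star_eq[OF y])
    then obtain x where "x \<in> F2 y ` V10 y \<inter> F1 y ` V01 y" "cx (u y) = inv (R2 y \<circ> R1 y) x" by blast
    then show ?thesis using R_surj[OF y, of x] by simp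
  qed
  note ds = dressed_section[OF sec du]
  show thesis by (rule that[OF Wf(2,3,6,7) ds])
qed

text \<open>The conjugate derivative of a section of the transform is null, so the conformal
  structure is preserved and the new central sphere can be computed in the old charts.\<close>

lemma hol_charts_backlund: "hol_charts A \<Lambda> \<subseteq> hol_charts A \<Lambda>'"
proof
  fix c assume c: "c \<in> hol_charts A \<Lambda>"
  have "lform (dd u z (\<i> * X)) (dd u z (\<i> * Y)) = lform (dd u z X) (dd u z Y)"
    if u: "frame (\<Lambda>' \<circ> snd c) W0 u" "W0 \<subseteq> fst c" "z \<in> W0" for W0 u z X Y
  proof -
    have "lform (dzbar (cx \<circ> u) z) (dzbar (cx \<circ> u) z) = 0"
      by (rule backlund_frame[OF c u]) blast
    then show ?thesis
      using conformal_iff_null[OF smooth_on_differentiable[OF frameD(2)[OF u(1)] u(3)]] by blast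
  qed
  then show "c \<in> hol_charts A \<Lambda>'"
    using hol_chartsD(1)[OF c] by (cases c) (auto simp: hol_charts_def)
qed

lemma mean_curvature_backlund:
  assumes im': "immerses A \<Lambda>'"
  shows "mean_curvature A \<Lambda>' v p = H"
proof -
  obtain c z where c: "c \<in> hol_charts A \<Lambda>" "z \<in> fst c" "snd c z = p"
    using hol_cover .
  note c' = subsetD[OF hol_charts_backlund c(1)]
  have nl': "null_line_subbundle A \<Lambda>'" using im' by (simp add: immerses_def)
  obtain W0 u where u: "z \<in> W0" "W0 \<subseteq> fst c" "frame (\<Lambda>' \<circ> snd c) W0 u"
    using frame_exists[OF atlas nl' hol_chartsD(1)[OF c(1)] c(2)] .
  note hf = hol_frame_atI[OF c' u(2,3,1), unfolded c(3)]
  obtain W \<sigma> l where Wf: "z \<in> W" "W \<subseteq> W0" "frame (L \<circ> snd c) W l" "dressed_frames W (cx \<circ> \<sigma>) (n c) (f c) l h \<alpha>"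
    and u_ns: "\<And>y. y \<in> W \<Longrightarrow> lform ((cx \<circ> u) y) (local_frames.ns (n c) l \<alpha> y) = 0"
    "\<And>y. y \<in> W \<Longrightarrow> lform (dz (cx \<circ> u) y) (local_frames.ns (n c) l \<alpha> y) = 0"
    "\<And>y. y \<in> W \<Longrightarrow> lform (dzbar (cx \<circ> u) y) (local_frames.ns (n c) l \<alpha> y) = 0"
    "\<And>y. y \<in> W \<Longrightarrow> lform (dz (dzbar (cx \<circ> u)) y) (local_frames.ns (n c) l \<alpha> y) = 0"
    using backlund_frame[OF c(1) u(3,2,1)] by metis
  interpret dressed_frames W "cx \<circ> \<sigma>" "n c" "f c" l h \<alpha> by (rule Wf(4))
  have nsns: "lform (ns z) (ns z) = 1"
    using R_orthogonal[OF Wf(1), of "ns z" "ns z"] R_ns[OF Wf(1)] NN by simp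
  then have ns0: "ns z \<noteq> 0" by auto
  have S': "central_sphere A \<Lambda>' p = orth {ns z}"
    using gram_span[OF null_frame_gram(1-7)[OF atlas im' hf] ns0 u_ns[OF Wf(1)]]
      hol_frame_bundles(3)[OF atlas im' hf] by simp
  have "unit_vector (ns z)" using nsns by unfold_locales
  then have np: "normal_part A \<Lambda>' v p = lform (cx v) (ns z) *s ns z"
    unfolding normal_part_def S' by (rule unit_vector.proj_normal)
  define w where "w = cx v - complex_of_real H *s n c z"
  \<comment> \<open>At parameter 1 the two coefficients of \<open>p_inf\<close> add up to
    \<open>H\<close>, so \<open>p_inf\<close> there is \<open>v\<close> itself.\<close>
  have hh: "cnj h + h = complex_of_real H" by (simp add: complex_eq_iff)
  have w: "lform w (n c z) = 0" "conjv w = w"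
    using v_N(1)[of "snd c z"] NN by (simp_all add: w_def lform_simps conjv_ops)
  have tp: "tangent_part A \<Lambda> v p = w"
    unfolding tangent_part_def sphere unit_vector.proj_hyperplane[OF unit_normal_at] v_N(1) w_def c(3) ..
  have "l z \<in> L p" using frameD(5)[OF Wf(3,1)] c(3) by simp
  then have "lform (p_inf A \<Lambda> v H N t \<alpha> p) (l z) = 0" using perp by blast
  moreover have "p_inf A \<Lambda> v H N t \<alpha> p = (cnj h / \<alpha> + h * \<alpha>) *s n c z + w"
    unfolding p_inf_def tp c(3) by (simp add: vec_eq_iff field_simps)
  ultimately have "lform ((cnj h + h) *s n c z + w) (ns z) = - (cnj h + h)"
    using dressed_vector[OF Wf(1) w] by simp
  \<comment> \<open>The vector paired with \<open>ns\<close> is \<open>v\<close> split into its old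
    normal and tangential parts.\<close>
  then have "lform (cx v) (ns z) = - complex_of_real H"
    unfolding hh by (simp add: w_def)
  then show ?thesis
    unfolding mean_curvature_def np using nsns v_N(2) by (simp add: lform_simps)
qed

end

theorem proposition8p40:
  fixes A :: "'m::{t2_space, second_countable_topology} chart set"
    and \<Lambda> :: "'m \<Rightarrow> (real ^ 5) set"
    and v :: "real ^ 5"
    and t H :: real
    and N :: "'m \<Rightarrow> real ^ 5"
    and \<alpha> :: complex
    and L :: "'m \<Rightarrow> (complex ^ 5) set"
  assumes "oriented_atlas A"
    and "surface A \<Lambda>"
    and isothermal: "\<forall>p. \<exists>(D, \<psi>)\<in>hol_charts A \<Lambda>. p \<in> \<psi> ` D"
    and "v \<noteq> 0"
    and in_space_form: "\<forall>p. \<forall>u\<in>\<Lambda> p. u \<noteq> 0 \<longrightarrow> lform u v \<noteq> 0"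
    and "cmc A \<Lambda> v H"
    and "unit_normal A \<Lambda> v N"
    and "real_backlund_parameters A \<Lambda> (q_inf \<Lambda> v H N t) \<alpha> L"
    and "\<forall>p. \<forall>l\<in>L p. lform (p_inf A \<Lambda> v H N t \<alpha> p) l = 0"
    and "immerses A (backlund_transform A \<Lambda> \<alpha> L)"
  shows "\<forall>p. mean_curvature A (backlund_transform A \<Lambda> \<alpha> L) v p = H"
proof -
  interpret cmc_backlund A \<Lambda> v t H N \<alpha> L
    using assms by unfold_locales (auto simp: surface_def)
  show ?thesis using mean_curvature_backlund[OF assms(10)] by blast
qed

end
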